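(* Let $q\in\Bbbk^\times$ with $q\ne\pm1$ and let $N,m\ge 3$. Then the generalized Taft algebra $T_n(\lambda,m,0)$ acts on $\mathcal O_q(M_N(\Bbbk))$ with $x$ acting linearly and nonzero, and with $g$ acting as an element of $\mathcal H\rtimes\langle\tau\rangle$, if and only if $\lambda=q^{\pm2}$ and $\operatorname{ord}(q)\mid n$. The actions are exactly those in the following list, where $\delta\in\Bbbk^\times$, the action of $g$ is $g\cdot Y_{ij}=\alpha_{ij}Y_{ij}$, and $x$ acts as zero on every generator not listed. (1) $\lambda=q^2$; for some fixed $b$ with $1<b\le N$: for all $i$, $\alpha_{i,b-1}=q$, $\alpha_{i,b}=q^{-1}$, and $\alpha_{ij}=1$ for $j\ne b-1,b$; $x\cdot Y_{a,b}=\delta Y_{a,b-1}$ for all $a$. (2) $\lambda=q^2$; for some fixed $a$ with $1<a\le N$: for all $j$, $\alpha_{a-1,j}=q$, $\alpha_{a,j}=q^{-1}$, and $\alpha_{ij}=1$ for $i\ne a-1,a$; $x\cdot Y_{a,b}=\delta Y_{a-1,b}$ for all $b$. (3) $\lambda=q^2$; the first row of $(\alpha_{ij})$ is $(q^{-3},q^{-2},\dots,q^{-2},q^{-1})$ and every other row is $(q^{-1},1,\dots,1,q)$; $x\cdot Y_{11}=\delta Y_{1N}$. (4) $\lambda=q^2$; the first column of $(\alpha_{ij})$ is $(q^{-3},q^{-2},\dots,q^{-2},q^{-1})^{T}$ and every other column is $(q^{-1},1,\dots,1,q)^{T}$; $x\cdot Y_{11}=\delta Y_{N1}$. (5) $\lambda=q^{-2}$;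 for some fixed $b$ with $1\le b<N$: for all $i$, $\alpha_{i,b}=q$, $\alpha_{i,b+1}=q^{-1}$, and $\alpha_{ij}=1$ for $j\ne b,b+1$; $x\cdot Y_{a,b}=\delta Y_{a,b+1}$ for all $a$. (6) $\lambda=q^{-2}$; for some fixed $a$ with $1\le a<N$: for all $j$, $\alpha_{a,j}=q$, $\alpha_{a+1,j}=q^{-1}$, and $\alpha_{ij}=1$ for $i\ne a,a+1$; $x\cdot Y_{a,b}=\delta Y_{a+1,b}$ for all $b$. (7) $\lambda=q^{-2}$; the last column of $(\alpha_{ij})$ is $(q,q^2,\dots,q^2,q^3)^{T}$ and every other column is $(q^{-1},1,\dots,1,q)^{T}$; $x\cdot Y_{NN}=\delta Y_{1N}$. (8) $\lambda=q^{-2}$; the last row of $(\alpha_{ij})$ is $(q,q^2,\dots,q^2,q^3)$ and every other row is $(q^{-1},1,\dots,1,q)$; $x\cdot Y_{NN}=\delta Y_{N1}$.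
   Context: $\Bbbk$ is an algebraically closed field of characteristic zero; $\operatorname{ord}$ denotes multiplicative order. $\mathcal O_q(M_N(\Bbbk))$ is the algebra generated by $Y_{ij}$, $1\le i,j\le N$, with relations: $Y_{ij}Y_{\ell m}=qY_{\ell m}Y_{ij}$ if ($i<\ell$, $j=m$) or ($i=\ell$, $j<m$); $Y_{ij}Y_{\ell m}=Y_{\ell m}Y_{ij}$ if $i<\ell$, $j>m$; and $Y_{ij}Y_{\ell m}=Y_{\ell m}Y_{ij}+(q-q^{-1})Y_{im}Y_{\ell j}$ if $i<\ell$, $j<m$. $\mathcal H\cong(\Bbbk^\times)^{2N-1}$ is the group of automorphisms of the form $Y_{ij}\mapsto\alpha_{ij}Y_{ij}$ where $(\alpha_{ij})$ is an $N\times N$ matrix of rank one with no zero entries; $\tau$ is the automorphism $Y_{ij}\mapsto Y_{ji}$. Generalized Taft algebra: for $m\mid n$ and $\lambda$ a primitive $m$th root of unity, $T_n(\lambda,m,0)$ is the Hopf algebra generated by a grouplike $g$ and $x$ with $\Delta(x)=g\otimes x+x\otimes1$, with relations $g^n=1$, $x^m=0$, $gx=\lambda xg$. It acts on an algebra $R$ if $R$ is a left $T_n(\lambda,m,0)$-module algebra. "$x$ acts linearly and nonzero" means $x$ maps $\operatorname{Span}_\Bbbk\{Y_{ij}\}$ into itself and does not act as zero. *)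

theory Defs
  imports
    "HOL-Library.FuncSet"
    "HOL-Library.Poly_Mapping"
    "HOL-Computational_Algebra.Polynomial"
    "HOL-Algebra.QuotRing"
    "HOL-Algebra.Bij"
    "HOL-Algebra.Generated_Groups"
    "HOL-Algebra.Multiplicative_Group"
    "Jordan_Normal_Form.DL_Rank"
begin

text \<open>
  An associative algebra over the field \<open>'k\<close> is carried by a record of type \<open>('k, 'a) module\<close>;
  the scalars are the whole type \<open>'k\<close>. The library locale \<open>algebra\<close> is not used, since it
  requires commutativity.
\<close>

section \<open>Presented algebras\<close>

definition monoid_alg :: "('a, 'z) monoid_scheme \<Rightarrow> ('k::field, 'a \<Rightarrow>\<^sub>0 'k) module" where
  "monoid_alg M =
    \<lparr>carrier = {p. Poly_Mapping.keys p \<subseteq> carrier M},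
     mult = (\<lambda>p q. \<Sum>u\<in>Poly_Mapping.keys p. \<Sum>v\<in>Poly_Mapping.keys q.
       Poly_Mapping.single (u \<otimes>\<^bsub>M\<^esub> v) (Poly_Mapping.lookup p u * Poly_Mapping.lookup q v)),
     one = Poly_Mapping.single \<one>\<^bsub>M\<^esub> 1,
     zero = 0,
     add = (+),
     smult = (\<lambda>c. Poly_Mapping.map ((*) c))\<rparr>"

definition free_alg :: "'x set \<Rightarrow> ('k::field, 'x list \<Rightarrow>\<^sub>0 'k) module" where
  "free_alg X = monoid_alg \<lparr>carrier = lists X, mult = (@), one = []\<rparr>"

abbreviation term_of_word :: "'k::field \<Rightarrow> 'x list \<Rightarrow> ('x list \<Rightarrow>\<^sub>0 'k)" where
  "term_of_word c w \<equiv> Poly_Mapping.single w c"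

definition quot_alg :: "('k::field, 'a) module \<Rightarrow> 'a set \<Rightarrow> ('k, 'a set) module" where
  "quot_alg A I =
    \<lparr>carrier = carrier (A Quot I), mult = mult (A Quot I), one = one (A Quot I),
     zero = zero (A Quot I), add = add (A Quot I),
     smult = (\<lambda>c S. \<Union>a\<in>S. I +>\<^bsub>A\<^esub> (c \<odot>\<^bsub>A\<^esub> a))\<rparr>"

text \<open>\<open>Idl\<close> is the generated two-sided ideal; in these unital algebras it is closed under scalars.\<close>

definition pres_alg ::
    "'x set \<Rightarrow> ('x list \<Rightarrow>\<^sub>0 'k) set \<Rightarrow> ('k::field, ('x list \<Rightarrow>\<^sub>0 'k) set) module" where
  "pres_alg X R = quot_alg (free_alg X) (Idl\<^bsub>free_alg X\<^esub> R)"

definition pres_gen ::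
    "'x set \<Rightarrow> ('x list \<Rightarrow>\<^sub>0 'k) set \<Rightarrow> 'x \<Rightarrow> ('x list \<Rightarrow>\<^sub>0 'k::field) set" where
  "pres_gen X R x = (Idl\<^bsub>free_alg X\<^esub> R) +>\<^bsub>free_alg X\<^esub> term_of_word 1 [x]"

text \<open>The algebra homomorphism from the free algebra into \<open>B\<close> sending each generator \<open>x\<close>
  to \<open>\<phi> x\<close>.\<close>

definition free_lift ::
    "('k::field, 'b) module \<Rightarrow> ('x \<Rightarrow> 'b) \<Rightarrow> ('x list \<Rightarrow>\<^sub>0 'k) \<Rightarrow> 'b" where
  "free_lift B \<phi> p =
    (\<Oplus>\<^bsub>B\<^esub>w\<in>Poly_Mapping.keys p.
       Poly_Mapping.lookup p w \<odot>\<^bsub>B\<^esub> foldr (\<lambda>x b. \<phi> x \<otimes>\<^bsub>B\<^esub> b) w \<one>\<^bsub>B\<^esub>)"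

definition scalar_alg :: "('k::field, 'k) module" where
  "scalar_alg = \<lparr>carrier = UNIV, mult = (*), one = 1, zero = 0, add = (+), smult = (*)\<rparr>"

definition op_alg :: "('k::field, 'a) module \<Rightarrow> ('k, 'a) module" where
  "op_alg A = A\<lparr>mult := (\<lambda>a b. b \<otimes>\<^bsub>A\<^esub> a)\<rparr>"


section \<open>Tensor products of algebras\<close>

text \<open>
  \<open>A \<otimes> B\<close> is the space of formal linear combinations of pairs modulo bilinearity. The pairs are
  multiplied componentwise; the span of the bilinearity relations is stable under
  multiplication by pairs, so it coincides with the ideal generated by them.
\<close>

definition tensor_rels ::
    "('k::field, 'a) module \<Rightarrow> ('k, 'b) module \<Rightarrow> (('a \<times> 'b) \<Rightarrow>\<^sub>0 'k) set" where
  "tensor_rels A B =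
     {Poly_Mapping.single (a \<oplus>\<^bsub>A\<^esub> a', b) 1 - Poly_Mapping.single (a, b) 1
        - Poly_Mapping.single (a', b) 1 | a a' b.
        a \<in> carrier A \<and> a' \<in> carrier A \<and> b \<in> carrier B}
   \<union> {Poly_Mapping.single (a, b \<oplus>\<^bsub>B\<^esub> b') 1 - Poly_Mapping.single (a, b) 1
        - Poly_Mapping.single (a, b') 1 | a b b'.
        a \<in> carrier A \<and> b \<in> carrier B \<and> b' \<in> carrier B}
   \<union> {Poly_Mapping.single (c \<odot>\<^bsub>A\<^esub> a, b) 1 - Poly_Mapping.single (a, b) c | c a b.
        a \<in> carrier A \<and> b \<in> carrier B}
   \<union> {Poly_Mapping.single (a, c \<odot>\<^bsub>B\<^esub> b) 1 - Poly_Mapping.single (a, b) c | c a b.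
        a \<in> carrier A \<and> b \<in> carrier B}"

definition tensor_alg ::
    "('k::field, 'a) module \<Rightarrow> ('k, 'b) module \<Rightarrow> ('k, (('a \<times> 'b) \<Rightarrow>\<^sub>0 'k) set) module" where
  "tensor_alg A B =
     quot_alg (monoid_alg (A \<times>\<times> B)) (Idl\<^bsub>monoid_alg (A \<times>\<times> B)\<^esub> (tensor_rels A B))"

definition tensor ::
    "('k::field, 'a) module \<Rightarrow> ('k, 'b) module \<Rightarrow> 'a \<Rightarrow> 'b \<Rightarrow> (('a \<times> 'b) \<Rightarrow>\<^sub>0 'k) set" where
  "tensor A B a b =
     (Idl\<^bsub>monoid_alg (A \<times>\<times> B)\<^esub> (tensor_rels A B)) +>\<^bsub>monoid_alg (A \<times>\<times> B)\<^esub>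
       Poly_Mapping.single (a, b) 1"


section \<open>Hopf algebras and module algebras\<close>

text \<open>
  \<open>comult\<close> takes values in the tensor square of the underlying algebra: \<open>comult H h\<close> is a
  class of formal sums, whose members are the expressions \<open>\<Sum> h\<^sub>1 \<otimes> h\<^sub>2\<close> of \<open>\<Delta>(h)\<close>.
\<close>

record (overloaded) ('k, 'h) hopf = "('k, 'h) module" +
  comult :: "'h \<Rightarrow> (('h \<times> 'h) \<Rightarrow>\<^sub>0 'k) set"
  counit :: "'h \<Rightarrow> 'k"
  antipode :: "'h \<Rightarrow> 'h"

definition module_algebra ::
    "('k::field, 'h) hopf \<Rightarrow> ('k, 'a) module \<Rightarrow> ('h \<Rightarrow> 'a \<Rightarrow> 'a) \<Rightarrow> bool" where
  "module_algebra H A \<rho> \<longleftrightarrow>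
     \<rho> \<in> carrier H \<rightarrow>\<^sub>E (carrier A \<rightarrow>\<^sub>E carrier A) \<and>
     (\<forall>h\<in>carrier H. \<forall>a\<in>carrier A. \<forall>b\<in>carrier A. \<rho> h (a \<oplus>\<^bsub>A\<^esub> b) = \<rho> h a \<oplus>\<^bsub>A\<^esub> \<rho> h b) \<and>
     (\<forall>h\<in>carrier H. \<forall>h'\<in>carrier H. \<forall>a\<in>carrier A. \<rho> (h \<oplus>\<^bsub>H\<^esub> h') a = \<rho> h a \<oplus>\<^bsub>A\<^esub> \<rho> h' a) \<and>
     (\<forall>c. \<forall>h\<in>carrier H. \<forall>a\<in>carrier A.
        \<rho> h (c \<odot>\<^bsub>A\<^esub> a) = c \<odot>\<^bsub>A\<^esub> \<rho> h a \<and> \<rho> (c \<odot>\<^bsub>H\<^esub> h) a = c \<odot>\<^bsub>A\<^esub> \<rho> h a) \<and>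
     (\<forall>a\<in>carrier A. \<rho> \<one>\<^bsub>H\<^esub> a = a) \<and>
     (\<forall>h\<in>carrier H. \<forall>h'\<in>carrier H. \<forall>a\<in>carrier A. \<rho> (h \<otimes>\<^bsub>H\<^esub> h') a = \<rho> h (\<rho> h' a)) \<and>
     (\<forall>h\<in>carrier H. \<rho> h \<one>\<^bsub>A\<^esub> = counit H h \<odot>\<^bsub>A\<^esub> \<one>\<^bsub>A\<^esub>) \<and>
     (\<forall>h\<in>carrier H. \<forall>a\<in>carrier A. \<forall>b\<in>carrier A. \<forall>s\<in>comult H h.
        \<rho> h (a \<otimes>\<^bsub>A\<^esub> b) =
          (\<Oplus>\<^bsub>A\<^esub>w\<in>Poly_Mapping.keys s.
             Poly_Mapping.lookup s w \<odot>\<^bsub>A\<^esub> (\<rho> (fst w) a \<otimes>\<^bsub>A\<^esub> \<rho> (snd w) b)))"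


section \<open>The generalized Taft algebras\<close>

text \<open>The library order of an element is \<open>0\<close> when no positive power of it is \<open>1\<close>.\<close>

definition mult_ord :: "'k::field \<Rightarrow> nat" where
  "mult_ord a = group.ord (mult_of class_ring) a"

datatype taft_gen = Gr | Sk

definition taft_rels :: "nat \<Rightarrow> 'k::field \<Rightarrow> nat \<Rightarrow> (taft_gen list \<Rightarrow>\<^sub>0 'k) set" where
  "taft_rels n l m =
     {term_of_word 1 (replicate n Gr) - term_of_word 1 [],
      term_of_word 1 (replicate m Sk),
      term_of_word 1 [Gr, Sk] - term_of_word l [Sk, Gr]}"

definition taft_alg ::
    "nat \<Rightarrow> 'k::field \<Rightarrow> nat \<Rightarrow> ('k, (taft_gen list \<Rightarrow>\<^sub>0 'k) set) module" where
  "taft_alg n l m = pres_alg UNIV (taft_rels n l m)"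

definition taft_g :: "nat \<Rightarrow> 'k::field \<Rightarrow> nat \<Rightarrow> (taft_gen list \<Rightarrow>\<^sub>0 'k) set" where
  "taft_g n l m = pres_gen UNIV (taft_rels n l m) Gr"

definition taft_x :: "nat \<Rightarrow> 'k::field \<Rightarrow> nat \<Rightarrow> (taft_gen list \<Rightarrow>\<^sub>0 'k) set" where
  "taft_x n l m = pres_gen UNIV (taft_rels n l m) Sk"

text \<open>
  The structure maps are induced on cosets by homomorphisms out of the free algebra:
  \<open>\<Delta>(g) = g \<otimes> g\<close>, \<open>\<Delta>(x) = g \<otimes> x + x \<otimes> 1\<close>, \<open>\<epsilon>(g) = 1\<close>, \<open>\<epsilon>(x) = 0\<close>,
  \<open>S(g) = g\<^sup>-\<^sup>1 = g\<^bsup>n-1\<^esup>\<close>, \<open>S(x) = -g\<^sup>-\<^sup>1x\<close>. The homomorphism is constant on each coset of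
  the relation ideal, so that for a set-valued target the union over the coset is its common value.
\<close>

definition taft ::
    "nat \<Rightarrow> 'k::field \<Rightarrow> nat \<Rightarrow> ('k, (taft_gen list \<Rightarrow>\<^sub>0 'k) set) hopf" where
  "taft n l m =
    (let T = taft_alg n l m; g = taft_g n l m; x = taft_x n l m in
     \<lparr>carrier = carrier T, mult = mult T, one = one T, zero = zero T, add = add T,
      smult = smult T,
      comult = (\<lambda>h. \<Union>f\<in>h. free_lift (tensor_alg T T)
        (case_taft_gen (tensor T T g g)
          (tensor T T g x \<oplus>\<^bsub>tensor_alg T T\<^esub> tensor T T x \<one>\<^bsub>T\<^esub>)) f),
      counit = (\<lambda>h. the_elem (free_lift scalar_alg (case_taft_gen 1 0) ` h)),
      antipode = (\<lambda>h. \<Union>f\<in>h. free_lift (op_alg T)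
        (case_taft_gen (g [^]\<^bsub>T\<^esub> (n - 1)) (\<ominus>\<^bsub>T\<^esub> (g [^]\<^bsub>T\<^esub> (n - 1) \<otimes>\<^bsub>T\<^esub> x))) f)\<rparr>)"


section \<open>Quantum matrices\<close>

definition qmat_rels :: "'k::field \<Rightarrow> nat \<Rightarrow> ((nat \<times> nat) list \<Rightarrow>\<^sub>0 'k) set" where
  "qmat_rels q N =
     {term_of_word 1 [(i, j), (l, m)] - term_of_word q [(l, m), (i, j)] | i j l m.
        {i, j, l, m} \<subseteq> {1..N} \<and> (i < l \<and> j = m \<or> i = l \<and> j < m)}
   \<union> {term_of_word 1 [(i, j), (l, m)] - term_of_word 1 [(l, m), (i, j)] | i j l m.
        {i, j, l, m} \<subseteq> {1..N} \<and> i < l \<and> j > m}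
   \<union> {term_of_word 1 [(i, j), (l, m)] - term_of_word 1 [(l, m), (i, j)]
        - term_of_word (q - inverse q) [(i, m), (l, j)] | i j l m.
        {i, j, l, m} \<subseteq> {1..N} \<and> i < l \<and> j < m}"

definition qmat :: "'k::field \<Rightarrow> nat \<Rightarrow> ('k, ((nat \<times> nat) list \<Rightarrow>\<^sub>0 'k) set) module" where
  "qmat q N = pres_alg ({1..N} \<times> {1..N}) (qmat_rels q N)"

definition qY :: "'k::field \<Rightarrow> nat \<Rightarrow> nat \<Rightarrow> nat \<Rightarrow> ((nat \<times> nat) list \<Rightarrow>\<^sub>0 'k) set" where
  "qY q N i j = pres_gen ({1..N} \<times> {1..N}) (qmat_rels q N) (i, j)"

definition qY_span :: "'k::field \<Rightarrow> nat \<Rightarrow> ((nat \<times> nat) list \<Rightarrow>\<^sub>0 'k) set set" where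
  "qY_span q N =
     {\<Oplus>\<^bsub>qmat q N\<^esub>u\<in>{1..N} \<times> {1..N}. c u \<odot>\<^bsub>qmat q N\<^esub> qY q N (fst u) (snd u) | c. True}"

definition alg_Aut :: "('k::field, 'a) module \<Rightarrow> ('a \<Rightarrow> 'a) monoid" where
  "alg_Aut A = BijGroup (carrier A)
     \<lparr>carrier := {\<phi> \<in> Ring.ring_hom A A \<inter> Bij (carrier A).
        \<forall>c. \<forall>a\<in>carrier A. \<phi> (c \<odot>\<^bsub>A\<^esub> a) = c \<odot>\<^bsub>A\<^esub> \<phi> a}\<rparr>"

text \<open>The group \<open>\<H>\<close>; the matrices of \<^theory>\<open>Jordan_Normal_Form.Matrix\<close> are indexed from \<open>0\<close>.\<close>

definition qmat_torus ::
    "'k::field \<Rightarrow> nat \<Rightarrow> (((nat \<times> nat) list \<Rightarrow>\<^sub>0 'k) set \<Rightarrow> ((nat \<times> nat) list \<Rightarrow>\<^sub>0 'k) set) set" where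
  "qmat_torus q N =
     {\<phi> \<in> carrier (alg_Aut (qmat q N)). \<exists>\<alpha> :: nat \<Rightarrow> nat \<Rightarrow> 'k.
        vec_space.rank N (mat N N (\<lambda>(i, j). \<alpha> (i + 1) (j + 1))) = 1 \<and>
        (\<forall>i\<in>{1..N}. \<forall>j\<in>{1..N}.
           \<alpha> i j \<noteq> 0 \<and> \<phi> (qY q N i j) = \<alpha> i j \<odot>\<^bsub>qmat q N\<^esub> qY q N i j)}"

definition qmat_transp ::
    "'k::field \<Rightarrow> nat \<Rightarrow> ((nat \<times> nat) list \<Rightarrow>\<^sub>0 'k) set \<Rightarrow> ((nat \<times> nat) list \<Rightarrow>\<^sub>0 'k) set" where
  "qmat_transp q N =
     (\<lambda>a\<in>carrier (qmat q N). \<Union>f\<in>a. free_lift (qmat q N) (\<lambda>(i, j). qY q N j i) f)"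

text \<open>\<open>\<H> \<rtimes> \<langle>\<tau>\<rangle>\<close>, as an internal semidirect product in the group of algebra automorphisms.\<close>

definition qmat_torus_transp ::
    "'k::field \<Rightarrow> nat \<Rightarrow> (((nat \<times> nat) list \<Rightarrow>\<^sub>0 'k) set \<Rightarrow> ((nat \<times> nat) list \<Rightarrow>\<^sub>0 'k) set) set" where
  "qmat_torus_transp q N =
     qmat_torus q N <#>\<^bsub>alg_Aut (qmat q N)\<^esub> generate (alg_Aut (qmat q N)) {qmat_transp q N}"


section \<open>Linear Taft actions on quantum matrices\<close>

definition linear_taft_action ::
    "'k::field \<Rightarrow> nat \<Rightarrow> nat \<Rightarrow> 'k \<Rightarrow> nat \<Rightarrow>
     ((taft_gen list \<Rightarrow>\<^sub>0 'k) set \<Rightarrow> ((nat \<times> nat) list \<Rightarrow>\<^sub>0 'k) set \<Rightarrow> ((nat \<times> nat) list \<Rightarrow>\<^sub>0 'k) set)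
     \<Rightarrow> bool" where
  "linear_taft_action q N n l m \<rho> \<longleftrightarrow>
     module_algebra (taft n l m) (qmat q N) \<rho> \<and>
     \<rho> (taft_x n l m) ` qY_span q N \<subseteq> qY_span q N \<and>
     (\<exists>a\<in>carrier (qmat q N). \<rho> (taft_x n l m) a \<noteq> \<zero>\<^bsub>qmat q N\<^esub>) \<and>
     \<rho> (taft_g n l m) \<in> qmat_torus_transp q N"

text \<open>\<open>g\<close> acts on the generators by the weights \<open>\<alpha>\<close>, and \<open>x\<close> sends \<open>Y\<^sub>i\<^sub>j\<close> to \<open>v i j\<close>.\<close>

definition acts_on_gens ::
    "'k::field \<Rightarrow> nat \<Rightarrow> nat \<Rightarrow> 'k \<Rightarrow> nat \<Rightarrow>
     ((taft_gen list \<Rightarrow>\<^sub>0 'k) set \<Rightarrow> ((nat \<times> nat) list \<Rightarrow>\<^sub>0 'k) set \<Rightarrow> ((nat \<times> nat) list \<Rightarrow>\<^sub>0 'k) set)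
     \<Rightarrow> (nat \<Rightarrow> nat \<Rightarrow> 'k) \<Rightarrow> (nat \<Rightarrow> nat \<Rightarrow> ((nat \<times> nat) list \<Rightarrow>\<^sub>0 'k) set) \<Rightarrow> bool" where
  "acts_on_gens q N n l m \<rho> \<alpha> v \<longleftrightarrow>
     (\<forall>i\<in>{1..N}. \<forall>j\<in>{1..N}.
        \<rho> (taft_g n l m) (qY q N i j) = \<alpha> i j \<odot>\<^bsub>qmat q N\<^esub> qY q N i j \<and>
        \<rho> (taft_x n l m) (qY q N i j) = v i j)"

text \<open>The vector \<open>(a, b, \<dots>, b, c)\<close> of length \<open>N\<close>, indexed from \<open>1\<close>.\<close>

definition ends :: "nat \<Rightarrow> 'k \<Rightarrow> 'k \<Rightarrow> 'k \<Rightarrow> nat \<Rightarrow> 'k" where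
  "ends N a b c i = (if i = 1 then a else if i = N then c else b)"

inductive listed ::
    "'k::field \<Rightarrow> nat \<Rightarrow> 'k \<Rightarrow> (nat \<Rightarrow> nat \<Rightarrow> 'k) \<Rightarrow>
     (nat \<Rightarrow> nat \<Rightarrow> ((nat \<times> nat) list \<Rightarrow>\<^sub>0 'k) set) \<Rightarrow> bool"
  for q :: "'k::field" and N :: nat and l :: 'k
where
  col_left: "l = q ^ 2 \<Longrightarrow> 1 < b \<Longrightarrow> b \<le> N \<Longrightarrow> \<delta> \<noteq> 0 \<Longrightarrow>
    listed q N l
      (\<lambda>i j. if j = b - 1 then q else if j = b then q powi (-1) else 1)
      (\<lambda>i j. if j = b then \<delta> \<odot>\<^bsub>qmat q N\<^esub> qY q N i (b - 1) else \<zero>\<^bsub>qmat q N\<^esub>)"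
| row_up: "l = q ^ 2 \<Longrightarrow> 1 < a \<Longrightarrow> a \<le> N \<Longrightarrow> \<delta> \<noteq> 0 \<Longrightarrow>
    listed q N l
      (\<lambda>i j. if i = a - 1 then q else if i = a then q powi (-1) else 1)
      (\<lambda>i j. if i = a then \<delta> \<odot>\<^bsub>qmat q N\<^esub> qY q N (a - 1) j else \<zero>\<^bsub>qmat q N\<^esub>)"
| first_to_right: "l = q ^ 2 \<Longrightarrow> \<delta> \<noteq> 0 \<Longrightarrow>
    listed q N l
      (\<lambda>i j. if i = 1 then ends N (q powi (-3)) (q powi (-2)) (q powi (-1)) j
             else ends N (q powi (-1)) 1 q j)
      (\<lambda>i j. if i = 1 \<and> j = 1 then \<delta> \<odot>\<^bsub>qmat q N\<^esub> qY q N 1 N else \<zero>\<^bsub>qmat q N\<^esub>)"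
| first_to_bottom: "l = q ^ 2 \<Longrightarrow> \<delta> \<noteq> 0 \<Longrightarrow>
    listed q N l
      (\<lambda>i j. if j = 1 then ends N (q powi (-3)) (q powi (-2)) (q powi (-1)) i
             else ends N (q powi (-1)) 1 q i)
      (\<lambda>i j. if i = 1 \<and> j = 1 then \<delta> \<odot>\<^bsub>qmat q N\<^esub> qY q N N 1 else \<zero>\<^bsub>qmat q N\<^esub>)"
| col_right: "l = q powi (-2) \<Longrightarrow> 1 \<le> b \<Longrightarrow> b < N \<Longrightarrow> \<delta> \<noteq> 0 \<Longrightarrow>
    listed q N l
      (\<lambda>i j. if j = b then q else if j = b + 1 then q powi (-1) else 1)
      (\<lambda>i j. if j = b then \<delta> \<odot>\<^bsub>qmat q N\<^esub> qY q N i (b + 1) else \<zero>\<^bsub>qmat q N\<^esub>)"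
| row_down: "l = q powi (-2) \<Longrightarrow> 1 \<le> a \<Longrightarrow> a < N \<Longrightarrow> \<delta> \<noteq> 0 \<Longrightarrow>
    listed q N l
      (\<lambda>i j. if i = a then q else if i = a + 1 then q powi (-1) else 1)
      (\<lambda>i j. if i = a then \<delta> \<odot>\<^bsub>qmat q N\<^esub> qY q N (a + 1) j else \<zero>\<^bsub>qmat q N\<^esub>)"
| last_to_top: "l = q powi (-2) \<Longrightarrow> \<delta> \<noteq> 0 \<Longrightarrow>
    listed q N l
      (\<lambda>i j. if j = N then ends N q (q ^ 2) (q ^ 3) i
             else ends N (q powi (-1)) 1 q i)
      (\<lambda>i j. if i = N \<and> j = N then \<delta> \<odot>\<^bsub>qmat q N\<^esub> qY q N 1 N else \<zero>\<^bsub>qmat q N\<^esub>)"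
| last_to_left: "l = q powi (-2) \<Longrightarrow> \<delta> \<noteq> 0 \<Longrightarrow>
    listed q N l
      (\<lambda>i j. if i = N then ends N q (q ^ 2) (q ^ 3) j
             else ends N (q powi (-1)) 1 q j)
      (\<lambda>i j. if i = N \<and> j = N then \<delta> \<odot>\<^bsub>qmat q N\<^esub> qY q N N 1 else \<zero>\<^bsub>qmat q N\<^esub>)"

end

theory Submission
  imports Defs
begin

text \<open>
  A module algebra over the Taft algebra is the same as an algebra automorphism \<open>G\<close> and a
  \<open>(G, id)\<close>-skew derivation \<open>D\<close> with \<open>G\<^sup>n = 1\<close>, \<open>D\<^sup>m = 0\<close> and \<open>GD = \<lambda>DG\<close>, because the coproducts of \<open>g\<close>
  and \<open>x\<close> are the product rules of \<open>G\<close> and \<open>D\<close>. On an algebra given by generators and relations, both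
  maps are the extensions of their values on the generators, and they exist as soon as they send the
  relations into the ideal (\<open>module_algebra_rho\<close>, \<open>rho_gx_ext\<close>, \<open>taft_module_algebra_unique\<close>). For the
  listed maps the three identities hold already on the free algebra.

  The relations of quantum matrices are quadratic, and \<open>G\<close> and \<open>D\<close> preserve the degree. Hence the whole
  question is about the span of the relations in degree two, which is described by a rewriting of
  words \<open>Y\<^sub>u Y\<^sub>v\<close> into decreasing words (\<open>nf_I\<close>, \<open>quadratic_in_I\<close>). An action becomes a finite system of equations for the weights \<open>\<alpha>\<close> of \<open>g\<close> and the
  matrix \<open>c\<close> of \<open>x\<close>.

  To solve it, note that rewriting preserves the multisets of row and of column indices, so the
  system holds for each homogeneous component of \<open>c\<close> separately. A component that moves both indices
  is impossible (\<open>no_diagonal_shift\<close>). A component that moves column \<open>j\<close> to column \<open>l\<close> either moves all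
  rows alike and has \<open>l = j \<plusminus> 1\<close>, or moves one corner to the other corner of the same row (\<open>adjacent\<close>,
  \<open>distant\<close>). In each case the weights and \<open>\<lambda> = q\<^bsup>\<plusminus>2\<^esup>\<close> are determined, and transposition and
  the reversal of the index order, which exchanges \<open>q\<close> and \<open>q\<^sup>-\<^sup>1\<close>, yield the remaining cases. Two
  different components would require the same weights and the same \<open>\<lambda>\<close>, which never happens because
  \<open>\<lambda>\<^sup>2 \<noteq> 1\<close> (\<open>pattern_unique\<close>). If \<open>g\<close> involves the transposition, the equations leave no nonzero entry in
  \<open>c\<close> (\<open>no_transposed_action\<close>).

  Conversely, the listed maps satisfy the equations. All their weights are powers of \<open>q\<close>, among them
  \<open>q\<close> or \<open>q\<^sup>-\<^sup>1\<close>, so \<open>G\<^sup>n = 1\<close> means \<open>q\<^sup>n = 1\<close>. Since \<open>D\<^sup>2\<close> kills the generators, \<open>D\<^sup>m\<close> applied to a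
  product produces only the factor \<open>1 + \<lambda> + \<dots> + \<lambda>\<^bsup>m-1\<^esup>\<close>, which vanishes for a primitive \<open>m\<close>-th root of unity
  (\<open>skew_ext_nilpotent\<close>).
\<close>

abbreviation (input) supp :: "('a \<Rightarrow>\<^sub>0 'k::zero) \<Rightarrow> 'a set" where "supp \<equiv> Poly_Mapping.keys"
abbreviation (input) cf :: "('a \<Rightarrow>\<^sub>0 'k::zero) \<Rightarrow> 'a \<Rightarrow> 'k" where "cf \<equiv> Poly_Mapping.lookup"
abbreviation (input) mon :: "'a \<Rightarrow> 'k::zero \<Rightarrow> ('a \<Rightarrow>\<^sub>0 'k)" where "mon \<equiv> Poly_Mapping.single"
abbreviation pscale :: "'k::field \<Rightarrow> ('a \<Rightarrow>\<^sub>0 'k) \<Rightarrow> ('a \<Rightarrow>\<^sub>0 'k)" (infixr "\<cdot>" 75)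
  where "c \<cdot> f \<equiv> Poly_Mapping.map ((*) c) f"

section \<open>Linear maps between spaces of formal sums\<close>

lemma cf_scale [simp]: "cf (c \<cdot> f) w = c * cf f w"
  by transfer (auto simp: when_def)

lemma scale_add [simp]: "c \<cdot> (f + g) = c \<cdot> f + c \<cdot> g"
  by (rule poly_mapping_eqI) (simp add: lookup_add algebra_simps)

lemma scale_diff [simp]: "c \<cdot> (f - g) = c \<cdot> f - c \<cdot> g"
  by (rule poly_mapping_eqI) (simp add: lookup_minus algebra_simps)

lemma scale_add_left: "(c + d) \<cdot> f = c \<cdot> f + d \<cdot> f"
  by (rule poly_mapping_eqI) (simp add: lookup_add algebra_simps)

lemma scale_scale [simp]: "c \<cdot> d \<cdot> f = (c * d) \<cdot> f"
  by (rule poly_mapping_eqI) (simp add: algebra_simps)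

lemma scale_zero [simp]: "c \<cdot> 0 = 0" "0 \<cdot> f = 0"
  by (rule poly_mapping_eqI, simp)+

lemma scale_one [simp]: "1 \<cdot> f = f"
  by (rule poly_mapping_eqI) simp

lemma scale_minus_one [simp]: "(-1) \<cdot> f = - f"
  by (rule poly_mapping_eqI) simp

lemma scale_mon [simp]: "c \<cdot> mon w d = mon w (c * d)"
  by simp

lemma scale_sum: "c \<cdot> (\<Sum>x\<in>S. f x) = (\<Sum>x\<in>S. c \<cdot> f x)"
  by (induction S rule: infinite_finite_induct) simp_all

lemma supp_scale: "supp (c \<cdot> f) \<subseteq> supp f"
  by (auto simp: in_keys_iff)

text \<open>
  All maps below are linear extensions of maps given on a basis (words, pairs), so that identities
  between them are checked on basis elements.
\<close>

definition lin :: "('a \<Rightarrow> ('b \<Rightarrow>\<^sub>0 'k::field)) \<Rightarrow> ('a \<Rightarrow>\<^sub>0 'k) \<Rightarrow> ('b \<Rightarrow>\<^sub>0 'k)" where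
  "lin \<phi> f = (\<Sum>w\<in>supp f. cf f w \<cdot> \<phi> w)"

definition linmap :: "(('a \<Rightarrow>\<^sub>0 'k::field) \<Rightarrow> ('b \<Rightarrow>\<^sub>0 'k)) \<Rightarrow> bool" where
  "linmap L \<longleftrightarrow> (\<forall>f g. L (f + g) = L f + L g) \<and> (\<forall>c f. L (c \<cdot> f) = c \<cdot> L f)"

lemma linmap_add: "linmap L \<Longrightarrow> L (f + g) = L f + L g"
  and linmap_scale: "linmap L \<Longrightarrow> L (c \<cdot> f) = c \<cdot> L f"
  by (simp_all add: linmap_def)

lemma linmap_zero: "linmap L \<Longrightarrow> L 0 = 0"
  using linmap_scale[of L 0 0] by simp

lemma linmap_diff: "linmap L \<Longrightarrow> L (f - g) = L f - L g"
  using linmap_add[of L f "(-1) \<cdot> g"] linmap_scale[of L "-1" g] by simp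

lemma linmap_sum: "linmap L \<Longrightarrow> L (\<Sum>x\<in>S. f x) = (\<Sum>x\<in>S. L (f x))"
  by (induction S rule: infinite_finite_induct) (simp_all add: linmap_zero linmap_add)

lemma lin_superset:
  fixes f :: "'a \<Rightarrow>\<^sub>0 'k::field"
  assumes "finite S" "supp f \<subseteq> S"
  shows "lin \<phi> f = (\<Sum>w\<in>S. cf f w \<cdot> \<phi> w)"
  unfolding lin_def using assms
  by (intro sum.mono_neutral_left) (auto simp: in_keys_iff)

lemma linmap_lin [simp]:
  fixes \<phi> :: "'a \<Rightarrow> ('b \<Rightarrow>\<^sub>0 'k::field)"
  shows "linmap (lin \<phi>)"
  unfolding linmap_def
proof safe
  fix f g :: "'a \<Rightarrow>\<^sub>0 'k" and c
  let ?S = "supp f \<union> supp g"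
  have "lin \<phi> (f + g) = (\<Sum>w\<in>?S. cf (f + g) w \<cdot> \<phi> w)"
    by (rule lin_superset) (use keys_add[of f g] in auto)
  also have "\<dots> = (\<Sum>w\<in>?S. cf f w \<cdot> \<phi> w) + (\<Sum>w\<in>?S. cf g w \<cdot> \<phi> w)"
    by (simp add: lookup_add scale_add_left sum.distrib)
  also have "\<dots> = lin \<phi> f + lin \<phi> g"
    by (simp add: lin_superset[of ?S])
  finally show "lin \<phi> (f + g) = lin \<phi> f + lin \<phi> g" .
  have "lin \<phi> (c \<cdot> f) = (\<Sum>w\<in>supp f. cf (c \<cdot> f) w \<cdot> \<phi> w)"
    by (rule lin_superset) (use supp_scale[of c f] in auto)
  also have "\<dots> = c \<cdot> lin \<phi> f"
    by (simp add: lin_def scale_sum)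
  finally show "lin \<phi> (c \<cdot> f) = c \<cdot> lin \<phi> f" .
qed

lemmas lin_add = linmap_add[OF linmap_lin]
  and lin_scale = linmap_scale[OF linmap_lin]
  and lin_zero [simp] = linmap_zero[OF linmap_lin]

lemma lin_mon [simp]: "lin \<phi> (mon w c) = c \<cdot> \<phi> w"
  by (simp add: lin_def)

lemma lin_cong: "(\<And>w. w \<in> supp f \<Longrightarrow> \<phi> w = \<psi> w) \<Longrightarrow> lin \<phi> f = lin \<psi> f"
  by (simp add: lin_def)

lemma linear_lin: "linmap L \<Longrightarrow> L (lin \<phi> f) = lin (\<lambda>w. L (\<phi> w)) f"
  by (simp add: lin_def linmap_sum linmap_scale)

lemma lin_fun_add: "lin (\<lambda>w. \<phi> w + \<psi> w) f = lin \<phi> f + lin \<psi> f"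
  by (simp add: lin_def sum.distrib)

lemma lin_fun_diff: "lin (\<lambda>w. \<phi> w - \<psi> w) f = lin \<phi> f - lin \<psi> f"
  by (simp add: lin_def sum_subtractf)

lemma lin_fun_scale: "lin (\<lambda>w. c \<cdot> \<phi> w) f = c \<cdot> lin \<phi> f"
  by (simp add: lin_def scale_sum mult.commute)

lemma lin_fun_zero [simp]: "lin (\<lambda>w. 0) f = 0"
  by (simp add: lin_def)

lemma lin_id [simp]:
  fixes f :: "'a \<Rightarrow>\<^sub>0 'k::field"
  shows "lin (\<lambda>w. mon w 1) f = f"
proof (rule poly_mapping_eqI)
  fix k show "cf (lin (\<lambda>w. mon w 1) f) k = cf f k"
    by (auto simp: lin_def lookup_sum lookup_single when_def in_keys_iff)
qed

lemma linmap_eq_lin: "linmap L \<Longrightarrow> L f = lin (\<lambda>w. L (mon w 1)) f"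
  using linear_lin[of L "\<lambda>w. mon w 1" f] by simp

lemma linmap_eqI:
  assumes "linmap L" "linmap L'" "\<And>w. w \<in> supp f \<Longrightarrow> L (mon w 1) = L' (mon w 1)"
  shows "L f = L' f"
  using assms(3) by (simp add: linmap_eq_lin[OF assms(1), of f] linmap_eq_lin[OF assms(2), of f]
      cong: lin_cong)

lemma linmap_comp: "linmap L \<Longrightarrow> linmap L' \<Longrightarrow> linmap (\<lambda>f. L (L' f))"
  and linmap_ident: "linmap (\<lambda>f. f)"
  by (simp_all add: linmap_def algebra_simps)

lemma linmap_scaled: "linmap L \<Longrightarrow> linmap (\<lambda>f. c \<cdot> L f)"
  by (simp add: linmap_def mult.commute)

definition lsubspace :: "('a \<Rightarrow>\<^sub>0 'k::field) set \<Rightarrow> bool" where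
  "lsubspace S \<longleftrightarrow> 0 \<in> S \<and> (\<forall>f\<in>S. \<forall>g\<in>S. f + g \<in> S) \<and> (\<forall>c. \<forall>f\<in>S. c \<cdot> f \<in> S)"

lemma lsubspaceD:
  assumes "lsubspace S"
  shows lsubspace_zero: "0 \<in> S" and lsubspace_add: "f \<in> S \<Longrightarrow> g \<in> S \<Longrightarrow> f + g \<in> S"
    and lsubspace_scale: "f \<in> S \<Longrightarrow> c \<cdot> f \<in> S"
  using assms by (auto simp: lsubspace_def)

lemma lsubspace_uminus: "lsubspace S \<Longrightarrow> f \<in> S \<Longrightarrow> - f \<in> S"
  using lsubspace_scale[of S f "-1"] by simp

lemma lsubspace_diff: "lsubspace S \<Longrightarrow> f \<in> S \<Longrightarrow> g \<in> S \<Longrightarrow> f - g \<in> S"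
  using lsubspace_add[of S f "- g"] lsubspace_uminus by fastforce

lemma lsubspace_sum: "lsubspace S \<Longrightarrow> (\<And>x. x \<in> A \<Longrightarrow> f x \<in> S) \<Longrightarrow> (\<Sum>x\<in>A. f x) \<in> S"
  by (induction A rule: infinite_finite_induct) (auto simp: lsubspace_zero lsubspace_add)

lemma lin_in_lsubspace: "lsubspace S \<Longrightarrow> (\<And>w. w \<in> supp f \<Longrightarrow> \<phi> w \<in> S) \<Longrightarrow> lin \<phi> f \<in> S"
  unfolding lin_def by (auto intro: lsubspace_sum lsubspace_scale)

lemma lsubspace_supp: "lsubspace {f. supp f \<subseteq> A}"
proof -
  have "supp (f + g) \<subseteq> A" if "supp f \<subseteq> A" "supp g \<subseteq> A" for f g :: "'a \<Rightarrow>\<^sub>0 'b"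
    using keys_add[of f g] that by auto
  moreover have "supp (c \<cdot> f) \<subseteq> A" if "supp f \<subseteq> A" for c and f :: "'a \<Rightarrow>\<^sub>0 'b"
    using supp_scale[of c f] that by auto
  ultimately show ?thesis
    by (simp add: lsubspace_def)
qed

lemma supp_lin: "(\<And>w. w \<in> supp f \<Longrightarrow> supp (\<phi> w) \<subseteq> A) \<Longrightarrow> supp (lin \<phi> f) \<subseteq> A"
  using lin_in_lsubspace[OF lsubspace_supp, of f \<phi> A] by simp

section \<open>Monoid algebras\<close>

text \<open>
  The multiplication of a monoid algebra, as a bilinear extension of the multiplication \<open>m\<close>.
\<close>

definition conv :: "('a \<Rightarrow> 'a \<Rightarrow> 'a) \<Rightarrow> ('a \<Rightarrow>\<^sub>0 'k::field) \<Rightarrow> ('a \<Rightarrow>\<^sub>0 'k) \<Rightarrow> ('a \<Rightarrow>\<^sub>0 'k)" where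
  "conv m p q = lin (\<lambda>u. lin (\<lambda>v. mon (m u v) 1) q) p"

lemma conv_altdef: "conv m p q = (\<Sum>u\<in>supp p. \<Sum>v\<in>supp q. mon (m u v) (cf p u * cf q v))"
  by (simp add: conv_def lin_def scale_sum)

lemma linmap_conv [simp]: "linmap (conv m p)" "linmap (\<lambda>p. conv m p q)"
  unfolding conv_def linmap_def
  by (simp_all add: lin_add lin_scale lin_fun_add lin_fun_scale)

lemmas conv_add = linmap_conv[THEN linmap_add]
  and conv_scale = linmap_conv[THEN linmap_scale]
  and conv_zero [simp] = linmap_conv[THEN linmap_zero]

lemma conv_mon: "conv m (mon u c) (mon v d) = mon (m u v) (c * d)"
  by (simp add: conv_def)

lemma lin_conv: "lin \<phi> (conv m p q) = lin (\<lambda>u. lin (\<lambda>v. \<phi> (m u v)) q) p"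
  by (simp add: conv_def linear_lin[OF linmap_lin, of \<phi>])

lemma supp_conv:
  assumes "\<And>u v. u \<in> supp p \<Longrightarrow> v \<in> supp q \<Longrightarrow> m u v \<in> A"
  shows "supp (conv m p q) \<subseteq> A"
  unfolding conv_def by (intro supp_lin) (use assms in auto)

lemma conv_assoc:
  assumes "\<And>u v w. u \<in> supp p \<Longrightarrow> v \<in> supp q \<Longrightarrow> w \<in> supp r \<Longrightarrow> m (m u v) w = m u (m v w)"
  shows "conv m (conv m p q) r = conv m p (conv m q r)"
proof -
  have "conv m (conv m p q) r = lin (\<lambda>u. lin (\<lambda>v. lin (\<lambda>w. mon (m (m u v) w) 1) r) q) p"
    unfolding conv_def[of m "conv m p q"] by (rule lin_conv)
  also have "\<dots> = lin (\<lambda>u. lin (\<lambda>v. lin (\<lambda>w. mon (m u (m v w)) 1) r) q) p"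
    by (intro lin_cong) (simp add: assms)
  also have "\<dots> = conv m p (conv m q r)"
    unfolding conv_def[of m p] by (simp add: lin_conv)
  finally show ?thesis .
qed

lemma monoid_alg_sel [simp]:
  "carrier (monoid_alg M) = {p. supp p \<subseteq> carrier M}"
  "mult (monoid_alg M) = conv (mult M)"
  "one (monoid_alg M) = mon \<one>\<^bsub>M\<^esub> 1"
  "zero (monoid_alg M) = 0"
  "add (monoid_alg M) = (+)"
  "smult (monoid_alg M) = pscale"
  by (auto simp: monoid_alg_def conv_altdef fun_eq_iff)

lemma abelian_group_monoid_alg:
  "abelian_group (monoid_alg M :: ('k::field, _) module)"
proof -
  have sub: "lsubspace {p :: 'a \<Rightarrow>\<^sub>0 'k. supp p \<subseteq> carrier M}" by (rule lsubspace_supp)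
  have neg: "\<exists>y. supp y \<subseteq> carrier M \<and> y + x = 0" if "supp x \<subseteq> carrier M" for x :: "'a \<Rightarrow>\<^sub>0 'k"
    using that lsubspace_uminus[OF sub, of x] by (intro exI[of _ "- x"]) simp
  have sum: "supp (x + y) \<subseteq> carrier M" if "supp x \<subseteq> carrier M" "supp y \<subseteq> carrier M"
    for x y :: "'a \<Rightarrow>\<^sub>0 'k"
    using that lsubspace_add[OF sub, of x y] by simp
  show ?thesis
    by (rule abelian_groupI, simp_all, erule sum, assumption, erule neg)
qed

lemma ring_monoid_alg:
  assumes "monoid M"
  shows "ring (monoid_alg M :: ('k::field, _) module)"
proof -
  interpret monoid M by fact
  have one: "conv (mult M) (mon \<one>\<^bsub>M\<^esub> 1) p = p" "conv (mult M) p (mon \<one>\<^bsub>M\<^esub> 1) = p"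
    if "supp p \<subseteq> carrier M" for p :: "'a \<Rightarrow>\<^sub>0 'k"
    by (rule linmap_eqI[where L' = "\<lambda>x. x"];
        use that in \<open>auto simp: linmap_ident conv_mon intro!: arg_cong[where f = "\<lambda>u. mon u _"]\<close>)+
  show ?thesis
  proof (rule ringI)
    show "abelian_group (monoid_alg M :: ('k, _) module)"
      by (rule abelian_group_monoid_alg)
    show "Group.monoid (monoid_alg M :: ('k, _) module)"
    proof (rule monoidI)
      fix x y z :: "'a \<Rightarrow>\<^sub>0 'k"
      assume x: "x \<in> carrier (monoid_alg M)" and y: "y \<in> carrier (monoid_alg M)"
      have "supp (conv (mult M) x y) \<subseteq> carrier M"
        by (rule supp_conv) (use x y in auto)
      then show "x \<otimes>\<^bsub>monoid_alg M\<^esub> y \<in> carrier (monoid_alg M)" by simp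
      assume z: "z \<in> carrier (monoid_alg M)"
      have "conv (mult M) (conv (mult M) x y) z = conv (mult M) x (conv (mult M) y z)"
        by (rule conv_assoc) (use x y z in \<open>auto intro!: m_assoc\<close>)
      then show "x \<otimes>\<^bsub>monoid_alg M\<^esub> y \<otimes>\<^bsub>monoid_alg M\<^esub> z = x \<otimes>\<^bsub>monoid_alg M\<^esub> (y \<otimes>\<^bsub>monoid_alg M\<^esub> z)"
        by simp
    qed (simp_all add: one)
  qed (auto simp: conv_add)
qed

lemma ideal_monoid_algI:
  assumes "monoid M" "lsubspace K" "K \<subseteq> carrier (monoid_alg M)"
    and "\<And>u f. u \<in> carrier M \<Longrightarrow> f \<in> K \<Longrightarrow> conv (mult M) (mon u 1) f \<in> K"
    and "\<And>u f. u \<in> carrier M \<Longrightarrow> f \<in> K \<Longrightarrow> conv (mult M) f (mon u 1) \<in> K"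
  shows "ideal K (monoid_alg M :: ('k::field, _) module)"
proof (rule idealI)
  show "ring (monoid_alg M :: ('k, _) module)" by (rule ring_monoid_alg) fact
  interpret A: ring "monoid_alg M :: ('k, _) module" by fact
  have minus: "\<ominus>\<^bsub>monoid_alg M\<^esub> f = - f" if "f \<in> K" for f
    by (rule A.minus_equality) (use that assms(3) lsubspace_uminus[OF assms(2)] in auto)
  show "subgroup K (add_monoid (monoid_alg M))"
  proof (rule group.subgroupI[OF A.a_group])
    show "K \<subseteq> carrier (add_monoid (monoid_alg M))" using assms(3) by simp
    show "K \<noteq> {}" using lsubspace_zero[OF assms(2)] by auto
    show "inv\<^bsub>add_monoid (monoid_alg M)\<^esub> a \<in> K" if "a \<in> K" for a
      using minus[OF that] lsubspace_uminus[OF assms(2) that] unfolding a_inv_def by simp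
    show "a \<otimes>\<^bsub>add_monoid (monoid_alg M)\<^esub> b \<in> K" if "a \<in> K" "b \<in> K" for a b
      using that lsubspace_add[OF assms(2)] by simp
  qed
  fix a x assume a: "a \<in> K" and x: "x \<in> carrier (monoid_alg M :: ('k, _) module)"
  have left: "conv (mult M) x a = lin (\<lambda>u. conv (mult M) (mon u 1) a) x"
    by (rule linmap_eq_lin[of "\<lambda>x. conv (mult M) x a" x]) simp
  have "lin (\<lambda>u. conv (mult M) (mon u 1) a) x \<in> K"
    by (rule lin_in_lsubspace[OF assms(2)]) (use a x assms(4) in auto)
  then show "x \<otimes>\<^bsub>monoid_alg M\<^esub> a \<in> K"
    unfolding monoid_alg_sel by (subst left)
  have right: "conv (mult M) a x = lin (\<lambda>u. conv (mult M) a (mon u 1)) x"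
    by (rule linmap_eq_lin[of "conv (mult M) a" x]) simp
  have "lin (\<lambda>u. conv (mult M) a (mon u 1)) x \<in> K"
    by (rule lin_in_lsubspace[OF assms(2)]) (use a x assms(5) in auto)
  then show "a \<otimes>\<^bsub>monoid_alg M\<^esub> x \<in> K"
    unfolding monoid_alg_sel by (subst right)
qed

section \<open>Quotients of monoid algebras by relations\<close>

definition formal_sums :: "('a, 'z) monoid_scheme \<Rightarrow> ('a \<Rightarrow>\<^sub>0 'k::field) set" where
  "formal_sums M = {p. supp p \<subseteq> carrier M}"

lemma lsubspace_formal_sums: "lsubspace (formal_sums M)"
  unfolding formal_sums_def by (rule lsubspace_supp)

lemma formal_sums_closed [simp]:
  "0 \<in> formal_sums M" "f \<in> formal_sums M \<Longrightarrow> g \<in> formal_sums M \<Longrightarrow> f + g \<in> formal_sums M"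
  "f \<in> formal_sums M \<Longrightarrow> g \<in> formal_sums M \<Longrightarrow> f - g \<in> formal_sums M" "f \<in> formal_sums M \<Longrightarrow> c \<cdot> f \<in> formal_sums M"
  using lsubspaceD[OF lsubspace_formal_sums] lsubspace_diff[OF lsubspace_formal_sums] by blast+

lemma mon_in_formal_sums [simp]: "w \<in> carrier M \<Longrightarrow> mon w c \<in> formal_sums M"
  by (simp add: formal_sums_def)

lemma supp_formal_sums: "f \<in> formal_sums M \<Longrightarrow> w \<in> supp f \<Longrightarrow> w \<in> carrier M"
  by (auto simp: formal_sums_def)

lemma lin_in_formal_sums: "(\<And>w. w \<in> supp f \<Longrightarrow> \<phi> w \<in> formal_sums M) \<Longrightarrow> lin \<phi> f \<in> formal_sums M"
  by (rule lin_in_lsubspace[OF lsubspace_formal_sums])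

lemma sum_in_formal_sums: "(\<And>x. x \<in> S \<Longrightarrow> f x \<in> formal_sums M) \<Longrightarrow> (\<Sum>x\<in>S. f x) \<in> formal_sums M"
  by (rule lsubspace_sum[OF lsubspace_formal_sums])

lemma formal_sums_induct [consumes 1, case_names zero mon add]:
  assumes "f \<in> formal_sums M"
    and "P 0" "\<And>w c. w \<in> carrier M \<Longrightarrow> P (mon w c)"
    and add: "\<And>f g. f \<in> formal_sums M \<Longrightarrow> g \<in> formal_sums M \<Longrightarrow> P f \<Longrightarrow> P g \<Longrightarrow> P (f + g)"
  shows "P f"
proof -
  have "P (\<Sum>w\<in>S. mon w (cf f w)) \<and> (\<Sum>w\<in>S. mon w (cf f w)) \<in> formal_sums M"
    if "finite S" "S \<subseteq> supp f" for S
    using that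
  proof (induction S rule: finite_induct)
    case (insert w S)
    moreover from insert have "w \<in> carrier M" using supp_formal_sums[OF assms(1)] by auto
    ultimately show ?case using assms(3) by (simp add: add)
  qed (simp add: assms(2))
  from this[of "supp f"] have "P (\<Sum>w\<in>supp f. mon w (cf f w))" by simp
  also have "(\<Sum>w\<in>supp f. mon w (cf f w)) = f"
    using lin_id[of f] unfolding lin_def by simp
  finally show ?thesis .
qed

locale relations =
  fixes M :: "('a, 'z) monoid_scheme" and R :: "('a \<Rightarrow>\<^sub>0 'k::field) set"
  assumes monoid: "monoid M" and rels: "R \<subseteq> formal_sums M"
begin

abbreviation A :: "('k, 'a \<Rightarrow>\<^sub>0 'k) module" where "A \<equiv> monoid_alg M"
abbreviation C :: "('a \<Rightarrow>\<^sub>0 'k) set" where "C \<equiv> formal_sums M"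
abbreviation mul (infixl "\<star>" 70) where "mul \<equiv> conv (mult M)"
abbreviation unit :: "'a \<Rightarrow>\<^sub>0 'k" where "unit \<equiv> mon \<one>\<^bsub>M\<^esub> 1"
abbreviation I :: "('a \<Rightarrow>\<^sub>0 'k) set" where "I \<equiv> Idl\<^bsub>A\<^esub> R"
abbreviation B :: "('k, ('a \<Rightarrow>\<^sub>0 'k) set) module" where "B \<equiv> quot_alg A I"
abbreviation cl :: "('a \<Rightarrow>\<^sub>0 'k) \<Rightarrow> ('a \<Rightarrow>\<^sub>0 'k) set" where "cl f \<equiv> I +>\<^bsub>A\<^esub> f"

lemma carrier_A: "carrier A = C"
  by (simp add: formal_sums_def)

sublocale M: monoid M by (rule monoid)
sublocale A: ring A by (rule ring_monoid_alg[OF monoid])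
sublocale I: ideal I A by (rule A.genideal_ideal) (use rels carrier_A in simp)

lemma mul_closed [simp]: "f \<in> C \<Longrightarrow> g \<in> C \<Longrightarrow> f \<star> g \<in> C"
  using A.m_closed[of f g] by (simp add: formal_sums_def)

lemma one_closed: "unit \<in> C"
  by simp

lemma mul_one [simp]: "f \<in> C \<Longrightarrow> unit \<star> f = f" "f \<in> C \<Longrightarrow> f \<star> unit = f"
  using A.l_one[of f] A.r_one[of f] by (simp_all add: formal_sums_def)

lemma mul_assoc: "f \<in> C \<Longrightarrow> g \<in> C \<Longrightarrow> h \<in> C \<Longrightarrow> f \<star> g \<star> h = f \<star> (g \<star> h)"
  using A.m_assoc[of f g h] by (simp add: formal_sums_def)

lemma I_sub: "f \<in> I \<Longrightarrow> f \<in> C"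
  using I.a_subset carrier_A by auto

lemma I_rel: "r \<in> R \<Longrightarrow> r \<in> I"
  using A.genideal_self[of R] rels carrier_A by auto

lemma I_mul: "f \<in> I \<Longrightarrow> g \<in> C \<Longrightarrow> g \<star> f \<in> I" "f \<in> I \<Longrightarrow> g \<in> C \<Longrightarrow> f \<star> g \<in> I"
  using I.I_l_closed[of f g] I.I_r_closed[of f g] by (simp_all add: formal_sums_def)

text \<open>
  Closure under multiplication by basis elements suffices, since these span the algebra.
\<close>

lemma I_minimal:
  assumes "lsubspace K" "K \<subseteq> C" "R \<subseteq> K"
    and "\<And>u f. u \<in> carrier M \<Longrightarrow> f \<in> K \<Longrightarrow> mon u 1 \<star> f \<in> K"
    and "\<And>u f. u \<in> carrier M \<Longrightarrow> f \<in> K \<Longrightarrow> f \<star> mon u 1 \<in> K"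
  shows "I \<subseteq> K"
  using A.genideal_minimal[OF ideal_monoid_algI[OF monoid assms(1) _ assms(4,5)] assms(3)] assms(2)
  by (simp add: formal_sums_def)

text \<open>Scalars act through multiples of the unit, so ideals are subspaces.\<close>

lemma lsubspace_I: "lsubspace I"
proof -
  have "c \<cdot> f \<in> I" if "f \<in> I" for c f
  proof -
    have "c \<cdot> f = mon \<one>\<^bsub>M\<^esub> c \<star> f"
      using I_sub[OF that] conv_scale(2)[of "mult M" c unit f] by simp
    then show ?thesis using I_mul(1)[OF that, of "mon \<one>\<^bsub>M\<^esub> c"] by simp
  qed
  then show ?thesis
    using I.a_closed I.zero_closed unfolding lsubspace_def by auto
qed

lemma cl_def': "cl f = {i + f | i. i \<in> I}"
  by (auto simp: a_r_coset_def')

lemma mem_cl_iff: "g \<in> cl f \<longleftrightarrow> g - f \<in> I"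
  unfolding cl_def' by (auto, metis diff_add_cancel)

lemma cl_eq_iff: "cl f = cl g \<longleftrightarrow> f - g \<in> I"
proof
  assume "cl f = cl g"
  moreover have "f \<in> cl f" using lsubspace_zero[OF lsubspace_I] by (simp add: mem_cl_iff)
  ultimately show "f - g \<in> I" by (simp add: mem_cl_iff[symmetric])
next
  assume fg: "f - g \<in> I"
  have "h - f \<in> I \<longleftrightarrow> h - g \<in> I" for h
    using lsubspace_add[OF lsubspace_I _ fg, of "h - f"] lsubspace_diff[OF lsubspace_I _ fg, of "h - g"]
    by auto
  then show "cl f = cl g" by (auto simp: mem_cl_iff)
qed

lemma cl_self: "f \<in> cl f"
  using cl_eq_iff[of f f] mem_cl_iff[of f f] by simp

lemma carrier_B: "carrier B = cl ` C"
proof -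
  have "carrier B = a_rcosets\<^bsub>A\<^esub> I" by (simp add: quot_alg_def FactRing_def)
  then show ?thesis by (auto simp only: A_RCOSETS_def' carrier_A a_r_coset_def')
qed

lemma cl_in_B [simp]: "f \<in> C \<Longrightarrow> cl f \<in> carrier B"
  by (simp add: carrier_B)

lemma B_add: "f \<in> C \<Longrightarrow> g \<in> C \<Longrightarrow> cl f \<oplus>\<^bsub>B\<^esub> cl g = cl (f + g)"
  using I.a_rcos_sum[of f g] unfolding carrier_A by (simp add: quot_alg_def FactRing_def)

lemma B_mult: "f \<in> C \<Longrightarrow> g \<in> C \<Longrightarrow> cl f \<otimes>\<^bsub>B\<^esub> cl g = cl (f \<star> g)"
  using I.rcoset_mult_add[of f g] unfolding carrier_A by (simp add: quot_alg_def FactRing_def)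

lemma B_one: "\<one>\<^bsub>B\<^esub> = cl unit"
  by (simp add: quot_alg_def FactRing_def)

lemma B_zero: "\<zero>\<^bsub>B\<^esub> = cl 0"
  by (auto simp: quot_alg_def FactRing_def cl_def')

lemma B_smult: "c \<odot>\<^bsub>B\<^esub> cl f = cl (c \<cdot> f)"
proof -
  have const: "cl (c \<cdot> a) = cl (c \<cdot> f)" if "a \<in> cl f" for a
    using that lsubspace_scale[OF lsubspace_I, of "a - f" c] by (simp add: mem_cl_iff cl_eq_iff)
  have "c \<odot>\<^bsub>B\<^esub> cl f = (\<Union>a\<in>cl f. cl (c \<cdot> a))"
    by (simp add: quot_alg_def)
  also have "\<dots> = (\<Union>a\<in>cl f. cl (c \<cdot> f))"
    by (intro SUP_cong refl const)
  also have "\<dots> = cl (c \<cdot> f)"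
    using cl_self[of f] by (intro UN_constant[THEN trans]) auto
  finally show ?thesis .
qed

lemma B_cases:
  assumes "a \<in> carrier B"
  obtains f where "f \<in> C" "a = cl f"
  using assms carrier_B by auto

lemma monoid_B: "monoid B"
proof (rule monoidI)
  fix x y z assume "x \<in> carrier B" "y \<in> carrier B"
  then obtain f g where f: "f \<in> C" "x = cl f" and g: "g \<in> C" "y = cl g"
    by (metis B_cases)
  then show "x \<otimes>\<^bsub>B\<^esub> y \<in> carrier B" by (simp add: B_mult)
  assume "z \<in> carrier B"
  then obtain h where "h \<in> C" "z = cl h" by (metis B_cases)
  with f g show "x \<otimes>\<^bsub>B\<^esub> y \<otimes>\<^bsub>B\<^esub> z = x \<otimes>\<^bsub>B\<^esub> (y \<otimes>\<^bsub>B\<^esub> z)"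
    by (simp add: B_mult mul_assoc)
qed (metis B_cases B_one B_mult one_closed mul_one cl_in_B)+

lemma abelian_monoid_B: "abelian_monoid B"
proof (rule abelian_monoidI)
  fix x y z assume "x \<in> carrier B" "y \<in> carrier B"
  then obtain f g where f: "f \<in> C" "x = cl f" and g: "g \<in> C" "y = cl g"
    by (metis B_cases)
  then show "x \<oplus>\<^bsub>B\<^esub> y \<in> carrier B" "x \<oplus>\<^bsub>B\<^esub> y = y \<oplus>\<^bsub>B\<^esub> x"
    by (simp_all add: B_add add.commute)
  assume "z \<in> carrier B"
  then obtain h where "h \<in> C" "z = cl h" by (metis B_cases)
  with f g show "x \<oplus>\<^bsub>B\<^esub> y \<oplus>\<^bsub>B\<^esub> z = x \<oplus>\<^bsub>B\<^esub> (y \<oplus>\<^bsub>B\<^esub> z)"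
    by (simp add: B_add add.assoc)
next
  fix x assume "x \<in> carrier B"
  then obtain f where "f \<in> C" "x = cl f" by (metis B_cases)
  then show "\<zero>\<^bsub>B\<^esub> \<oplus>\<^bsub>B\<^esub> x = x" by (simp add: B_add B_zero)
qed (simp add: B_zero)

sublocale B: abelian_monoid B by (rule abelian_monoid_B)

lemma B_finsum:
  assumes "finite S" "\<And>w. w \<in> S \<Longrightarrow> f w \<in> C"
  shows "(\<Oplus>\<^bsub>B\<^esub>w\<in>S. cl (f w)) = cl (\<Sum>w\<in>S. f w)"
  using assms
proof (induction S rule: finite_induct)
  case (insert x S)
  then have "(\<Sum>w\<in>S. f w) \<in> C" by (intro sum_in_formal_sums) auto
  with insert show ?case
    by (subst B.finsum_insert) (simp_all add: B_add Pi_iff)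
qed (simp add: B_zero)

lemma B_finsum_lin:
  assumes "\<And>w. w \<in> supp f \<Longrightarrow> \<phi> w \<in> C"
  shows "(\<Oplus>\<^bsub>B\<^esub>w\<in>supp f. cf f w \<odot>\<^bsub>B\<^esub> cl (\<phi> w)) = cl (lin \<phi> f)"
proof -
  have "(\<Oplus>\<^bsub>B\<^esub>w\<in>supp f. cf f w \<odot>\<^bsub>B\<^esub> cl (\<phi> w)) = (\<Oplus>\<^bsub>B\<^esub>w\<in>supp f. cl (cf f w \<cdot> \<phi> w))"
    using assms by (intro B.finsum_cong') (simp_all add: B_smult Pi_iff)
  also have "\<dots> = cl (lin \<phi> f)"
    unfolding lin_def using assms by (intro B_finsum) simp_all
  finally show ?thesis .
qed

lemma foldr_in_C: "(\<And>x. x \<in> set w \<Longrightarrow> \<phi> x \<in> C) \<Longrightarrow> foldr (\<lambda>x b. \<phi> x \<star> b) w unit \<in> C"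
  by (induction w) simp_all

lemma free_lift_B:
  assumes "\<And>w x. w \<in> supp f \<Longrightarrow> x \<in> set w \<Longrightarrow> \<phi> x \<in> C"
  shows "free_lift B (\<lambda>x. cl (\<phi> x)) f = cl (lin (\<lambda>w. foldr (\<lambda>x b. \<phi> x \<star> b) w unit) f)"
proof -
  have word: "foldr (\<lambda>x b. cl (\<phi> x) \<otimes>\<^bsub>B\<^esub> b) w \<one>\<^bsub>B\<^esub> = cl (foldr (\<lambda>x b. \<phi> x \<star> b) w unit)"
    if "\<And>x. x \<in> set w \<Longrightarrow> \<phi> x \<in> C" for w
    using that
  proof (induction w)
    case (Cons x w)
    then have "\<phi> x \<in> C" "foldr (\<lambda>x b. \<phi> x \<star> b) w unit \<in> C" by (simp_all add: foldr_in_C)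
    with Cons show ?case by (simp add: B_mult)
  qed (simp add: B_one)
  have "free_lift B (\<lambda>x. cl (\<phi> x)) f =
    (\<Oplus>\<^bsub>B\<^esub>w\<in>supp f. cf f w \<odot>\<^bsub>B\<^esub> cl (foldr (\<lambda>x b. \<phi> x \<star> b) w unit))"
    unfolding free_lift_def
    using word assms by (intro B.finsum_cong') (simp_all add: B_smult Pi_iff foldr_in_C)
  also have "\<dots> = cl (lin (\<lambda>w. foldr (\<lambda>x b. \<phi> x \<star> b) w unit) f)"
    using assms by (intro B_finsum_lin foldr_in_C) blast
  finally show ?thesis .
qed

end

section \<open>Free algebras, homomorphisms and skew derivations\<close>

definition words :: "'x set \<Rightarrow> 'x list monoid" where
  "words X = \<lparr>carrier = lists X, mult = (@), one = []\<rparr>"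

lemma words_sel [simp]: "carrier (words X) = lists X" "mult (words X) = (@)" "one (words X) = []"
  by (simp_all add: words_def)

abbreviation fmul :: "('x list \<Rightarrow>\<^sub>0 'k::field) \<Rightarrow> ('x list \<Rightarrow>\<^sub>0 'k) \<Rightarrow> ('x list \<Rightarrow>\<^sub>0 'k)" (infixl "\<diamondop>" 70)
  where "fmul \<equiv> conv (@)"

lemma monoid_words: "monoid (words X)"
  by (rule monoidI) auto

lemma fmul_assoc: "f \<diamondop> g \<diamondop> h = f \<diamondop> (g \<diamondop> h)"
  by (rule conv_assoc) simp

lemma fmul_one [simp]: "mon [] 1 \<diamondop> f = f" "f \<diamondop> mon [] 1 = f"
  by (rule linmap_eqI[where L = "\<lambda>f. mon [] 1 \<diamondop> f" and L' = "\<lambda>f. f"]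
      linmap_eqI[where L = "\<lambda>f. f \<diamondop> mon [] 1" and L' = "\<lambda>f. f"];
      simp add: linmap_ident conv_mon)+

lemma mon_Cons: "mon (x # w) c = mon [x] 1 \<diamondop> mon w c"
  by (simp add: conv_mon)

lemma conv_lin: "conv m (lin a f) (lin b g) = lin (\<lambda>u. lin (\<lambda>v. conv m (a u) (b v)) g) f"
proof -
  have "conv m (lin a f) (lin b g) = lin (\<lambda>u. conv m (a u) (lin b g)) f"
    by (rule linear_lin[of "\<lambda>p. conv m p (lin b g)"]) simp
  also have "\<dots> = lin (\<lambda>u. lin (\<lambda>v. conv m (a u) (b v)) g) f"
    by (intro lin_cong linear_lin) simp
  finally show ?thesis .
qed

definition word_prod :: "('x \<Rightarrow> ('y list \<Rightarrow>\<^sub>0 'k::field)) \<Rightarrow> 'x list \<Rightarrow> ('y list \<Rightarrow>\<^sub>0 'k)" where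
  "word_prod \<phi> w = foldr (\<lambda>x b. \<phi> x \<diamondop> b) w (mon [] 1)"

lemma word_prod_simps [simp]:
  "word_prod \<phi> [] = mon [] 1" "word_prod \<phi> (x # w) = \<phi> x \<diamondop> word_prod \<phi> w"
  by (simp_all add: word_prod_def)

lemma word_prod_append: "word_prod \<phi> (u @ v) = word_prod \<phi> u \<diamondop> word_prod \<phi> v"
  by (induction u) (simp_all add: fmul_assoc)

text \<open>The algebra homomorphism with prescribed values on the generators.\<close>

definition hom_ext :: "('x \<Rightarrow> ('y list \<Rightarrow>\<^sub>0 'k::field)) \<Rightarrow> ('x list \<Rightarrow>\<^sub>0 'k) \<Rightarrow> ('y list \<Rightarrow>\<^sub>0 'k)" where
  "hom_ext \<phi> = lin (word_prod \<phi>)"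

lemma linmap_hom_ext [simp]: "linmap (hom_ext \<phi>)"
  by (simp add: hom_ext_def)

lemma hom_ext_mon: "hom_ext \<phi> (mon w c) = c \<cdot> word_prod \<phi> w"
  by (simp add: hom_ext_def)

lemma hom_ext_mult: "hom_ext \<phi> (f \<diamondop> g) = hom_ext \<phi> f \<diamondop> hom_ext \<phi> g"
  by (simp add: hom_ext_def lin_conv conv_lin word_prod_append)

text \<open>The \<open>(\<gamma>, id)\<close>-skew derivation with prescribed values on the generators:
  \<open>D(fg) = \<gamma>(f) D(g) + D(f) g\<close>.\<close>

fun skew_word :: "('x \<Rightarrow> ('x list \<Rightarrow>\<^sub>0 'k::field)) \<Rightarrow> ('x \<Rightarrow> ('x list \<Rightarrow>\<^sub>0 'k)) \<Rightarrow> 'x list \<Rightarrow> ('x list \<Rightarrow>\<^sub>0 'k)"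
where
  "skew_word \<gamma> \<delta> [] = 0"
| "skew_word \<gamma> \<delta> (x # w) = \<gamma> x \<diamondop> skew_word \<gamma> \<delta> w + \<delta> x \<diamondop> mon w 1"

definition skew_ext :: "('x \<Rightarrow> ('x list \<Rightarrow>\<^sub>0 'k::field)) \<Rightarrow> ('x \<Rightarrow> ('x list \<Rightarrow>\<^sub>0 'k)) \<Rightarrow> ('x list \<Rightarrow>\<^sub>0 'k)
    \<Rightarrow> ('x list \<Rightarrow>\<^sub>0 'k)" where
  "skew_ext \<gamma> \<delta> = lin (skew_word \<gamma> \<delta>)"

lemma linmap_skew_ext [simp]: "linmap (skew_ext \<gamma> \<delta>)"
  by (simp add: skew_ext_def)

lemma skew_ext_mon: "skew_ext \<gamma> \<delta> (mon w c) = c \<cdot> skew_word \<gamma> \<delta> w"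
  by (simp add: skew_ext_def)

lemma skew_word_append:
  "skew_word \<gamma> \<delta> (u @ v) = word_prod \<gamma> u \<diamondop> skew_word \<gamma> \<delta> v + skew_word \<gamma> \<delta> u \<diamondop> mon v 1"
  by (induction u) (simp_all add: fmul_assoc conv_add conv_mon)

lemma skew_ext_mult:
  "skew_ext \<gamma> \<delta> (f \<diamondop> g) = hom_ext \<gamma> f \<diamondop> skew_ext \<gamma> \<delta> g + skew_ext \<gamma> \<delta> f \<diamondop> g"
proof -
  have "skew_ext \<gamma> \<delta> f \<diamondop> g = skew_ext \<gamma> \<delta> f \<diamondop> lin (\<lambda>v. mon v 1) g" by simp
  then show ?thesis
    unfolding skew_ext_def hom_ext_def lin_conv conv_lin skew_word_append lin_fun_add by simp
qed

lemma fmul_in: "f \<in> formal_sums (words X) \<Longrightarrow> g \<in> formal_sums (words X) \<Longrightarrow> f \<diamondop> g \<in> formal_sums (words X)"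
  unfolding formal_sums_def using supp_conv[of f g "(@)" "lists X"] by auto

lemma word_prod_in:
  "(\<And>x. x \<in> set w \<Longrightarrow> \<phi> x \<in> formal_sums (words Y)) \<Longrightarrow> word_prod \<phi> w \<in> formal_sums (words Y)"
  by (induction w) (simp_all add: fmul_in)

lemma hom_ext_in:
  assumes "f \<in> formal_sums (words X)" "\<And>x. x \<in> X \<Longrightarrow> \<phi> x \<in> formal_sums (words Y)"
  shows "hom_ext \<phi> f \<in> formal_sums (words Y)"
  unfolding hom_ext_def using assms
  by (intro lin_in_formal_sums word_prod_in) (auto dest!: supp_formal_sums)

lemma skew_word_in:
  assumes "\<And>x. x \<in> X \<Longrightarrow> \<gamma> x \<in> formal_sums (words X)" "\<And>x. x \<in> X \<Longrightarrow> \<delta> x \<in> formal_sums (words X)"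
  shows "set w \<subseteq> X \<Longrightarrow> skew_word \<gamma> \<delta> w \<in> formal_sums (words X)"
  by (induction w) (auto simp: assms intro!: formal_sums_closed fmul_in mon_in_formal_sums)

lemma skew_ext_in:
  assumes "f \<in> formal_sums (words X)"
    and "\<And>x. x \<in> X \<Longrightarrow> \<gamma> x \<in> formal_sums (words X)" "\<And>x. x \<in> X \<Longrightarrow> \<delta> x \<in> formal_sums (words X)"
  shows "skew_ext \<gamma> \<delta> f \<in> formal_sums (words X)"
  unfolding skew_ext_def using assms
  by (intro lin_in_formal_sums skew_word_in) (auto dest!: supp_formal_sums)

locale free_relations =
  fixes X :: "'x set" and R :: "('x list \<Rightarrow>\<^sub>0 'k::field) set"
  assumes free_rels: "R \<subseteq> formal_sums (words X)"

sublocale free_relations \<subseteq> relations "words X" R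
  rewrites "mult (words X) = (@)" and "one (words X) = []" and "carrier (words X) = lists X"
  by unfold_locales (use free_rels monoid_words in auto)

context free_relations
begin

lemma pres_alg_B: "pres_alg X R = B"
  by (simp add: pres_alg_def free_alg_def words_def)

lemma pres_gen_cl: "pres_gen X R x = cl (mon [x] 1)"
  by (simp add: pres_gen_def free_alg_def words_def)

text \<open>
  The elements of the ideal with images in \<open>J\<close> form an ideal of their own. For a skew derivation
  \<open>D\<close> the twisted Leibniz rule \<open>D(ef) = G(e)D(f) + D(e)f\<close> requires \<open>G\<close> to respect the ideal as well.
\<close>

lemma hom_ext_I:
  fixes \<phi> :: "'x \<Rightarrow> ('y list \<Rightarrow>\<^sub>0 'k)"
  assumes "lsubspace J" "\<And>r. r \<in> R \<Longrightarrow> hom_ext \<phi> r \<in> J"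
    and "\<And>x f. x \<in> X \<Longrightarrow> f \<in> J \<Longrightarrow> \<phi> x \<diamondop> f \<in> J" "\<And>x f. x \<in> X \<Longrightarrow> f \<in> J \<Longrightarrow> f \<diamondop> \<phi> x \<in> J"
    and "f \<in> I"
  shows "hom_ext \<phi> f \<in> J"
proof -
  let ?K = "{f \<in> C. hom_ext \<phi> f \<in> J}"
  have left: "word_prod \<phi> u \<diamondop> g \<in> J" and right: "g \<diamondop> word_prod \<phi> u \<in> J"
    if "set u \<subseteq> X" "g \<in> J" for u g
    using that
  proof (induction u arbitrary: g)
    case (Cons x u)
    { case 1 with Cons.IH(1)[of g] assms(3)[of x] show ?case by (simp add: fmul_assoc) }
    { case 2 with Cons.IH(2)[of "g \<diamondop> \<phi> x"] assms(4)[of x g] show ?case by (simp add: fmul_assoc) }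
  qed simp_all
  have "I \<subseteq> ?K"
  proof (rule I_minimal)
    show "lsubspace ?K"
      using assms(1) unfolding lsubspace_def
      by (auto simp: linmap_zero linmap_add linmap_scale)
    show "R \<subseteq> ?K" using rels assms(2) by auto
    fix u f assume u: "u \<in> lists X" and f: "f \<in> ?K"
    have "hom_ext \<phi> (mon u 1 \<diamondop> f) \<in> J" "hom_ext \<phi> (f \<diamondop> mon u 1) \<in> J"
      using u f left[of u] right[of u] by (auto simp: hom_ext_mult hom_ext_mon)
    then show "mon u 1 \<diamondop> f \<in> ?K" "f \<diamondop> mon u 1 \<in> ?K"
      using u f by auto
  qed auto
  with assms(5) show ?thesis by auto
qed

lemma skew_ext_I:
  assumes \<gamma>: "\<And>x. x \<in> X \<Longrightarrow> \<gamma> x \<in> C" and \<delta>: "\<And>x. x \<in> X \<Longrightarrow> \<delta> x \<in> C"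
    and "\<And>r. r \<in> R \<Longrightarrow> hom_ext \<gamma> r \<in> I" "\<And>r. r \<in> R \<Longrightarrow> skew_ext \<gamma> \<delta> r \<in> I" "f \<in> I"
  shows "skew_ext \<gamma> \<delta> f \<in> I"
proof -
  let ?K = "{f \<in> I. hom_ext \<gamma> f \<in> I \<and> skew_ext \<gamma> \<delta> f \<in> I}"
  have "I \<subseteq> ?K"
  proof (rule I_minimal)
    show "lsubspace ?K"
      using lsubspace_I unfolding lsubspace_def
      by (auto simp: linmap_zero linmap_add linmap_scale)
    show "?K \<subseteq> C" using I_sub by auto
    show "R \<subseteq> ?K" using assms(3,4) I_rel by auto
    fix u f assume u: "u \<in> lists X" and f: "f \<in> ?K"
    have "mon u 1 \<in> C" "word_prod \<gamma> u \<in> C" "skew_word \<gamma> \<delta> u \<in> C"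
      using u by (auto intro!: word_prod_in skew_word_in \<gamma> \<delta>)
    with f show "mon u 1 \<diamondop> f \<in> ?K" "f \<diamondop> mon u 1 \<in> ?K"
      by (simp_all add: hom_ext_mult skew_ext_mult hom_ext_mon skew_ext_mon I_mul I_sub
          lsubspace_add[OF lsubspace_I])
  qed
  with assms(5) show ?thesis by auto
qed

end

section \<open>Module algebras over the generalized Taft algebras\<close>

locale taft_relations =
  fixes n m :: nat and lam :: "'k::field"
  assumes m_pos: "m > 0"
begin

sublocale T: free_relations UNIV "taft_rels n lam m"
  by unfold_locales (simp add: formal_sums_def)

abbreviation H :: "('k, (taft_gen list \<Rightarrow>\<^sub>0 'k) set) hopf" where "H \<equiv> taft n lam m"
abbreviation gT :: "(taft_gen list \<Rightarrow>\<^sub>0 'k) set" where "gT \<equiv> taft_g n lam m"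
abbreviation xT :: "(taft_gen list \<Rightarrow>\<^sub>0 'k) set" where "xT \<equiv> taft_x n lam m"

lemma T_C [simp]: "f \<in> T.C"
  by (simp add: formal_sums_def)

lemma taft_alg_T: "taft_alg n lam m = T.B"
  by (simp add: taft_alg_def T.pres_alg_B)

lemma g_cl: "gT = T.cl (mon [Gr] 1)" and x_cl: "xT = T.cl (mon [Sk] 1)"
  by (simp_all add: taft_g_def taft_x_def T.pres_gen_cl)

sublocale TT: relations "T.B \<times>\<times> T.B" "tensor_rels T.B T.B"
proof (rule relations.intro)
  show "monoid (T.B \<times>\<times> T.B)" by (intro DirProd_monoid T.monoid_B)
  have add: "a \<oplus>\<^bsub>T.B\<^esub> b \<in> carrier T.B" if "a \<in> carrier T.B" "b \<in> carrier T.B" for a b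
    using that by (rule T.B.a_closed)
  have smult: "c \<odot>\<^bsub>T.B\<^esub> a \<in> carrier T.B" if "a \<in> carrier T.B" for a c
    using that by (metis T.B_cases T.B_smult T.cl_in_B T_C)
  show "tensor_rels T.B T.B \<subseteq> formal_sums (T.B \<times>\<times> T.B)"
    unfolding tensor_rels_def
    by (auto intro!: formal_sums_closed mon_in_formal_sums add smult)
qed

lemma taft_sel [simp]:
  "carrier H = carrier T.B" "mult H = mult T.B" "one H = one T.B" "zero H = zero T.B"
  "add H = add T.B" "smult H = smult T.B"
  by (simp_all add: taft_def Let_def taft_alg_T)

text \<open>The coproduct is handled through these representatives of its classes in the tensor square.\<close>

definition \<Delta> :: "taft_gen \<Rightarrow> ((taft_gen list \<Rightarrow>\<^sub>0 'k) set \<times> (taft_gen list \<Rightarrow>\<^sub>0 'k) set) \<Rightarrow>\<^sub>0 'k" where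
  "\<Delta> = case_taft_gen (mon (gT, gT) 1) (mon (gT, xT) 1 + mon (xT, \<one>\<^bsub>T.B\<^esub>) 1)"

definition \<Delta>_word :: "taft_gen list \<Rightarrow> ((taft_gen list \<Rightarrow>\<^sub>0 'k) set \<times> (taft_gen list \<Rightarrow>\<^sub>0 'k) set) \<Rightarrow>\<^sub>0 'k" where
  "\<Delta>_word w = foldr (\<lambda>y. conv (mult (T.B \<times>\<times> T.B)) (\<Delta> y)) w (mon \<one>\<^bsub>T.B \<times>\<times> T.B\<^esub> 1)"

lemma gx_carrier [simp]: "gT \<in> carrier T.B" "xT \<in> carrier T.B" "\<one>\<^bsub>T.B\<^esub> \<in> carrier T.B"
  by (simp_all add: g_cl x_cl T.B_one)

lemma \<Delta>_in [simp]: "\<Delta> y \<in> TT.C"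
  by (cases y) (auto simp: \<Delta>_def intro!: formal_sums_closed mon_in_formal_sums)

lemma \<Delta>_word_in [simp]: "\<Delta>_word w \<in> TT.C"
  unfolding \<Delta>_word_def by (rule TT.foldr_in_C) simp

lemma comult_H: "comult H h = (\<Union>f\<in>h. TT.cl (lin \<Delta>_word f))"
proof -
  have "case_taft_gen (tensor T.B T.B gT gT) (tensor T.B T.B gT xT \<oplus>\<^bsub>tensor_alg T.B T.B\<^esub> tensor T.B T.B xT \<one>\<^bsub>T.B\<^esub>)
      = (\<lambda>y. TT.cl (\<Delta> y))" (is "?l = _")
  proof
    fix y show "?l y = TT.cl (\<Delta> y)"
    proof (cases y)
      case Sk
      have "mon (gT, xT) 1 \<in> TT.C" "mon (xT, \<one>\<^bsub>T.B\<^esub>) 1 \<in> TT.C" by simp_all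
      from TT.B_add[OF this] Sk show ?thesis
        by (simp add: \<Delta>_def tensor_def tensor_alg_def)
    qed (simp add: \<Delta>_def tensor_def)
  qed
  then have "comult H h = (\<Union>f\<in>h. free_lift TT.B (\<lambda>y. TT.cl (\<Delta> y)) f)"
    by (simp add: taft_def Let_def taft_alg_T tensor_alg_def)
  then show ?thesis
    by (simp add: TT.free_lift_B \<Delta>_word_def[abs_def])
qed

lemma free_lift_scalar:
  fixes \<phi> :: "taft_gen \<Rightarrow> 'k"
  shows "free_lift scalar_alg \<phi> f = cf (hom_ext (\<lambda>y. mon ([] :: taft_gen list) (\<phi> y)) f) []"
proof -
  have scal: "abelian_monoid (scalar_alg :: ('k, 'k) module)"
    by (rule abelian_monoidI) (auto simp: scalar_alg_def ac_simps)
  interpret S: abelian_monoid "scalar_alg :: ('k, 'k) module" by (rule scal)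
  have sum: "(\<Oplus>\<^bsub>scalar_alg\<^esub>w\<in>S. c w) = (\<Sum>w\<in>S. c w)" if "finite S" for S and c :: "_ \<Rightarrow> 'k"
    using that
  proof (induction S rule: finite_induct)
    case (insert w S)
    then show ?case by (subst S.finsum_insert) (auto simp: scalar_alg_def)
  qed (simp, simp add: scalar_alg_def)
  have word: "word_prod (\<lambda>y. mon [] (\<phi> y)) w = mon [] (foldr (\<lambda>y b. \<phi> y * b) w 1)" for w
    by (induction w) (simp_all add: conv_mon)
  show ?thesis
    unfolding free_lift_def by (subst sum) (simp_all add: hom_ext_def lin_def word lookup_sum scalar_alg_def)
qed

definition \<epsilon> :: "taft_gen \<Rightarrow> (taft_gen list \<Rightarrow>\<^sub>0 'k)" where
  "\<epsilon> = case_taft_gen (mon [] 1) 0"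

text \<open>
  The homomorphism \<open>\<epsilon>\<close> kills the relations, hence is constant on cosets; this needs \<open>m > 0\<close>, since
  otherwise \<open>x\<^sup>m = 0\<close> would read \<open>1 = 0\<close>.
\<close>

lemma counit_H: "counit H (T.cl f) = cf (hom_ext \<epsilon> f) []"
proof -
  have \<epsilon>: "(\<lambda>y. mon [] (case_taft_gen 1 0 y)) = \<epsilon>"
    by (auto simp: \<epsilon>_def fun_eq_iff split: taft_gen.split)
  have rel: "hom_ext \<epsilon> r \<in> {0}" if "r \<in> taft_rels n lam m" for r
  proof -
    have "word_prod \<epsilon> (replicate k Gr) = mon [] 1" for k
      by (induction k) (simp_all add: \<epsilon>_def)
    moreover have "word_prod \<epsilon> (replicate m Sk) = 0"
      using m_pos by (cases m) (simp_all add: \<epsilon>_def)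
    ultimately show ?thesis
      using that by (auto simp: taft_rels_def linmap_diff hom_ext_mon \<epsilon>_def)
  qed
  have ideal: "hom_ext \<epsilon> f = 0" if "f \<in> T.I" for f
    using T.hom_ext_I[of "{0}" \<epsilon> f, OF _ rel _ _ that] by (simp add: lsubspace_def)
  have const: "free_lift scalar_alg (case_taft_gen 1 0) f' = cf (hom_ext \<epsilon> f) []" if "f' \<in> T.cl f" for f'
  proof -
    have "hom_ext \<epsilon> f' = hom_ext \<epsilon> f"
      using ideal[of "f' - f"] that unfolding T.mem_cl_iff by (simp add: linmap_diff)
    then show ?thesis unfolding free_lift_scalar \<epsilon> by simp
  qed
  have "free_lift scalar_alg (case_taft_gen 1 0) ` T.cl f = (\<lambda>_. cf (hom_ext \<epsilon> f) []) ` T.cl f"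
    by (rule image_cong[OF refl const])
  also have "\<dots> = {cf (hom_ext \<epsilon> f) []}"
    using T.cl_self[of f] by (simp only: image_constant)
  finally show ?thesis by (simp add: taft_def Let_def)
qed

end

text \<open>
  A Taft module algebra structure on a presented algebra is built on the free algebra itself, where
  the Taft relations hold on the nose; only at the end are the operators passed to the quotient.
\<close>

locale taft_operators = taft_relations n m lam + A: free_relations X R
  for n m :: nat and lam :: "'k::field" and X :: "'x set" and R :: "('x list \<Rightarrow>\<^sub>0 'k) set" +
  fixes \<gamma> \<delta> :: "'x \<Rightarrow> ('x list \<Rightarrow>\<^sub>0 'k)"
  assumes gen_in: "x \<in> X \<Longrightarrow> \<gamma> x \<in> A.C" "x \<in> X \<Longrightarrow> \<delta> x \<in> A.C"
    and rel_in: "r \<in> R \<Longrightarrow> hom_ext \<gamma> r \<in> A.I" "r \<in> R \<Longrightarrow> skew_ext \<gamma> \<delta> r \<in> A.I"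
    and G_pow: "f \<in> A.C \<Longrightarrow> (hom_ext \<gamma> ^^ n) f = f"
    and D_pow: "f \<in> A.C \<Longrightarrow> (skew_ext \<gamma> \<delta> ^^ m) f = 0"
    and GD: "f \<in> A.C \<Longrightarrow> hom_ext \<gamma> (skew_ext \<gamma> \<delta> f) = lam \<cdot> skew_ext \<gamma> \<delta> (hom_ext \<gamma> f)"
begin

abbreviation "G \<equiv> hom_ext \<gamma>"
abbreviation "D \<equiv> skew_ext \<gamma> \<delta>"

lemma GD_in: "f \<in> A.C \<Longrightarrow> G f \<in> A.C" "f \<in> A.C \<Longrightarrow> D f \<in> A.C"
  using gen_in by (auto intro: hom_ext_in skew_ext_in)

lemma GD_I: "f \<in> A.I \<Longrightarrow> G f \<in> A.I" "f \<in> A.I \<Longrightarrow> D f \<in> A.I"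
proof -
  assume f: "f \<in> A.I"
  show "G f \<in> A.I"
    by (rule A.hom_ext_I[OF A.lsubspace_I _ _ _ f]) (simp_all add: rel_in gen_in A.I_mul)
  show "D f \<in> A.I"
    by (rule A.skew_ext_I[OF _ _ _ _ f]) (simp_all add: rel_in gen_in)
qed

definition op_word :: "taft_gen list \<Rightarrow> ('x list \<Rightarrow>\<^sub>0 'k) \<Rightarrow> ('x list \<Rightarrow>\<^sub>0 'k)" where
  "op_word w f = foldr (case_taft_gen G D) w f"

definition oper :: "(taft_gen list \<Rightarrow>\<^sub>0 'k) \<Rightarrow> ('x list \<Rightarrow>\<^sub>0 'k) \<Rightarrow> ('x list \<Rightarrow>\<^sub>0 'k)" where
  "oper h f = lin (\<lambda>w. op_word w f) h"

lemma op_word_simps [simp]: "op_word [] f = f" "op_word (Gr # w) f = G (op_word w f)"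
  "op_word (Sk # w) f = D (op_word w f)" "op_word (u @ v) f = op_word u (op_word v f)"
  "op_word (replicate k Gr) f = (G ^^ k) f" "op_word (replicate k Sk) f = (D ^^ k) f"
proof -
  show "op_word (replicate k Gr) f = (G ^^ k) f" "op_word (replicate k Sk) f = (D ^^ k) f"
    by (induction k) (simp_all add: op_word_def)
qed (simp_all add: op_word_def)

lemma linmap_op_word [simp]: "linmap (op_word w)"
proof (induction w)
  case (Cons y w)
  then show ?case
    by (cases y) (simp_all add: linmap_def linmap_add[OF linmap_hom_ext] linmap_scale[OF linmap_hom_ext]
        linmap_add[OF linmap_skew_ext] linmap_scale[OF linmap_skew_ext])
qed (simp add: linmap_def)

lemma linmap_oper [simp]: "linmap (oper h)" "linmap (\<lambda>h. oper h f)"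
  unfolding oper_def linmap_def
  by (simp_all add: lin_add lin_scale lin_fun_add lin_fun_scale linmap_add linmap_scale)

lemma oper_mult: "oper (h \<diamondop> h') f = oper h (oper h' f)"
  by (simp add: oper_def lin_conv linear_lin)

lemma oper_mon: "oper (mon w c) f = c \<cdot> op_word w f"
  by (simp add: oper_def)

lemma op_word_in: "f \<in> A.C \<Longrightarrow> op_word w f \<in> A.C"
proof (induction w)
  case (Cons y w)
  then show ?case by (cases y) (simp_all add: GD_in)
qed simp

lemma op_word_I: "f \<in> A.I \<Longrightarrow> op_word w f \<in> A.I"
proof (induction w)
  case (Cons y w)
  then show ?case by (cases y) (simp_all add: GD_I)
qed simp

lemma oper_in: "f \<in> A.C \<Longrightarrow> oper h f \<in> A.C"
  unfolding oper_def by (intro lin_in_formal_sums op_word_in)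

lemma oper_I: "f \<in> A.I \<Longrightarrow> oper h f \<in> A.I"
  unfolding oper_def by (intro lin_in_lsubspace[OF A.lsubspace_I] op_word_I)

text \<open>
  The Taft relations hold for the operators on the free algebra, and the elements of the free
  algebra on \<open>g, x\<close> that act as zero form an ideal.
\<close>

lemma oper_kills_I:
  assumes "h \<in> T.I" "f \<in> A.C"
  shows "oper h f = 0"
proof -
  let ?K = "{h. \<forall>f\<in>A.C. oper h f = 0}"
  have "T.I \<subseteq> ?K"
  proof (rule T.I_minimal)
    show "lsubspace ?K"
      by (simp add: lsubspace_def linmap_add[OF linmap_oper(2)] linmap_scale[OF linmap_oper(2)]
          linmap_zero[OF linmap_oper(2)])
    show "taft_rels n lam m \<subseteq> ?K"
      by (auto simp: taft_rels_def linmap_diff[OF linmap_oper(2)] oper_mon G_pow D_pow GD)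
  qed (auto simp: oper_mult oper_in linmap_zero)
  with assms show ?thesis by auto
qed

definition act :: "(taft_gen list \<Rightarrow>\<^sub>0 'k) set \<Rightarrow> ('x list \<Rightarrow>\<^sub>0 'k) \<Rightarrow> ('x list \<Rightarrow>\<^sub>0 'k)" where
  "act h = oper (SOME f. f \<in> h)"

lemma act_cl: "f \<in> A.C \<Longrightarrow> act (T.cl h) f = oper h f"
proof -
  assume f: "f \<in> A.C"
  have "(SOME f. f \<in> T.cl h) \<in> T.cl h" by (rule someI[of _ h]) (rule T.cl_self)
  then have "oper ((SOME f. f \<in> T.cl h) - h) f = 0"
    unfolding T.mem_cl_iff by (rule oper_kills_I[OF _ f])
  then show ?thesis
    by (simp add: act_def linmap_diff[OF linmap_oper(2)])
qed

lemma linmap_act [simp]: "linmap (act h)"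
  by (simp add: act_def)

lemma act_in: "f \<in> A.C \<Longrightarrow> act h f \<in> A.C"
  by (simp add: act_def oper_in)

lemma act_simps:
  assumes "f \<in> A.C"
  shows "act gT f = G f" "act xT f = D f" "act \<one>\<^bsub>T.B\<^esub> f = f"
    and "h \<in> carrier T.B \<Longrightarrow> h' \<in> carrier T.B \<Longrightarrow> act (h \<otimes>\<^bsub>T.B\<^esub> h') f = act h (act h' f)"
    and "h \<in> carrier T.B \<Longrightarrow> h' \<in> carrier T.B \<Longrightarrow> act (h \<oplus>\<^bsub>T.B\<^esub> h') f = act h f + act h' f"
    and "h \<in> carrier T.B \<Longrightarrow> act (c \<odot>\<^bsub>T.B\<^esub> h) f = c \<cdot> act h f"
proof -
  show "act gT f = G f" "act xT f = D f" "act \<one>\<^bsub>T.B\<^esub> f = f"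
    unfolding g_cl x_cl T.B_one using assms by (simp_all add: act_cl oper_mon)
  assume "h \<in> carrier T.B"
  then obtain p where p: "h = T.cl p" by (auto elim: T.B_cases)
  show "act (c \<odot>\<^bsub>T.B\<^esub> h) f = c \<cdot> act h f"
    unfolding p T.B_smult using assms by (simp add: act_cl linmap_scale[OF linmap_oper(2)])
  assume "h' \<in> carrier T.B"
  then obtain p' where p': "h' = T.cl p'" by (auto elim: T.B_cases)
  show "act (h \<otimes>\<^bsub>T.B\<^esub> h') f = act h (act h' f)"
    unfolding p p' using assms by (simp add: T.B_mult act_cl oper_mult oper_in)
  show "act (h \<oplus>\<^bsub>T.B\<^esub> h') f = act h f + act h' f"
    unfolding p p' using assms by (simp add: T.B_add act_cl linmap_add[OF linmap_oper(2)])
qed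

text \<open>
  A formal sum of pairs of Taft elements acts on two arguments, followed by a bilinear map \<open>\<beta>\<close>.
  Letting \<open>\<beta>\<close> vary makes the formal sums acting as zero an ideal: on the left, multiplication by
  a pair \<open>(h, h')\<close> just changes \<open>\<beta>\<close>.
\<close>

definition bilinear :: "(('x list \<Rightarrow>\<^sub>0 'k) \<Rightarrow> ('x list \<Rightarrow>\<^sub>0 'k) \<Rightarrow> ('x list \<Rightarrow>\<^sub>0 'k)) \<Rightarrow> bool" where
  "bilinear \<beta> \<longleftrightarrow> (\<forall>a. linmap (\<beta> a)) \<and> (\<forall>b. linmap (\<lambda>a. \<beta> a b))"

definition act2 where
  "act2 \<beta> s a b = lin (\<lambda>p. \<beta> (act (fst p) a) (act (snd p) b)) s"

lemma linmap_act2 [simp]: "linmap (\<lambda>s. act2 \<beta> s a b)"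
  by (simp add: act2_def)

lemma act2_mon: "act2 \<beta> (mon p c) a b = c \<cdot> \<beta> (act (fst p) a) (act (snd p) b)"
  by (simp add: act2_def)

lemma act2_mon_mult:
  assumes "s \<in> TT.C" "u \<in> carrier T.B" "v \<in> carrier T.B" "a \<in> A.C" "b \<in> A.C"
  shows "act2 \<beta> (conv (mult (T.B \<times>\<times> T.B)) (mon (u, v) c) s) a b
      = c \<cdot> act2 (\<lambda>a b. \<beta> (act u a) (act v b)) s a b"
    and "act2 \<beta> (conv (mult (T.B \<times>\<times> T.B)) s (mon (u, v) c)) a b
      = c \<cdot> act2 \<beta> s (act u a) (act v b)"
proof -
  have p: "fst p \<in> carrier T.B" "snd p \<in> carrier T.B" if "p \<in> supp s" for p
    using supp_formal_sums[OF assms(1) that] by auto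
  show "act2 \<beta> (conv (mult (T.B \<times>\<times> T.B)) (mon (u, v) c) s) a b
      = c \<cdot> act2 (\<lambda>a b. \<beta> (act u a) (act v b)) s a b"
    unfolding act2_def lin_conv lin_mon using assms p
    by (intro arg_cong[where f = "pscale c"] lin_cong) (simp add: mult_DirProd' act_simps)
  show "act2 \<beta> (conv (mult (T.B \<times>\<times> T.B)) s (mon (u, v) c)) a b
      = c \<cdot> act2 \<beta> s (act u a) (act v b)"
    unfolding act2_def lin_conv lin_fun_scale[symmetric] lin_mon using assms p
    by (intro lin_cong) (simp add: mult_DirProd' act_simps act_in)
qed

lemma act2_kills_I:
  assumes "s \<in> TT.I" "bilinear \<beta>" "a \<in> A.C" "b \<in> A.C"
  shows "act2 \<beta> s a b = 0"
proof -
  let ?K = "{s \<in> TT.C. \<forall>\<beta>. bilinear \<beta> \<longrightarrow> (\<forall>a\<in>A.C. \<forall>b\<in>A.C. act2 \<beta> s a b = 0)}"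
  have "TT.I \<subseteq> ?K"
  proof (rule TT.I_minimal)
    show "lsubspace ?K"
      by (simp add: lsubspace_def linmap_add[OF linmap_act2] linmap_scale[OF linmap_act2]
          linmap_zero[OF linmap_act2])
    show "tensor_rels T.B T.B \<subseteq> ?K"
    proof
      fix r assume r: "r \<in> tensor_rels T.B T.B"
      then have "r \<in> TT.C" using TT.rels by auto
      moreover have "act2 \<beta> r a b = 0" if "bilinear \<beta>" "a \<in> A.C" "b \<in> A.C" for \<beta> a b
      proof -
        note lin = linmap_diff[OF linmap_act2, of \<beta> _ _ a b] act2_mon fst_conv snd_conv
        have b: "\<beta> (a + a') b = \<beta> a b + \<beta> a' b" "\<beta> b (a + a') = \<beta> b a + \<beta> b a'"
          "\<beta> (c \<cdot> a) b = c \<cdot> \<beta> a b" "\<beta> b (c \<cdot> a) = c \<cdot> \<beta> b a" for a a' b c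
          using that(1) by (simp_all add: bilinear_def linmap_def)
        show ?thesis
          using r that(2,3) unfolding tensor_rels_def
          by (elim UnE; clarsimp simp only: mem_Collect_eq lin; simp add: act_simps b)
      qed
      ultimately show "r \<in> ?K" by blast
    qed
    fix p s assume p: "p \<in> carrier (T.B \<times>\<times> T.B)" and s: "s \<in> ?K"
    obtain u v where uv: "p = (u, v)" "u \<in> carrier T.B" "v \<in> carrier T.B" using p by auto
    have bil: "bilinear (\<lambda>a b. \<beta> (act u a) (act v b))" if "bilinear \<beta>" for \<beta>
      using that by (auto simp: bilinear_def intro: linmap_comp[OF _ linmap_act]
          linmap_comp[of "\<lambda>a. \<beta> a _", OF _ linmap_act])
    have mon: "mon p 1 \<in> TT.C" using p by simp
    show "conv (mult (T.B \<times>\<times> T.B)) (mon p 1) s \<in> ?K" "conv (mult (T.B \<times>\<times> T.B)) s (mon p 1) \<in> ?K"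
      using s uv TT.mul_closed[OF mon] TT.mul_closed[OF _ mon] bil
      by (auto simp: act2_mon_mult act_in)
  qed auto
  with assms show ?thesis by auto
qed

text \<open>
  The coproducts \<open>g \<otimes> g\<close> and \<open>g \<otimes> x + x \<otimes> 1\<close> are the rule \<open>G(ab) = G(a)G(b)\<close> and the twisted Leibniz
  rule of \<open>D\<close>; multiplicativity of the coproduct passes this on to words.
\<close>

lemma act2_\<Delta>_word:
  assumes "a \<in> A.C" "b \<in> A.C"
  shows "act2 (\<diamondop>) (\<Delta>_word w) a b = op_word w (a \<diamondop> b)"
proof (induction w)
  case Nil
  then show ?case using assms by (simp add: \<Delta>_word_def act2_mon act_simps)
next
  case (Cons y w)
  have eq: "\<Delta>_word (y # w) = conv (mult (T.B \<times>\<times> T.B)) (\<Delta> y) (\<Delta>_word w)"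
    by (simp add: \<Delta>_word_def)
  note lm = act2_mon_mult(1)[OF \<Delta>_word_in _ _ assms, where c = 1, unfolded scale_one]
  have in_C: "act (fst p) a \<in> A.C" "act (snd p) b \<in> A.C" for p
    using assms by (simp_all add: act_in)
  show ?case
  proof (cases y)
    case Gr
    have "act2 (\<diamondop>) (\<Delta>_word (y # w)) a b = act2 (\<lambda>a b. act gT a \<diamondop> act gT b) (\<Delta>_word w) a b"
      unfolding eq by (simp add: Gr \<Delta>_def lm)
    also have "\<dots> = G (act2 (\<diamondop>) (\<Delta>_word w) a b)"
      using in_C by (simp add: act2_def act_simps linear_lin[OF linmap_hom_ext] hom_ext_mult)
    finally show ?thesis using Cons Gr by simp
  next
    case Sk
    have "act2 (\<diamondop>) (\<Delta>_word (y # w)) a b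
      = act2 (\<lambda>a b. act gT a \<diamondop> act xT b) (\<Delta>_word w) a b + act2 (\<lambda>a b. act xT a \<diamondop> act \<one>\<^bsub>T.B\<^esub> b) (\<Delta>_word w) a b"
      unfolding eq by (simp add: Sk \<Delta>_def conv_add linmap_add[OF linmap_act2] lm)
    also have "\<dots> = D (act2 (\<diamondop>) (\<Delta>_word w) a b)"
      using in_C by (simp add: act2_def act_simps linear_lin[OF linmap_skew_ext] skew_ext_mult lin_fun_add)
    finally show ?thesis using Cons Sk by simp
  qed
qed

definition rho :: "(taft_gen list \<Rightarrow>\<^sub>0 'k) set \<Rightarrow> ('x list \<Rightarrow>\<^sub>0 'k) set \<Rightarrow> ('x list \<Rightarrow>\<^sub>0 'k) set" where
  "rho = (\<lambda>h\<in>carrier T.B. \<lambda>a\<in>carrier A.B. A.cl (act h (SOME f. f \<in> a)))"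

lemma rho_cl:
  assumes "h \<in> carrier T.B" "f \<in> A.C"
  shows "rho h (A.cl f) = A.cl (act h f)"
proof -
  have "(SOME f'. f' \<in> A.cl f) \<in> A.cl f" by (rule someI[of _ f]) (rule A.cl_self)
  then have "act h ((SOME f'. f' \<in> A.cl f) - f) \<in> A.I"
    unfolding A.mem_cl_iff by (simp add: act_def oper_I)
  then have "A.cl (act h (SOME f'. f' \<in> A.cl f)) = A.cl (act h f)"
    unfolding A.cl_eq_iff by (simp add: linmap_diff)
  with assms show ?thesis by (simp add: rho_def)
qed

lemma oper_unit: "oper h (mon [] 1) = cf (hom_ext \<epsilon> h) [] \<cdot> mon [] 1"
proof -
  have G: "G (mon [] c) = mon [] c" and D: "D (mon [] c) = 0" for c
    by (simp_all add: hom_ext_mon skew_ext_mon)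
  have word: "op_word w (mon [] 1) = cf (word_prod \<epsilon> w) [] \<cdot> mon [] 1
      \<and> (\<exists>c. word_prod \<epsilon> w = mon [] c)" for w
  proof (induction w)
    case (Cons y w)
    then show ?case by (cases y) (auto simp: G D \<epsilon>_def conv_mon intro: exI[of _ "0::'k"])
  qed auto
  have scalar: "linmap (\<lambda>s. cf s [] \<cdot> (mon [] 1 :: 'x list \<Rightarrow>\<^sub>0 'k))"
    by (simp add: linmap_def lookup_add single_add)
  have "oper h (mon [] 1) = lin (\<lambda>w. cf (word_prod \<epsilon> w) [] \<cdot> mon [] 1) h"
    unfolding oper_def using word by (intro lin_cong) blast
  also have "\<dots> = cf (hom_ext \<epsilon> h) [] \<cdot> mon [] 1"
    unfolding hom_ext_def by (rule linear_lin[OF scalar, symmetric])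
  finally show ?thesis .
qed

theorem module_algebra_rho: "module_algebra H A.B rho"
  unfolding module_algebra_def taft_sel
proof (intro conjI ballI allI)
  have "rho h a \<in> carrier A.B" if "h \<in> carrier T.B" "a \<in> carrier A.B" for h a
    using that by (auto elim!: A.B_cases simp: rho_cl act_in)
  then show "rho \<in> carrier T.B \<rightarrow>\<^sub>E (carrier A.B \<rightarrow>\<^sub>E carrier A.B)"
    by (auto simp: rho_def)
next
  fix h a b assume "h \<in> carrier T.B" "a \<in> carrier A.B" "b \<in> carrier A.B"
  then show "rho h (a \<oplus>\<^bsub>A.B\<^esub> b) = rho h a \<oplus>\<^bsub>A.B\<^esub> rho h b"
    by (elim A.B_cases) (simp add: A.B_add rho_cl act_in linmap_add)
next
  fix h h' a assume h: "h \<in> carrier T.B" "h' \<in> carrier T.B" and "a \<in> carrier A.B"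
  then obtain f where f: "f \<in> A.C" "a = A.cl f" by (elim A.B_cases)
  have "h \<oplus>\<^bsub>T.B\<^esub> h' \<in> carrier T.B" "h \<otimes>\<^bsub>T.B\<^esub> h' \<in> carrier T.B"
    using h T.B.a_closed monoid.m_closed[OF T.monoid_B] by auto
  with f h show "rho (h \<oplus>\<^bsub>T.B\<^esub> h') a = rho h a \<oplus>\<^bsub>A.B\<^esub> rho h' a"
    "rho (h \<otimes>\<^bsub>T.B\<^esub> h') a = rho h (rho h' a)"
    by (simp_all add: A.B_add rho_cl act_in act_simps)
next
  fix c h a assume h: "h \<in> carrier T.B" and "a \<in> carrier A.B"
  then obtain f where f: "f \<in> A.C" "a = A.cl f" by (elim A.B_cases)
  have "c \<odot>\<^bsub>T.B\<^esub> h \<in> carrier T.B" using h by (metis T.B_cases T.B_smult T.cl_in_B T_C)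
  with f h show "rho h (c \<odot>\<^bsub>A.B\<^esub> a) = c \<odot>\<^bsub>A.B\<^esub> rho h a"
    "rho (c \<odot>\<^bsub>T.B\<^esub> h) a = c \<odot>\<^bsub>A.B\<^esub> rho h a"
    by (simp_all add: A.B_smult rho_cl act_in act_simps linmap_scale)
next
  fix a assume "a \<in> carrier A.B"
  then show "rho \<one>\<^bsub>T.B\<^esub> a = a"
    by (elim A.B_cases) (simp add: rho_cl act_simps)
next
  fix h assume "h \<in> carrier T.B"
  then obtain p where "h = T.cl p" by (auto elim: T.B_cases)
  then show "rho h \<one>\<^bsub>A.B\<^esub> = counit H h \<odot>\<^bsub>A.B\<^esub> \<one>\<^bsub>A.B\<^esub>"
    by (simp add: A.B_one A.B_smult rho_cl act_cl oper_unit counit_H)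
next
  fix h a b s assume "h \<in> carrier T.B" "a \<in> carrier A.B" "b \<in> carrier A.B" and s: "s \<in> comult H h"
  then obtain e f where e: "e \<in> A.C" "a = A.cl e" and f: "f \<in> A.C" "b = A.cl f"
    by (metis A.B_cases)
  obtain p where "p \<in> h" "s \<in> TT.cl (lin \<Delta>_word p)"
    using s unfolding comult_H by blast
  then have p: "p \<in> h" "s - lin \<Delta>_word p \<in> TT.I"
    by (simp_all only: TT.mem_cl_iff)
  have h: "h = T.cl p"
  proof -
    obtain p' where "h = T.cl p'" using \<open>h \<in> carrier T.B\<close> by (auto elim: T.B_cases)
    moreover from this p(1) have "T.cl p = T.cl p'"
      by (simp only: T.cl_eq_iff T.mem_cl_iff)
    ultimately show ?thesis by simp
  qed
  have \<Delta>_in: "lin \<Delta>_word p \<in> TT.C" by (intro lin_in_formal_sums) simp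
  from formal_sums_closed(2)[OF TT.I_sub[OF p(2)] this] have s_in: "s \<in> TT.C" by simp
  have "bilinear (\<diamondop>)" by (simp add: bilinear_def)
  from act2_kills_I[OF p(2) this e(1) f(1)]
  have "act2 (\<diamondop>) s e f = act2 (\<diamondop>) (lin \<Delta>_word p) e f"
    by (simp add: linmap_diff[OF linmap_act2])
  also have "\<dots> = oper p (e \<diamondop> f)"
    using e f by (simp add: linear_lin[OF linmap_act2] act2_\<Delta>_word oper_def)
  finally have "A.cl (oper p (e \<diamondop> f)) = A.cl (act2 (\<diamondop>) s e f)" by simp
  also have "\<dots> = (\<Oplus>\<^bsub>A.B\<^esub>w\<in>supp s. cf s w \<odot>\<^bsub>A.B\<^esub> A.cl (act (fst w) e \<diamondop> act (snd w) f))"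
    unfolding act2_def using e f by (intro A.B_finsum_lin[symmetric]) (simp add: act_in)
  also have "\<dots> = (\<Oplus>\<^bsub>A.B\<^esub>w\<in>supp s. cf s w \<odot>\<^bsub>A.B\<^esub> (rho (fst w) a \<otimes>\<^bsub>A.B\<^esub> rho (snd w) b))"
    using e f supp_formal_sums[OF s_in]
    by (intro A.B.finsum_cong') (auto simp: A.B_mult rho_cl act_in A.B_smult)
  finally show "rho h (a \<otimes>\<^bsub>A.B\<^esub> b) =
      (\<Oplus>\<^bsub>A.B\<^esub>w\<in>supp s. cf s w \<odot>\<^bsub>A.B\<^esub> (rho (fst w) a \<otimes>\<^bsub>A.B\<^esub> rho (snd w) b))"
    using e f \<open>h \<in> carrier T.B\<close> by (simp add: A.B_mult rho_cl h act_cl)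
qed

lemma rho_gx:
  assumes "f \<in> A.C"
  shows "rho gT (A.cl f) = A.cl (G f)" "rho xT (A.cl f) = A.cl (D f)"
  using assms by (simp_all add: rho_cl act_simps)

end

text \<open>Conversely, a module algebra structure is determined by \<open>g\<close> and \<open>x\<close> on the generators.\<close>

locale taft_module_algebra = taft_relations n m lam + A: free_relations X R
  for n m :: nat and lam :: "'k::field" and X :: "'x set" and R :: "('x list \<Rightarrow>\<^sub>0 'k) set" +
  fixes \<rho>
  assumes module_algebra: "module_algebra H A.B \<rho>"
begin

lemmas ma = module_algebra[unfolded module_algebra_def taft_sel]

lemmas rho_ext = ma[THEN conjunct1]
  and rho_add = ma[THEN conjunct2, THEN conjunct1, rule_format]
  and rho_add_left = ma[THEN conjunct2, THEN conjunct2, THEN conjunct1, rule_format]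
  and rho_smult = ma[THEN conjunct2, THEN conjunct2, THEN conjunct2, THEN conjunct1, rule_format, THEN conjunct1]
  and rho_smult_left = ma[THEN conjunct2, THEN conjunct2, THEN conjunct2, THEN conjunct1, rule_format, THEN conjunct2]
  and rho_one = ma[THEN conjunct2, THEN conjunct2, THEN conjunct2, THEN conjunct2, THEN conjunct1, rule_format]
  and rho_mult = ma[THEN conjunct2, THEN conjunct2, THEN conjunct2, THEN conjunct2, THEN conjunct2, THEN conjunct1, rule_format]
  and rho_unit = ma[THEN conjunct2, THEN conjunct2, THEN conjunct2, THEN conjunct2, THEN conjunct2, THEN conjunct2, THEN conjunct1, rule_format]
  and rho_comult = ma[THEN conjunct2, THEN conjunct2, THEN conjunct2, THEN conjunct2, THEN conjunct2, THEN conjunct2, THEN conjunct2, rule_format]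

lemma rho_in: "h \<in> carrier T.B \<Longrightarrow> a \<in> carrier A.B \<Longrightarrow> \<rho> h a \<in> carrier A.B"
  using rho_ext by (blast dest: PiE_mem)

lemma rho_product:
  assumes "e \<in> A.C" "f \<in> A.C" "s \<in> comult H h" "h \<in> carrier T.B" "s \<in> TT.C"
    and F: "\<And>w. w \<in> supp s \<Longrightarrow> F w \<in> A.C \<and> \<rho> (fst w) (A.cl e) \<otimes>\<^bsub>A.B\<^esub> \<rho> (snd w) (A.cl f) = A.cl (F w)"
  shows "\<rho> h (A.cl (e \<diamondop> f)) = A.cl (lin F s)"
proof -
  have "\<rho> h (A.cl (e \<diamondop> f)) = (\<Oplus>\<^bsub>A.B\<^esub>w\<in>supp s. cf s w \<odot>\<^bsub>A.B\<^esub> (\<rho> (fst w) (A.cl e) \<otimes>\<^bsub>A.B\<^esub> \<rho> (snd w) (A.cl f)))"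
    using rho_comult[OF assms(4) _ _ assms(3), of "A.cl e" "A.cl f"] assms(1,2) by (simp add: A.B_mult)
  also have "\<dots> = (\<Oplus>\<^bsub>A.B\<^esub>w\<in>supp s. cf s w \<odot>\<^bsub>A.B\<^esub> A.cl (F w))"
    using F by (intro A.B.finsum_cong') (auto simp: A.B_smult)
  also have "\<dots> = A.cl (lin F s)"
    using F by (intro A.B_finsum_lin) blast
  finally show ?thesis .
qed

lemma \<Delta>_in_comult: "\<Delta> Gr \<in> comult H gT" "\<Delta> Sk \<in> comult H xT"
proof -
  have "lin \<Delta>_word (mon [y] 1) = \<Delta> y" for y
    using TT.mul_one(2)[OF \<Delta>_in, of y] by (simp add: \<Delta>_word_def)
  then have "\<Delta> y \<in> comult H (T.cl (mon [y] 1))" for y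
    unfolding comult_H using T.cl_self[of "mon [y] 1"] TT.cl_self[of "\<Delta> y"] by (intro UN_I) auto
  then show "\<Delta> Gr \<in> comult H gT" "\<Delta> Sk \<in> comult H xT"
    unfolding g_cl x_cl by blast+
qed

lemma rho_gx_mult:
  assumes ef: "e \<in> A.C" "f \<in> A.C"
    and gx: "\<rho> gT (A.cl e) = A.cl e'" "\<rho> xT (A.cl e) = A.cl e''" "e' \<in> A.C" "e'' \<in> A.C"
      "\<rho> gT (A.cl f) = A.cl f'" "\<rho> xT (A.cl f) = A.cl f''" "f' \<in> A.C" "f'' \<in> A.C"
  shows "\<rho> gT (A.cl (e \<diamondop> f)) = A.cl (e' \<diamondop> f')"
    and "\<rho> xT (A.cl (e \<diamondop> f)) = A.cl (e' \<diamondop> f'' + e'' \<diamondop> f)"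
proof -
  define F where "F w = (SOME p. p \<in> A.C \<and> \<rho> (fst w) (A.cl e) \<otimes>\<^bsub>A.B\<^esub> \<rho> (snd w) (A.cl f) = A.cl p)" for w
  have F: "F w \<in> A.C \<and> \<rho> (fst w) (A.cl e) \<otimes>\<^bsub>A.B\<^esub> \<rho> (snd w) (A.cl f) = A.cl (F w)"
    if "fst w \<in> carrier T.B" "snd w \<in> carrier T.B" for w
  proof -
    have "\<rho> (fst w) (A.cl e) \<otimes>\<^bsub>A.B\<^esub> \<rho> (snd w) (A.cl f) \<in> carrier A.B"
      using that ef by (intro monoid.m_closed[OF A.monoid_B] rho_in) auto
    then have "\<exists>p. p \<in> A.C \<and> \<rho> (fst w) (A.cl e) \<otimes>\<^bsub>A.B\<^esub> \<rho> (snd w) (A.cl f) = A.cl p"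
      by (elim A.B_cases) blast
    then show ?thesis unfolding F_def by (rule someI_ex)
  qed
  have F\<Delta>: "F w \<in> A.C \<and> \<rho> (fst w) (A.cl e) \<otimes>\<^bsub>A.B\<^esub> \<rho> (snd w) (A.cl f) = A.cl (F w)"
    if "w \<in> supp (\<Delta> y)" for w y
    using supp_formal_sums[OF \<Delta>_in that] by (intro F) auto
  have lift: "A.cl (F (gT, gT)) = A.cl (e' \<diamondop> f')" "A.cl (F (gT, xT)) = A.cl (e' \<diamondop> f'')"
      "A.cl (F (xT, \<one>\<^bsub>T.B\<^esub>)) = A.cl (e'' \<diamondop> f)"
    using F[of "(gT, gT)"] F[of "(gT, xT)"] F[of "(xT, \<one>\<^bsub>T.B\<^esub>)"] gx ef
    by (simp_all add: A.B_mult rho_one)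
  show "\<rho> gT (A.cl (e \<diamondop> f)) = A.cl (e' \<diamondop> f')"
    using rho_product[OF ef \<Delta>_in_comult(1) _ \<Delta>_in F\<Delta>[of _ Gr]] lift by (simp add: \<Delta>_def)
  have "\<rho> xT (A.cl (e \<diamondop> f)) = A.cl (F (gT, xT) + F (xT, \<one>\<^bsub>T.B\<^esub>))"
    using rho_product[OF ef \<Delta>_in_comult(2) _ \<Delta>_in F\<Delta>[of _ Sk]] by (simp add: \<Delta>_def lin_add)
  also have "\<dots> = A.cl (F (gT, xT)) \<oplus>\<^bsub>A.B\<^esub> A.cl (F (xT, \<one>\<^bsub>T.B\<^esub>))"
    using F[of "(gT, xT)"] F[of "(xT, \<one>\<^bsub>T.B\<^esub>)"] by (intro A.B_add[symmetric]) auto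
  also have "\<dots> = A.cl (e' \<diamondop> f'' + e'' \<diamondop> f)"
    unfolding lift using ef gx by (intro A.B_add) auto
  finally show "\<rho> xT (A.cl (e \<diamondop> f)) = A.cl (e' \<diamondop> f'' + e'' \<diamondop> f)" .
qed

lemma rho_gx_unit: "\<rho> gT (A.cl (mon [] 1)) = A.cl (mon [] 1)" "\<rho> xT (A.cl (mon [] 1)) = A.cl 0"
  using rho_unit[of gT] rho_unit[of xT]
  by (simp_all add: A.B_one A.B_smult g_cl x_cl counit_H hom_ext_mon \<epsilon>_def)

text \<open>
  Induction over words: the coproducts of \<open>g\<close> and \<open>x\<close> dictate exactly the product rules that define
  the two extensions.
\<close>

lemma rho_gx_ext:
  assumes gen_in: "\<And>y. y \<in> X \<Longrightarrow> \<gamma> y \<in> A.C" "\<And>y. y \<in> X \<Longrightarrow> \<delta> y \<in> A.C"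
    and gen: "\<And>y. y \<in> X \<Longrightarrow> \<rho> gT (A.cl (mon [y] 1)) = A.cl (\<gamma> y)"
      "\<And>y. y \<in> X \<Longrightarrow> \<rho> xT (A.cl (mon [y] 1)) = A.cl (\<delta> y)"
    and f: "f \<in> A.C"
  shows "\<rho> gT (A.cl f) = A.cl (hom_ext \<gamma> f) \<and> \<rho> xT (A.cl f) = A.cl (skew_ext \<gamma> \<delta> f)"
proof -
  have hom_in: "hom_ext \<gamma> f \<in> A.C" and skew_in: "skew_ext \<gamma> \<delta> f \<in> A.C" if "f \<in> A.C" for f
    using that gen_in by (auto intro: hom_ext_in skew_ext_in)
  have word: "\<rho> gT (A.cl (mon w 1)) = A.cl (word_prod \<gamma> w) \<and> \<rho> xT (A.cl (mon w 1)) = A.cl (skew_word \<gamma> \<delta> w)"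
    if "set w \<subseteq> X" for w
    using that
  proof (induction w)
    case (Cons y w)
    then have "mon [y] 1 \<in> A.C" "mon w 1 \<in> A.C"
      by (auto simp: lists_eq_set intro!: mon_in_formal_sums)
    moreover from Cons have "word_prod \<gamma> w \<in> A.C" "skew_word \<gamma> \<delta> w \<in> A.C"
      using gen_in by (auto intro!: word_prod_in skew_word_in)
    ultimately show ?case using Cons rho_gx_mult[of "mon [y] 1" "mon w 1" "\<gamma> y" "\<delta> y" "word_prod \<gamma> w" "skew_word \<gamma> \<delta> w"]
      by (simp add: gen gen_in conv_mon)
  qed (simp add: rho_gx_unit)
  from f show ?thesis
  proof (induction f rule: formal_sums_induct)
    case zero
    show ?case
      using rho_smult[of gT "A.cl 0" 0] rho_smult[of xT "A.cl 0" 0] rho_in[of gT "A.cl 0"] rho_in[of xT "A.cl 0"]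
      by (auto elim!: A.B_cases simp: A.B_smult linmap_zero)
  next
    case (mon w c)
    then have w: "set w \<subseteq> X" "mon w 1 \<in> A.C" by auto
    then show ?case
      using word[OF w(1)] rho_smult[of gT "A.cl (mon w 1)" c] rho_smult[of xT "A.cl (mon w 1)" c]
      by (simp add: A.B_smult hom_ext_mon skew_ext_mon)
  next
    case (add f g)
    then show ?case
      using rho_add[of gT "A.cl f" "A.cl g"] rho_add[of xT "A.cl f" "A.cl g"]
      by (simp add: A.B_add hom_in skew_in linmap_add)
  qed
qed

lemma rho_word:
  assumes "a \<in> carrier A.B"
  shows "\<rho> (T.cl (mon w 1)) a = foldr (case_taft_gen (\<rho> gT) (\<rho> xT)) w a
    \<and> foldr (case_taft_gen (\<rho> gT) (\<rho> xT)) w a \<in> carrier A.B"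
proof (induction w)
  case Nil
  show ?case using rho_one[OF assms] assms by (simp add: T.B_one)
next
  case (Cons y w)
  have "T.cl (mon (y # w) 1) = T.cl (mon [y] 1) \<otimes>\<^bsub>T.B\<^esub> T.cl (mon w 1)"
    by (simp add: T.B_mult conv_mon)
  then have "\<rho> (T.cl (mon (y # w) 1)) a = \<rho> (T.cl (mon [y] 1)) (\<rho> (T.cl (mon w 1)) a)"
    using assms by (simp add: rho_mult)
  then show ?case
    using Cons rho_in[of gT] rho_in[of xT] by (cases y) (simp_all add: g_cl[symmetric] x_cl[symmetric])
qed

lemma rho_g_pow: "a \<in> carrier A.B \<Longrightarrow> (\<rho> gT ^^ n) a = a"
proof -
  assume a: "a \<in> carrier A.B"
  have "foldr (case_taft_gen (\<rho> gT) (\<rho> xT)) (replicate k Gr) a = (\<rho> gT ^^ k) a" for k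
    by (induction k) simp_all
  then have "\<rho> (T.cl (mon (replicate n Gr) 1)) a = (\<rho> gT ^^ n) a"
    using rho_word[OF a] by metis
  moreover have "T.cl (mon (replicate n Gr) 1) = T.cl (mon [] 1)"
    unfolding T.cl_eq_iff by (rule T.I_rel) (simp add: taft_rels_def)
  ultimately show ?thesis
    using rho_one[OF a] by (simp add: T.B_one)
qed

lemma rho_gx_commute:
  assumes "a \<in> carrier A.B"
  shows "\<rho> gT (\<rho> xT a) = lam \<odot>\<^bsub>A.B\<^esub> \<rho> xT (\<rho> gT a)"
proof -
  have "mon [Gr, Sk] 1 - lam \<cdot> mon [Sk, Gr] 1 \<in> T.I"
    by (rule T.I_rel) (simp add: taft_rels_def)
  then have "T.cl (mon [Gr, Sk] 1) = lam \<odot>\<^bsub>T.B\<^esub> T.cl (mon [Sk, Gr] 1)"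
    unfolding T.B_smult T.cl_eq_iff .
  then have "\<rho> (T.cl (mon [Gr, Sk] 1)) a = lam \<odot>\<^bsub>A.B\<^esub> \<rho> (T.cl (mon [Sk, Gr] 1)) a"
    using assms by (simp add: rho_smult_left)
  then show ?thesis
    using rho_word[OF assms, of "[Gr, Sk]"] rho_word[OF assms, of "[Sk, Gr]"] by simp
qed

end

lemma taft_module_algebra_unique:
  fixes X :: "'x set" and R :: "('x list \<Rightarrow>\<^sub>0 'k::field) set"
  assumes "taft_module_algebra n m lam X R \<rho>" "taft_module_algebra n m lam X R \<rho>'"
    and gen: "\<And>y. y \<in> X \<Longrightarrow> \<rho> (taft_g n lam m) (pres_gen X R y) = \<rho>' (taft_g n lam m) (pres_gen X R y)"
      "\<And>y. y \<in> X \<Longrightarrow> \<rho> (taft_x n lam m) (pres_gen X R y) = \<rho>' (taft_x n lam m) (pres_gen X R y)"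
  shows "\<rho> = \<rho>'"
proof -
  interpret P: taft_module_algebra n m lam X R \<rho> by fact
  interpret P': taft_module_algebra n m lam X R \<rho>' by fact
  note T = P.T_C
  define \<gamma> where "\<gamma> y = (SOME p. p \<in> P.A.C \<and> \<rho> P.gT (P.A.cl (mon [y] 1)) = P.A.cl p)" for y
  define \<delta> where "\<delta> y = (SOME p. p \<in> P.A.C \<and> \<rho> P.xT (P.A.cl (mon [y] 1)) = P.A.cl p)" for y
  have lift: "\<exists>p. p \<in> P.A.C \<and> a = P.A.cl p" if "a \<in> carrier P.A.B" for a
    using that by (elim P.A.B_cases) blast
  have \<gamma>: "\<gamma> y \<in> P.A.C \<and> \<rho> P.gT (P.A.cl (mon [y] 1)) = P.A.cl (\<gamma> y)" if "y \<in> X" for y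
    unfolding \<gamma>_def by (rule someI_ex[OF lift]) (use that in \<open>auto intro!: P.rho_in\<close>)
  have \<delta>: "\<delta> y \<in> P.A.C \<and> \<rho> P.xT (P.A.cl (mon [y] 1)) = P.A.cl (\<delta> y)" if "y \<in> X" for y
    unfolding \<delta>_def by (rule someI_ex[OF lift]) (use that in \<open>auto intro!: P.rho_in\<close>)
  have gx: "\<rho> P.gT a = \<rho>' P.gT a \<and> \<rho> P.xT a = \<rho>' P.xT a" if a: "a \<in> carrier P.A.B" for a
  proof -
    obtain f where f: "f \<in> P.A.C" "a = P.A.cl f" using a by (elim P.A.B_cases)
    show ?thesis
      using P.rho_gx_ext[of \<gamma> \<delta> f] P'.rho_gx_ext[of \<gamma> \<delta> f] f \<gamma> \<delta> gen
      by (simp add: P.A.pres_gen_cl)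
  qed
  have word: "\<rho> (P.T.cl (mon w 1)) a = \<rho>' (P.T.cl (mon w 1)) a" if a: "a \<in> carrier P.A.B" for w a
  proof -
    have "foldr (case_taft_gen (\<rho> P.gT) (\<rho> P.xT)) w a = foldr (case_taft_gen (\<rho>' P.gT) (\<rho>' P.xT)) w a"
    proof (induction w)
      case (Cons y w)
      then show ?case using gx P.rho_word[OF a, of w] by (cases y) simp_all
    qed simp
    then show ?thesis using P.rho_word[OF a] P'.rho_word[OF a] by simp
  qed
  have all: "\<rho> (P.T.cl h) a = \<rho>' (P.T.cl h) a" if a: "a \<in> carrier P.A.B" for h a
  proof -
    have scale: "\<rho> (P.T.cl (mon w c)) a = \<rho>' (P.T.cl (mon w c)) a" for w c
      using word[OF a, of w] P.rho_smult_left[OF _ a, of "P.T.cl (mon w 1)" c]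
        P'.rho_smult_left[OF _ a, of "P.T.cl (mon w 1)" c]
      by (simp add: P.T.B_smult)
    have "h \<in> P.T.C" by simp
    then show ?thesis
    proof (induction h rule: formal_sums_induct)
      case zero
      show ?case using scale[of "[]" 0] by simp
    next
      case (add f g)
      then show ?case
        using P.rho_add_left[OF _ _ a, of "P.T.cl f" "P.T.cl g"]
          P'.rho_add_left[OF _ _ a, of "P.T.cl f" "P.T.cl g"]
        by (simp add: P.T.B_add)
    qed (rule scale)
  qed
  show ?thesis
  proof (rule PiE_ext[OF P.rho_ext P'.rho_ext])
    fix h assume h: "h \<in> carrier P.T.B"
    show "\<rho> h = \<rho>' h"
    proof (rule PiE_ext)
      show "\<rho> h \<in> carrier P.A.B \<rightarrow>\<^sub>E carrier P.A.B" "\<rho>' h \<in> carrier P.A.B \<rightarrow>\<^sub>E carrier P.A.B"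
        using PiE_mem[OF P.rho_ext h] PiE_mem[OF P'.rho_ext h] by simp_all
      show "\<rho> h a = \<rho>' h a" if "a \<in> carrier P.A.B" for a
        using all[OF that] h by (elim P.T.B_cases) simp
    qed
  qed
qed

section \<open>Quantum matrices in low degree\<close>

definition square :: "nat \<Rightarrow> (nat \<times> nat) set" where "square N = {1..N} \<times> {1..N}"

lemma mem_square [simp]: "(i, j) \<in> square N \<longleftrightarrow> i \<in> {1..N} \<and> j \<in> {1..N}"
  by (simp add: square_def)

lemma finite_square [simp]: "finite (square N)"
  by (simp add: square_def)

locale quantum_matrices =
  fixes q :: "'k::field" and N :: nat
  assumes q_nonzero: "q \<noteq> 0"
begin

sublocale Q: free_relations "square N" "qmat_rels q N"
  by unfold_locales (auto simp: qmat_rels_def intro!: formal_sums_closed mon_in_formal_sums)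

lemma qmat_B: "qmat q N = Q.B"
  by (simp only: qmat_def Q.pres_alg_B flip: square_def)

lemma qY_cl: "qY q N i j = Q.cl (mon [(i, j)] 1)"
  by (simp only: qY_def Q.pres_gen_cl flip: square_def)

text \<open>The rewriting of a quadratic word into lexicographically decreasing words.\<close>

definition nf2 :: "nat \<times> nat \<Rightarrow> nat \<times> nat \<Rightarrow> ((nat \<times> nat) list \<Rightarrow>\<^sub>0 'k)" where
  "nf2 u v = (case (u, v) of ((i, j), (k, l)) \<Rightarrow>
    if i < k \<and> j = l \<or> i = k \<and> j < l then mon [v, u] q
    else if i < k \<and> l < j then mon [v, u] 1
    else if i < k \<and> j < l then mon [v, u] 1 + mon [(k, j), (i, l)] (q - inverse q)
    else mon [u, v] 1)"

definition nf :: "((nat \<times> nat) list \<Rightarrow>\<^sub>0 'k) \<Rightarrow> ((nat \<times> nat) list \<Rightarrow>\<^sub>0 'k)" where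
  "nf = lin (\<lambda>w. case w of [u, v] \<Rightarrow> nf2 u v | _ \<Rightarrow> 0)"

lemma linmap_nf [simp]: "linmap nf"
  by (simp add: nf_def)

lemma nf_mon: "nf (mon [u, v] c) = c \<cdot> nf2 u v" "length w \<noteq> 2 \<Longrightarrow> nf (mon w c) = 0"
  by (auto simp: nf_def split: list.split)

lemma nf_high:
  assumes "\<And>w. w \<in> supp f \<Longrightarrow> length w > 2"
  shows "nf f = 0"
proof -
  have "nf f = lin (\<lambda>w. 0) f"
    unfolding nf_def by (rule lin_cong) (auto dest!: assms split: list.split)
  then show ?thesis by simp
qed

lemma nf_rel: "r \<in> qmat_rels q N \<Longrightarrow> nf r = 0"
  by (auto simp: qmat_rels_def linmap_diff nf_mon nf2_def)

text \<open>
  Since the relations are quadratic, the ideal meets degree at most two only in their span, and there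
  \<open>nf\<close> vanishes by inspection of the relations.
\<close>

lemma nf_I: "f \<in> Q.I \<Longrightarrow> nf f = 0"
  and I_degree: "f \<in> Q.I \<Longrightarrow> w \<in> supp f \<Longrightarrow> length w \<ge> 2"
proof -
  define V where "V = {f :: (nat \<times> nat) list \<Rightarrow>\<^sub>0 'k. supp f \<subseteq> {w. length w \<ge> 2}}"
  let ?K = "{f \<in> Q.C. nf f = 0 \<and> f \<in> V}"
  have V: "lsubspace V" unfolding V_def by (rule lsubspace_supp)
  have mon_V: "mon [u, v] c \<in> V" for u v :: "nat \<times> nat" and c :: 'k
    by (simp add: V_def)
  have "Q.I \<subseteq> ?K"
  proof (rule Q.I_minimal)
    show "lsubspace ?K"
      using lsubspaceD[OF V] unfolding lsubspace_def
      by (simp add: linmap_zero linmap_add linmap_scale)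
    have "qmat_rels q N \<subseteq> V"
      by (auto simp: qmat_rels_def intro!: lsubspace_diff[OF V] mon_V)
    then show "qmat_rels q N \<subseteq> ?K" using Q.rels nf_rel by auto
    fix u f assume u: "u \<in> lists (square N)" and f: "f \<in> ?K"
    have "nf (mon u 1 \<diamondop> f) = 0 \<and> mon u 1 \<diamondop> f \<in> V \<and> nf (f \<diamondop> mon u 1) = 0 \<and> f \<diamondop> mon u 1 \<in> V"
    proof (cases "u = []")
      case False
      then have len: "length u + length v > 2" if "v \<in> supp f" for v
        using f that by (cases u) (auto simp: V_def)
      have left: "supp (mon u 1 \<diamondop> f) \<subseteq> {w. length w > 2}"
        by (rule supp_conv) (use len in \<open>force simp: add.commute\<close>)
      have right: "supp (f \<diamondop> mon u 1) \<subseteq> {w. length w > 2}"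
        by (rule supp_conv) (use len in \<open>force simp: add.commute\<close>)
      have le: "{w :: (nat \<times> nat) list. length w > 2} \<subseteq> {w. length w \<ge> 2}" by auto
      have "nf (mon u 1 \<diamondop> f) = 0" "nf (f \<diamondop> mon u 1) = 0"
        by (rule nf_high; use left right in blast)+
      then show ?thesis
        using order_trans[OF left le] order_trans[OF right le] by (simp add: V_def)
    qed (use f in simp)
    then show "mon u 1 \<diamondop> f \<in> ?K" "f \<diamondop> mon u 1 \<in> ?K" using u f by auto
  qed auto
  then show "f \<in> Q.I \<Longrightarrow> nf f = 0" "f \<in> Q.I \<Longrightarrow> w \<in> supp f \<Longrightarrow> length w \<ge> 2" by (auto simp: V_def)
qed

lemma qmat_rels_I:
  assumes "{i, j, k, l} \<subseteq> {1..N}"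
  shows "i < k \<and> j = l \<or> i = k \<and> j < l \<Longrightarrow> mon [(i, j), (k, l)] 1 - mon [(k, l), (i, j)] q \<in> qmat_rels q N"
    and "i < k \<Longrightarrow> l < j \<Longrightarrow> mon [(i, j), (k, l)] 1 - mon [(k, l), (i, j)] 1 \<in> qmat_rels q N"
    and "i < k \<Longrightarrow> j < l \<Longrightarrow> mon [(i, j), (k, l)] 1 - mon [(k, l), (i, j)] 1
      - mon [(i, l), (k, j)] (q - inverse q) \<in> qmat_rels q N"
  subgoal unfolding qmat_rels_def using assms by blast
  subgoal unfolding qmat_rels_def using assms by blast
  subgoal unfolding qmat_rels_def using assms by blast
  done

lemma qmat_rels_cases:
  assumes "r \<in> qmat_rels q N"
  obtains i j k l where "{i, j, k, l} \<subseteq> {1..N}" "i < k \<and> j = l \<or> i = k \<and> j < l"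
      "r = mon [(i, j), (k, l)] 1 - mon [(k, l), (i, j)] q"
  | i j k l where "{i, j, k, l} \<subseteq> {1..N}" "i < k" "l < j"
      "r = mon [(i, j), (k, l)] 1 - mon [(k, l), (i, j)] 1"
  | i j k l where "{i, j, k, l} \<subseteq> {1..N}" "i < k" "j < l"
      "r = mon [(i, j), (k, l)] 1 - mon [(k, l), (i, j)] 1 - mon [(i, l), (k, j)] (q - inverse q)"
  using assms unfolding qmat_rels_def by (elim UnE CollectE exE conjE) (rule that; assumption)+

lemma nf2_congruent:
  assumes "u \<in> square N" "v \<in> square N"
  shows "mon [u, v] 1 - nf2 u v \<in> Q.I"
proof -
  obtain i j k l where uv: "u = (i, j)" "v = (k, l)" by (cases u, cases v)
  have in_N: "{i, j, k, l} \<subseteq> {1..N}" using assms uv by auto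
  consider "i < k \<and> j = l \<or> i = k \<and> j < l" | "i < k" "l < j" | "i < k" "j < l"
    | "k < i \<or> k = i \<and> l \<le> j" by linarith
  then show ?thesis
  proof cases
    case 1
    from Q.I_rel[OF qmat_rels_I(1)[OF in_N 1]] 1 show ?thesis by (simp add: nf2_def uv)
  next
    case 2
    from Q.I_rel[OF qmat_rels_I(2)[OF in_N 2]] 2 show ?thesis by (simp add: nf2_def uv)
  next
    case 3
    have "{i, l, k, j} \<subseteq> {1..N}" using in_N by auto
    from qmat_rels_I(2)[OF this] 3
    have "(mon [(i, j), (k, l)] 1 - mon [(k, l), (i, j)] 1 - mon [(i, l), (k, j)] (q - inverse q))
      + (q - inverse q) \<cdot> (mon [(i, l), (k, j)] 1 - mon [(k, j), (i, l)] 1) \<in> Q.I"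
      by (intro lsubspace_add[OF Q.lsubspace_I] lsubspace_scale[OF Q.lsubspace_I] Q.I_rel
          qmat_rels_I(3)[OF in_N]) simp_all
    also have "(mon [(i, j), (k, l)] 1 - mon [(k, l), (i, j)] 1 - mon [(i, l), (k, j)] (q - inverse q))
      + (q - inverse q) \<cdot> (mon [(i, l), (k, j)] 1 - mon [(k, j), (i, l)] 1)
      = mon [u, v] 1 - nf2 u v"
      using 3 by (simp add: nf2_def uv)
    finally show ?thesis .
  next
    case 4
    then have "nf2 u v = mon [u, v] 1" by (auto simp: nf2_def uv)
    then show ?thesis using lsubspace_zero[OF Q.lsubspace_I] by simp
  qed
qed

definition quadratic :: "((nat \<times> nat) list \<Rightarrow>\<^sub>0 'k) set" where
  "quadratic = {f. supp f \<subseteq> {[u, v] | u v. u \<in> square N \<and> v \<in> square N}}"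

lemma lsubspace_quadratic: "lsubspace quadratic"
  unfolding quadratic_def by (rule lsubspace_supp)

lemma quadratic_in_I: "f \<in> quadratic \<Longrightarrow> nf f = 0 \<Longrightarrow> f \<in> Q.I"
proof -
  assume f: "f \<in> quadratic" and "nf f = 0"
  have "f - nf f = lin (\<lambda>w. mon w 1 - (case w of [u, v] \<Rightarrow> nf2 u v | _ \<Rightarrow> 0)) f"
    unfolding lin_fun_diff nf_def by simp
  also have "\<dots> \<in> Q.I"
  proof (rule lin_in_lsubspace[OF Q.lsubspace_I])
    fix w assume "w \<in> supp f"
    then obtain u v where "w = [u, v]" "u \<in> square N" "v \<in> square N"
      using f by (auto simp: quadratic_def)
    then show "mon w 1 - (case w of [u, v] \<Rightarrow> nf2 u v | _ \<Rightarrow> 0) \<in> Q.I"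
      using nf2_congruent[of u v] by simp
  qed
  finally show "f \<in> Q.I" using \<open>nf f = 0\<close> by simp
qed

definition linear_form :: "(nat \<times> nat \<Rightarrow> 'k) \<Rightarrow> ((nat \<times> nat) list \<Rightarrow>\<^sub>0 'k)" where
  "linear_form c = (\<Sum>w\<in>square N. mon [w] (c w))"

lemma linear_form_in: "linear_form c \<in> Q.C"
  unfolding linear_form_def by (intro sum_in_formal_sums) auto

lemma linear_form_cf: "u \<in> square N \<Longrightarrow> cf (linear_form c) [u] = c u"
  by (simp add: linear_form_def lookup_sum lookup_single when_def)

lemma linear_form_single: "u \<in> square N \<Longrightarrow> linear_form (\<lambda>w. if w = u then d else 0) = mon [u] d"
  by (simp add: linear_form_def if_distrib[of "mon _"] cong: if_cong)

text \<open>
  The ideal has no elements of degree one, so the generators are linearly independent modulo it.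
\<close>

lemma linear_form_cl_eq:
  assumes "Q.cl (linear_form c) = Q.cl (linear_form d)" "u \<in> square N"
  shows "c u = d u"
proof -
  have "linear_form c - linear_form d \<in> Q.I" using assms(1) by (simp add: Q.cl_eq_iff)
  from I_degree[OF this, of "[u]"] have "cf (linear_form c - linear_form d) [u] = 0"
    by (auto simp: in_keys_iff)
  then show ?thesis using assms(2) by (simp add: lookup_minus linear_form_cf)
qed

text \<open>
  A skew derivation of the free algebra descends to quantum matrices when it respects the
  relations; in degree two this is a finite system of equations for \<open>nf\<close>.
\<close>

definition stable where
  "stable \<gamma> \<delta> \<longleftrightarrow> (\<forall>f\<in>Q.I. skew_ext \<gamma> \<delta> f \<in> Q.I)"

definition leibniz where
  "leibniz \<gamma> \<delta> u v = nf (\<gamma> u \<diamondop> \<delta> v + \<delta> u \<diamondop> mon [v] 1)"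

definition compatible where
  "compatible L \<longleftrightarrow> (\<forall>i j k l. {i, j, k, l} \<subseteq> {1..N} \<longrightarrow>
     (i < k \<and> j = l \<or> i = k \<and> j < l \<longrightarrow> L (i, j) (k, l) = q \<cdot> L (k, l) (i, j)) \<and>
     (i < k \<and> l < j \<longrightarrow> L (i, j) (k, l) = L (k, l) (i, j)) \<and>
     (i < k \<and> j < l \<longrightarrow> L (i, j) (k, l) = L (k, l) (i, j) + (q - inverse q) \<cdot> L (i, l) (k, j)))"

lemma skew_ext_quadratic: "skew_ext \<gamma> \<delta> (mon [u, v] c) = c \<cdot> (\<gamma> u \<diamondop> \<delta> v + \<delta> u \<diamondop> mon [v] 1)"
  by (simp add: skew_ext_mon)

lemma nf_skew_ext: "nf (skew_ext \<gamma> \<delta> (mon [u, v] c)) = c \<cdot> leibniz \<gamma> \<delta> u v"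
  by (simp add: skew_ext_quadratic leibniz_def linmap_scale del: scale_add)

lemma compatible_iff:
  "compatible (leibniz \<gamma> \<delta>) \<longleftrightarrow> (\<forall>r\<in>qmat_rels q N. nf (skew_ext \<gamma> \<delta> r) = 0)"
proof
  assume c: "compatible (leibniz \<gamma> \<delta>)"
  show "\<forall>r\<in>qmat_rels q N. nf (skew_ext \<gamma> \<delta> r) = 0"
  proof
    fix r assume "r \<in> qmat_rels q N"
    then show "nf (skew_ext \<gamma> \<delta> r) = 0"
    proof (cases rule: qmat_rels_cases)
      case (1 i j k l)
      then have "leibniz \<gamma> \<delta> (i, j) (k, l) = q \<cdot> leibniz \<gamma> \<delta> (k, l) (i, j)"
        using c unfolding compatible_def by blast
      then show ?thesis by (simp add: 1(3) linmap_diff nf_skew_ext)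
    next
      case (2 i j k l)
      then have "leibniz \<gamma> \<delta> (i, j) (k, l) = leibniz \<gamma> \<delta> (k, l) (i, j)"
        using c unfolding compatible_def by blast
      then show ?thesis by (simp add: 2(4) linmap_diff nf_skew_ext)
    next
      case (3 i j k l)
      then have "leibniz \<gamma> \<delta> (i, j) (k, l) = leibniz \<gamma> \<delta> (k, l) (i, j)
          + (q - inverse q) \<cdot> leibniz \<gamma> \<delta> (i, l) (k, j)"
        using c unfolding compatible_def by blast
      then show ?thesis by (simp add: 3(4) linmap_diff nf_skew_ext)
    qed
  qed
next
  assume zero: "\<forall>r\<in>qmat_rels q N. nf (skew_ext \<gamma> \<delta> r) = 0"
  show "compatible (leibniz \<gamma> \<delta>)"
    unfolding compatible_def
  proof (intro allI impI conjI)
    fix i j k l assume in_N: "{i, j, k, l} \<subseteq> {1..N}"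
    show "leibniz \<gamma> \<delta> (i, j) (k, l) = q \<cdot> leibniz \<gamma> \<delta> (k, l) (i, j)" if "i < k \<and> j = l \<or> i = k \<and> j < l"
      using zero[rule_format, OF qmat_rels_I(1)[OF in_N that]] by (simp add: linmap_diff nf_skew_ext)
    show "leibniz \<gamma> \<delta> (i, j) (k, l) = leibniz \<gamma> \<delta> (k, l) (i, j)" if "i < k \<and> l < j"
      using zero[rule_format, OF qmat_rels_I(2)[OF in_N]] that by (simp add: linmap_diff nf_skew_ext)
    show "leibniz \<gamma> \<delta> (i, j) (k, l) = leibniz \<gamma> \<delta> (k, l) (i, j) + (q - inverse q) \<cdot> leibniz \<gamma> \<delta> (i, l) (k, j)"
      if "i < k \<and> j < l"
    proof -
      have "leibniz \<gamma> \<delta> (i, j) (k, l) - leibniz \<gamma> \<delta> (k, l) (i, j) - (q - inverse q) \<cdot> leibniz \<gamma> \<delta> (i, l) (k, j) = 0"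
        using zero[rule_format, OF qmat_rels_I(3)[OF in_N]] that by (simp add: linmap_diff nf_skew_ext)
      then show ?thesis unfolding diff_diff_eq by simp
    qed
  qed
qed

lemma stable_compatible: "stable \<gamma> \<delta> \<Longrightarrow> compatible (leibniz \<gamma> \<delta>)"
  unfolding stable_def compatible_iff using nf_I Q.I_rel by blast

lemma quadraticI: "u \<in> square N \<Longrightarrow> v \<in> square N \<Longrightarrow> mon [u, v] c \<in> quadratic"
  by (auto simp: quadratic_def simp del: split_paired_Ex)

lemma rels_quadratic: "qmat_rels q N \<subseteq> quadratic"
proof
  fix r assume "r \<in> qmat_rels q N"
  then show "r \<in> quadratic"
    by (cases rule: qmat_rels_cases)
      (auto intro!: lsubspace_diff[OF lsubspace_quadratic] quadraticI)
qed

text \<open>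
  The normal form of \<open>D(Y\<^sub>u Y\<^sub>v)\<close> when \<open>D\<close> sends each generator to a multiple of a generator.
\<close>

definition mleib where
  "mleib \<alpha> \<sigma> d u v = (\<alpha> u * d v) \<cdot> nf2 u (\<sigma> v) + d u \<cdot> nf2 (\<sigma> u) v"

lemma leibniz_monomial:
  "leibniz (\<lambda>u. mon [u] (\<alpha> u)) (\<lambda>u. mon [\<sigma> u] (d u)) = mleib \<alpha> \<sigma> d"
  by (simp add: fun_eq_iff leibniz_def mleib_def conv_mon linmap_add nf_mon)

lemma monomial_rel_in:
  assumes "compatible (mleib \<alpha> \<sigma> d)" "\<And>u. u \<in> square N \<Longrightarrow> d u \<noteq> 0 \<Longrightarrow> \<sigma> u \<in> square N"
    and r: "r \<in> qmat_rels q N"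
  shows "skew_ext (\<lambda>u. mon [u] (\<alpha> u)) (\<lambda>u. mon [\<sigma> u] (d u)) r \<in> Q.I" (is "?D r \<in> _")
proof (rule quadratic_in_I)
  show "nf (?D r) = 0"
    using assms(1) r compatible_iff[of "\<lambda>u. mon [u] (\<alpha> u)" "\<lambda>u. mon [\<sigma> u] (d u)"]
    by (simp add: leibniz_monomial)
  have word: "skew_word (\<lambda>u. mon [u] (\<alpha> u)) (\<lambda>u. mon [\<sigma> u] (d u)) [u, v] \<in> quadratic"
    if uv: "u \<in> square N" "v \<in> square N" for u v
  proof -
    have "mon [u, \<sigma> v] (\<alpha> u * d v) \<in> quadratic" "mon [\<sigma> u, v] (d u) \<in> quadratic"
      using assms(2) uv lsubspace_zero[OF lsubspace_quadratic]
      by (cases "d v = 0"; cases "d u = 0"; auto intro!: quadraticI)+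
    then show ?thesis using lsubspace_add[OF lsubspace_quadratic] by (simp add: conv_mon)
  qed
  have "r \<in> quadratic" using rels_quadratic r by auto
  show "?D r \<in> quadratic"
    unfolding skew_ext_def
  proof (rule lin_in_lsubspace[OF lsubspace_quadratic])
    fix w assume "w \<in> supp r"
    then obtain u v where "w = [u, v]" "u \<in> square N" "v \<in> square N"
      using \<open>r \<in> quadratic\<close> by (auto simp: quadratic_def simp del: split_paired_Ex)
    with word show "skew_word (\<lambda>u. mon [u] (\<alpha> u)) (\<lambda>u. mon [\<sigma> u] (d u)) w \<in> quadratic"
      by (simp only:)
  qed
qed

text \<open>
  The normal form of \<open>D(Y\<^sub>u Y\<^sub>v)\<close> when \<open>D\<close> acts on the generators by the matrix \<open>c\<close> and \<open>G\<close> permutes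
  them by \<open>\<pi>\<close> up to the scalars \<open>\<alpha>\<close>.
\<close>

definition leib where
  "leib \<pi> \<alpha> c u v = (\<Sum>w\<in>square N. (\<alpha> u * c v w) \<cdot> nf2 (\<pi> u) w) + (\<Sum>w\<in>square N. c u w \<cdot> nf2 w v)"

lemma leibniz_linear_form:
  "leibniz (\<lambda>u. mon [\<pi> u] (\<alpha> u)) (\<lambda>u. linear_form (c u)) = leib \<pi> \<alpha> c"
proof (intro ext)
  fix u v
  have "mon [\<pi> u] (\<alpha> u) \<diamondop> linear_form (c v) = (\<Sum>w\<in>square N. mon [\<pi> u, w] (\<alpha> u * c v w))"
    unfolding linear_form_def by (subst linmap_sum) (simp_all add: conv_mon)
  moreover have "linear_form (c u) \<diamondop> mon [v] 1 = (\<Sum>w\<in>square N. mon [w, v] (c u w))"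
    unfolding linear_form_def
    by (subst linmap_sum[of "\<lambda>p. p \<diamondop> mon [v] 1"]) (simp_all add: conv_mon)
  ultimately show "leibniz (\<lambda>u. mon [\<pi> u] (\<alpha> u)) (\<lambda>u. linear_form (c u)) u v = leib \<pi> \<alpha> c u v"
    by (simp add: leibniz_def leib_def linmap_add linmap_sum nf_mon)
qed

lemma leib_monomial:
  assumes c: "\<And>u w. u \<in> square N \<Longrightarrow> w \<in> square N \<Longrightarrow> c u w = (if w = \<sigma> u then d u else 0)"
    and \<sigma>: "\<And>u. u \<in> square N \<Longrightarrow> d u \<noteq> 0 \<Longrightarrow> \<sigma> u \<in> square N"
    and uv: "u \<in> square N" "v \<in> square N"
  shows "leib id \<alpha> c u v = mleib \<alpha> \<sigma> d u v"
proof -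
  have sum: "(\<Sum>w\<in>square N. (b * c u w) \<cdot> F w) = (b * d u) \<cdot> F (\<sigma> u)" if "u \<in> square N" for u b F
  proof -
    have "(\<Sum>w\<in>square N. (b * c u w) \<cdot> F w) = (\<Sum>w\<in>square N. if w = \<sigma> u then (b * d u) \<cdot> F w else 0)"
      using that by (intro sum.cong) (simp_all add: c)
    also have "\<dots> = (b * d u) \<cdot> F (\<sigma> u)"
      using \<sigma>[OF that] by (cases "d u = 0") (simp_all add: sum.delta cong: if_cong)
    finally show ?thesis .
  qed
  show ?thesis
    using sum[OF uv(2), of "\<alpha> u" "nf2 u"] sum[OF uv(1), of 1 "\<lambda>w. nf2 w v"]
    by (simp add: leib_def mleib_def)
qed

lemma compatibleD:
  assumes "compatible L" "{i, j, k, l} \<subseteq> {1..N}"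
  shows "i < k \<and> j = l \<or> i = k \<and> j < l \<Longrightarrow> L (i, j) (k, l) = q \<cdot> L (k, l) (i, j)"
    and "i < k \<Longrightarrow> l < j \<Longrightarrow> L (i, j) (k, l) = L (k, l) (i, j)"
    and "i < k \<Longrightarrow> j < l \<Longrightarrow> L (i, j) (k, l) = L (k, l) (i, j) + (q - inverse q) \<cdot> L (i, l) (k, j)"
  using assms unfolding compatible_def by blast+

lemma compatible_cong:
  assumes eq: "\<And>u v. u \<in> square N \<Longrightarrow> v \<in> square N \<Longrightarrow> L u v = L' u v" and c: "compatible L"
  shows "compatible L'"
  unfolding compatible_def
proof (intro allI impI)
  fix i j k l assume in_N: "{i, j, k, l} \<subseteq> {1..N}"
  have "L (i, j) (k, l) = L' (i, j) (k, l)" "L (k, l) (i, j) = L' (k, l) (i, j)" "L (i, l) (k, j) = L' (i, l) (k, j)"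
    by (rule eq; use in_N in simp)+
  then show "(i < k \<and> j = l \<or> i = k \<and> j < l \<longrightarrow> L' (i, j) (k, l) = q \<cdot> L' (k, l) (i, j)) \<and>
     (i < k \<and> l < j \<longrightarrow> L' (i, j) (k, l) = L' (k, l) (i, j)) \<and>
     (i < k \<and> j < l \<longrightarrow> L' (i, j) (k, l) = L' (k, l) (i, j) + (q - inverse q) \<cdot> L' (i, l) (k, j))"
    using compatibleD[OF c in_N] by auto
qed

text \<open>
  Rewriting preserves the multisets of row and of column indices, so the homogeneous components of
  a skew derivation respect the relations separately.
\<close>

definition degree :: "(nat \<times> nat) list \<Rightarrow> nat multiset \<times> nat multiset" where
  "degree w = (mset (map fst w), mset (map snd w))"

lemma nf2_degree: "w \<in> supp (nf2 u v) \<Longrightarrow> degree w = degree [u, v]"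
  using keys_add[of "mon [v, u] (1::'k)"]
  by (cases u; cases v) (auto simp: nf2_def degree_def split: if_splits dest!: subsetD[OF keys_add])

definition proj :: "((nat \<times> nat) list \<Rightarrow> bool) \<Rightarrow> ((nat \<times> nat) list \<Rightarrow>\<^sub>0 'k) \<Rightarrow> ((nat \<times> nat) list \<Rightarrow>\<^sub>0 'k)" where
  "proj P = lin (\<lambda>w. if P w then mon w 1 else 0)"

lemma proj_nf2:
  assumes "\<And>w. degree w = degree [u, v] \<Longrightarrow> P w = P [u, v]"
  shows "proj P (nf2 u v) = (if P [u, v] then nf2 u v else 0)"
proof -
  have "proj P (nf2 u v) = lin (\<lambda>w. if P [u, v] then mon w 1 else 0) (nf2 u v)"
    unfolding proj_def using nf2_degree assms by (intro lin_cong) metis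
  then show ?thesis by simp
qed

text \<open>
  The entry of \<open>x\<close> from \<open>u\<close> to \<open>w\<close> has the same bidegree as the entry from \<open>u\<^sub>0\<close> to \<open>w\<^sub>0\<close>: formally
  \<open>w - u = w\<^sub>0 - u\<^sub>0\<close>, rewritten without subtraction.
\<close>

definition shift :: "nat \<times> nat \<Rightarrow> nat \<times> nat \<Rightarrow> nat \<times> nat \<Rightarrow> nat \<times> nat \<Rightarrow> bool" where
  "shift u\<^sub>0 w\<^sub>0 u w \<longleftrightarrow> degree [w, u\<^sub>0] = degree [u, w\<^sub>0]"

lemma compatible_component:
  assumes "compatible (leib id \<alpha> c)"
  shows "compatible (leib id \<alpha> (\<lambda>u w. if shift u\<^sub>0 w\<^sub>0 u w then c u w else 0))" (is "compatible ?L")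
proof -
  define P where "P u v w \<longleftrightarrow> degree (u\<^sub>0 # w) = degree [u, v, w\<^sub>0]" for u v w
  have comp: "?L u v = proj (P u v) (leib id \<alpha> c u v)" for u v
  proof -
    have lp: "linmap (proj (P u v))" by (simp add: proj_def)
    have "proj (P u v) (nf2 u w) = (if shift u\<^sub>0 w\<^sub>0 v w then nf2 u w else 0)"
      "proj (P u v) (nf2 w v) = (if shift u\<^sub>0 w\<^sub>0 u w then nf2 w v else 0)" for w
      by (subst proj_nf2; simp add: P_def shift_def degree_def add_mset_commute)+
    then show ?thesis
      unfolding leib_def
      by (simp add: linmap_add[OF lp] linmap_sum[OF lp] linmap_scale[OF lp] if_distrib[of "pscale _"] cong: if_cong)
        (simp add: if_distrib[of "\<lambda>x. x \<cdot> _"] if_distrib[of "(*) _"] cong: if_cong)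
  qed
  have P: "P (i, j) (k, l) = P (k, l) (i, j)" "P (i, l) (k, j) = P (k, l) (i, j)" for i j k l
    by (auto simp: P_def degree_def fun_eq_iff add_mset_commute)
  have lp: "linmap (proj Q)" for Q by (simp add: proj_def)
  show ?thesis
    unfolding compatible_def comp
  proof (intro allI impI conjI)
    fix i j k l assume in_N: "{i, j, k, l} \<subseteq> {1..N}"
    show "proj (P (i, j) (k, l)) (leib id \<alpha> c (i, j) (k, l)) = q \<cdot> proj (P (k, l) (i, j)) (leib id \<alpha> c (k, l) (i, j))"
      if "i < k \<and> j = l \<or> i = k \<and> j < l"
      unfolding compatibleD(1)[OF assms in_N that] P(1)[of i j k l] by (rule linmap_scale[OF lp])
    show "proj (P (i, j) (k, l)) (leib id \<alpha> c (i, j) (k, l)) = proj (P (k, l) (i, j)) (leib id \<alpha> c (k, l) (i, j))"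
      if "i < k \<and> l < j"
      using compatibleD(2)[OF assms in_N] that P(1)[of i j k l] by simp
    show "proj (P (i, j) (k, l)) (leib id \<alpha> c (i, j) (k, l)) = proj (P (k, l) (i, j)) (leib id \<alpha> c (k, l) (i, j))
        + (q - inverse q) \<cdot> proj (P (i, l) (k, j)) (leib id \<alpha> c (i, l) (k, j))"
      if "i < k \<and> j < l"
      unfolding compatibleD(3)[OF assms in_N that[THEN conjunct1] that[THEN conjunct2]] P(1)[of i j k l] P(2)[of i l k j]
      by (simp only: linmap_add[OF lp] linmap_scale[OF lp])
  qed
qed

end

section \<open>Symmetries of quantum matrices\<close>

abbreviation relabel :: "('x \<Rightarrow> 'y) \<Rightarrow> ('x list \<Rightarrow>\<^sub>0 'k::field) \<Rightarrow> ('y list \<Rightarrow>\<^sub>0 'k)" where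
  "relabel \<rho> \<equiv> hom_ext (\<lambda>u. mon [\<rho> u] 1)"

lemma relabel_mon:
  fixes c :: "'k::field"
  shows "relabel \<rho> (mon w c) = mon (map \<rho> w) c"
proof -
  have "word_prod (\<lambda>u. mon [\<rho> u] (1::'k)) w = mon (map \<rho> w) 1"
    by (induction w) (simp_all add: conv_mon)
  then show ?thesis by (simp add: hom_ext_mon)
qed

lemma relabel_relabel:
  assumes "\<And>u. \<rho> (\<rho> u) = u"
  shows "relabel \<rho> (relabel \<rho> f) = f"
  by (rule linmap_eqI[where L = "\<lambda>f. relabel \<rho> (relabel \<rho> f)" and L' = "\<lambda>f. f"])
    (simp_all add: linmap_comp linmap_ident relabel_mon assms comp_def)

lemma skew_ext_relabel:
  assumes "\<And>u. \<rho> (\<rho> u) = u"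
  shows "skew_ext (\<lambda>u. relabel \<rho> (\<gamma> (\<rho> u))) (\<lambda>u. relabel \<rho> (\<delta> (\<rho> u))) f
    = relabel \<rho> (skew_ext \<gamma> \<delta> (relabel \<rho> f))"
proof (rule linmap_eqI[where L' = "\<lambda>f. relabel \<rho> (skew_ext \<gamma> \<delta> (relabel \<rho> f))"])
  fix w
  have "skew_word (\<lambda>u. relabel \<rho> (\<gamma> (\<rho> u))) (\<lambda>u. relabel \<rho> (\<delta> (\<rho> u))) w
      = relabel \<rho> (skew_word \<gamma> \<delta> (map \<rho> w))"
  proof (induction w)
    case (Cons x w)
    have "map (\<rho> \<circ> \<rho>) w = w" by (simp add: comp_def assms)
    with Cons show ?case by (simp add: linmap_add hom_ext_mult relabel_mon)
  qed (simp add: linmap_zero)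
  then show "skew_ext (\<lambda>u. relabel \<rho> (\<gamma> (\<rho> u))) (\<lambda>u. relabel \<rho> (\<delta> (\<rho> u))) (mon w 1)
      = relabel \<rho> (skew_ext \<gamma> \<delta> (relabel \<rho> (mon w 1)))"
    by (simp add: skew_ext_mon relabel_mon)
qed (simp_all add: linmap_comp[OF linmap_hom_ext linmap_comp[OF linmap_skew_ext linmap_hom_ext]])

definition rev_index :: "nat \<Rightarrow> nat \<times> nat \<Rightarrow> nat \<times> nat" where
  "rev_index N u = (if u \<in> square N then (Suc N - fst u, Suc N - snd u) else u)"

lemma rev_index_rev [simp]: "rev_index N (rev_index N u) = u"
  by (cases u) (auto simp: rev_index_def)

lemma rev_index_in [simp]: "rev_index N u \<in> square N \<longleftrightarrow> u \<in> square N"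
  by (cases u) (auto simp: rev_index_def)

context quantum_matrices
begin

text \<open>
  Transposition is a symmetry; reversing both index orders exchanges \<open>q\<close> and \<open>q\<^sup>-\<^sup>1\<close>. These two reduce
  the eight kinds of action to a rightward shift of a column and the corner shift in the first row.
\<close>

lemma relabel_swap_rel: "r \<in> qmat_rels q N \<Longrightarrow> relabel prod.swap r \<in> Q.I"
proof (rule quadratic_in_I)
  assume r: "r \<in> qmat_rels q N"
  show "relabel prod.swap r \<in> quadratic"
    using r by (cases rule: qmat_rels_cases)
      (auto simp: linmap_diff relabel_mon intro!: lsubspace_diff[OF lsubspace_quadratic] quadraticI)
  show "nf (relabel prod.swap r) = 0"
    using r by (cases rule: qmat_rels_cases) (auto simp: linmap_diff relabel_mon nf_mon nf2_def)
qed

lemma relabel_rev_rel: "r \<in> qmat_rels (inverse q) N \<Longrightarrow> relabel (rev_index N) r \<in> Q.I"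
proof (rule quadratic_in_I)
  interpret inv: quantum_matrices "inverse q" N by unfold_locales (simp add: q_nonzero)
  assume r: "r \<in> qmat_rels (inverse q) N"
  have flip: "Suc N - a < Suc N - b \<longleftrightarrow> b < a" "Suc N - a = Suc N - b \<longleftrightarrow> a = b"
    if "a \<in> {1..N}" "b \<in> {1..N}" for a b
    using that by auto
  have rev: "rev_index N (a, b) = (Suc N - a, Suc N - b)" if "a \<in> {1..N}" "b \<in> {1..N}" for a b
    using that by (simp add: rev_index_def)
  have in_square: "mon [rev_index N (a, b), rev_index N (c, d)] e \<in> quadratic" if "{a, b, c, d} \<subseteq> {1..N}" for a b c d e
    by (rule quadraticI) (use that in simp_all)
  show "relabel (rev_index N) r \<in> quadratic"
    using r by (cases rule: inv.qmat_rels_cases)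
      (simp_all add: linmap_diff relabel_mon lsubspace_diff[OF lsubspace_quadratic] in_square)
  show "nf (relabel (rev_index N) r) = 0"
    using r
  proof (cases rule: inv.qmat_rels_cases)
    case (1 i j k l)
    then show ?thesis
      using q_nonzero by (auto simp: linmap_diff relabel_mon rev nf_mon nf2_def flip)
  next
    case (2 i j k l)
    then show ?thesis
      by (simp add: linmap_diff relabel_mon rev nf_mon nf2_def flip)
  next
    case (3 i j k l)
    then show ?thesis
      by (simp add: linmap_diff relabel_mon rev nf_mon nf2_def flip single_diff)
  qed
qed

lemma relabel_I:
  fixes R :: "((nat \<times> nat) list \<Rightarrow>\<^sub>0 'k) set"
  assumes "free_relations (square N) R" "\<And>r. r \<in> R \<Longrightarrow> relabel \<rho> r \<in> Q.I"
    and "\<And>u. u \<in> square N \<Longrightarrow> \<rho> u \<in> square N" "f \<in> Idl\<^bsub>monoid_alg (words (square N))\<^esub> R"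
  shows "relabel \<rho> f \<in> Q.I"
proof -
  interpret R: free_relations "square N" R by fact
  show ?thesis
    by (rule R.hom_ext_I[OF Q.lsubspace_I assms(2) _ _ assms(4)])
      (use assms(3) in \<open>simp_all add: Q.I_mul\<close>)
qed

lemma stable_swap:
  "stable \<gamma> \<delta> \<Longrightarrow> stable (\<lambda>u. relabel prod.swap (\<gamma> (prod.swap u))) (\<lambda>u. relabel prod.swap (\<delta> (prod.swap u)))"
  unfolding stable_def
  by (auto simp: skew_ext_relabel intro!: relabel_I[OF Q.free_relations_axioms relabel_swap_rel])

lemma stable_rev:
  assumes "quantum_matrices.stable (inverse q) N \<gamma> \<delta>"
  shows "stable (\<lambda>u. relabel (rev_index N) (\<gamma> (rev_index N u))) (\<lambda>u. relabel (rev_index N) (\<delta> (rev_index N u)))"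
proof -
  interpret inv: quantum_matrices "inverse q" N by unfold_locales (simp add: q_nonzero)
  have forth: "relabel (rev_index N) f \<in> inv.Q.I" if "f \<in> Q.I" for f
    by (rule inv.relabel_I[OF Q.free_relations_axioms _ _ that]) (use inv.relabel_rev_rel in simp_all)
  have backward: "relabel (rev_index N) f \<in> Q.I" if "f \<in> inv.Q.I" for f
    by (rule relabel_I[OF inv.Q.free_relations_axioms relabel_rev_rel _ that]) simp_all
  show ?thesis
    using assms unfolding stable_def inv.stable_def by (auto simp: skew_ext_relabel intro!: backward forth)
qed

end

section \<open>Classification of linear skew derivations\<close>

context quantum_matrices
begin

definition rank_one_weights :: "(nat \<times> nat \<Rightarrow> 'k) \<Rightarrow> bool" where
  "rank_one_weights \<alpha> \<longleftrightarrow> (\<forall>u\<in>square N. \<alpha> u \<noteq> 0) \<and>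
     (\<forall>i j k l. {i, j, k, l} \<subseteq> {1..N} \<longrightarrow> \<alpha> (i, j) * \<alpha> (k, l) = \<alpha> (i, l) * \<alpha> (k, j))"

lemma rank_one_weightsD:
  assumes "rank_one_weights \<alpha>"
  shows "u \<in> square N \<Longrightarrow> \<alpha> u \<noteq> 0"
    and "{i, j, k, l} \<subseteq> {1..N} \<Longrightarrow> \<alpha> (i, j) * \<alpha> (k, l) = \<alpha> (i, l) * \<alpha> (k, j)"
  using assms unfolding rank_one_weights_def by blast+

text \<open>
  The relation with three terms is rescaled by a single factor because \<open>2 \<times> 2\<close> minors vanish.
\<close>

lemma rank_one_hom_ext:
  assumes "rank_one_weights \<alpha>" "r \<in> qmat_rels q N"
  shows "hom_ext (\<lambda>u. mon [u] (\<alpha> u)) r \<in> Q.I"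
proof -
  have word: "hom_ext (\<lambda>u. mon [u] (\<alpha> u)) (mon [u, v] c) = mon [u, v] (\<alpha> u * \<alpha> v * c)" for u v c
    by (simp add: hom_ext_mon conv_mon mult_ac)
  from assms(2) show ?thesis
  proof (cases rule: qmat_rels_cases)
    case (1 i j k l)
    have "(\<alpha> (i, j) * \<alpha> (k, l)) \<cdot> r \<in> Q.I"
      using assms(2) by (intro lsubspace_scale[OF Q.lsubspace_I] Q.I_rel)
    then show ?thesis by (simp add: 1(3) linmap_diff word mult_ac)
  next
    case (2 i j k l)
    have "(\<alpha> (i, j) * \<alpha> (k, l)) \<cdot> r \<in> Q.I"
      using assms(2) by (intro lsubspace_scale[OF Q.lsubspace_I] Q.I_rel)
    then show ?thesis by (simp add: 2(4) linmap_diff word mult_ac)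
  next
    case (3 i j k l)
    have "(\<alpha> (i, j) * \<alpha> (k, l)) \<cdot> r \<in> Q.I"
      using assms(2) by (intro lsubspace_scale[OF Q.lsubspace_I] Q.I_rel)
    then show ?thesis
      using rank_one_weightsD(2)[OF assms(1) 3(1)] by (simp add: 3(4) linmap_diff word mult_ac)
  qed
qed

lemma monomial_stable:
  assumes "rank_one_weights \<alpha>" "compatible (mleib \<alpha> \<sigma> d)"
    and \<sigma>: "\<And>u. u \<in> square N \<Longrightarrow> d u \<noteq> 0 \<Longrightarrow> \<sigma> u \<in> square N"
  shows "stable (\<lambda>u. mon [u] (\<alpha> u)) (\<lambda>u. mon [\<sigma> u] (d u))"
  unfolding stable_def
proof
  fix f assume f: "f \<in> Q.I"
  show "skew_ext (\<lambda>u. mon [u] (\<alpha> u)) (\<lambda>u. mon [\<sigma> u] (d u)) f \<in> Q.I"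
  proof (rule Q.skew_ext_I[OF _ _ rank_one_hom_ext[OF assms(1)] monomial_rel_in[OF assms(2) \<sigma>] f])
    show "mon [\<sigma> u] (d u) \<in> Q.C" if "u \<in> square N" for u
      using \<sigma>[OF that] by (cases "d u = 0") simp_all
  qed simp_all
qed

lemma stable_mleib:
  "stable (\<lambda>u. mon [u] (\<alpha> u)) (\<lambda>u. mon [\<sigma> u] (d u)) \<Longrightarrow> compatible (mleib \<alpha> \<sigma> d)"
  using stable_compatible[of "\<lambda>u. mon [u] (\<alpha> u)" "\<lambda>u. mon [\<sigma> u] (d u)"] by (simp add: leibniz_monomial)

end

locale generic_quantum_matrices = quantum_matrices q N for q :: "'k::field" and N :: nat +
  assumes q_square: "q ^ 2 \<noteq> 1" and N_ge: "N \<ge> 3"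
begin

lemma q_gap: "q - inverse q \<noteq> 0" "q \<noteq> 1" "q * q \<noteq> 1"
  using q_square q_nonzero by (auto simp: field_simps power2_eq_square)

end

text \<open>
  One homogeneous component of \<open>x\<close>: it sends \<open>Y\<^sub>a\<^sub>j\<close> to \<open>c\<^sub>a Y\<^sub>a\<^sub>l\<close> in each row \<open>a\<close> and kills the other columns,
  with \<open>j < l\<close>. Each of the first lemmas compares one normal-form coefficient in one quadratic relation.
  Together they leave two possibilities, according to whether there is a column strictly between
  \<open>j\<close> and \<open>l\<close>.
\<close>

locale column_shift = generic_quantum_matrices q N for q :: "'k::field" and N :: nat +
  fixes \<alpha> :: "nat \<times> nat \<Rightarrow> 'k" and c :: "nat \<Rightarrow> 'k" and j l :: nat and lam :: 'k
  assumes compat: "compatible (mleib \<alpha> (\<lambda>u. (fst u, l)) (\<lambda>u. if snd u = j then c (fst u) else 0))"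
    and jl: "j \<in> {1..N}" "l \<in> {1..N}" "j < l"
    and rank_one: "rank_one_weights \<alpha>"
    and lam: "a \<in> {1..N} \<Longrightarrow> c a \<noteq> 0 \<Longrightarrow> \<alpha> (a, l) = lam * \<alpha> (a, j)"
    and nonzero: "\<exists>a\<in>{1..N}. c a \<noteq> 0"
begin

abbreviation L where "L \<equiv> mleib \<alpha> (\<lambda>u. (fst u, l)) (\<lambda>u. if snd u = j then c (fst u) else 0)"

lemmas coefficient = arg_cong[where f = "\<lambda>f. cf f w" for w]
lemmas expand = mleib_def nf2_def lookup_add lookup_minus lookup_single when_def

lemma \<alpha>_nonzero: "a \<in> {1..N} \<Longrightarrow> b \<in> {1..N} \<Longrightarrow> \<alpha> (a, b) \<noteq> 0"
  by (rule rank_one_weightsD(1)[OF rank_one]) simp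

lemma same_column:
  assumes "a \<in> {1..N}" "a' \<in> {1..N}" "a < a'"
  shows "\<alpha> (a, j) * c a' = q * c a'"
    and "\<alpha> (a, j) * c a' * (q - inverse q) + c a = q * \<alpha> (a', j) * c a"
proof -
  have eq: "L (a, j) (a', j) = q \<cdot> L (a', j) (a, j)"
    by (rule compatibleD(1)[OF compat]) (use assms jl in auto)
  show "\<alpha> (a, j) * c a' = q * c a'"
    using coefficient[OF eq, of "[(a', l), (a, j)]"] assms(3) jl(3) by (simp add: expand)
  show "\<alpha> (a, j) * c a' * (q - inverse q) + c a = q * \<alpha> (a', j) * c a"
    using coefficient[OF eq, of "[(a', j), (a, l)]"] assms(3) jl(3) by (simp add: expand mult_ac)
qed

lemma same_row:
  assumes "a \<in> {1..N}" "c a \<noteq> 0" "b \<in> {1..N}"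
  shows "b < j \<or> l < b \<Longrightarrow> \<alpha> (a, b) = 1" and "j < b \<Longrightarrow> b < l \<Longrightarrow> q ^ 2 * \<alpha> (a, b) = 1"
    and "b = l \<Longrightarrow> q * \<alpha> (a, b) = 1"
proof -
  have eq: "L (a, j) (a, b) = q \<cdot> L (a, b) (a, j)" if "j < b"
    by (rule compatibleD(1)[OF compat]) (use assms jl that in auto)
  have eq': "L (a, b) (a, j) = q \<cdot> L (a, j) (a, b)" if "b < j"
    by (rule compatibleD(1)[OF compat]) (use assms jl that in auto)
  show "\<alpha> (a, b) = 1" if b: "b < j \<or> l < b"
  proof (cases "b < j")
    case True
    then show ?thesis
      using coefficient[OF eq', of "[(a, l), (a, b)]"] assms(2) jl(3) q_nonzero by (simp add: expand)
  next
    case False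
    with b have "j < b" "l < b" using jl by auto
    then show ?thesis
      using coefficient[OF eq, of "[(a, b), (a, l)]"] assms(2) jl(3) q_nonzero by (simp add: expand)
  qed
  show "q ^ 2 * \<alpha> (a, b) = 1" if "j < b" "b < l"
    using coefficient[OF eq, of "[(a, l), (a, b)]"] assms(2) jl(3) that by (simp add: expand power2_eq_square mult_ac)
  show "q * \<alpha> (a, b) = 1" if "b = l"
    using coefficient[OF eq, of "[(a, l), (a, l)]"] assms(2) jl(3) that by (simp add: expand)
qed

lemma inner_column:
  assumes "a \<in> {1..N}" "a' \<in> {1..N}" "a < a'" "j < b" "b < l"
  shows "c a' = 0" and "c a \<noteq> 0 \<Longrightarrow> \<alpha> (a', b) = 1"
proof -
  have b: "b \<in> {1..N}" using assms jl by auto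
  have eq: "L (a, j) (a', b) = L (a', b) (a, j) + (q - inverse q) \<cdot> L (a, b) (a', j)"
    by (rule compatibleD(3)[OF compat]) (use assms jl b in auto)
  show zero: "c a' = 0"
    using coefficient[OF eq, of "[(a', l), (a, b)]"] assms jl(3) \<alpha>_nonzero[OF assms(1) b] q_gap
    by (simp add: expand)
  show "\<alpha> (a', b) = 1" if "c a \<noteq> 0"
    using coefficient[OF eq, of "[(a', b), (a, l)]"] assms jl(3) zero that by (simp add: expand)
qed

lemma later_column:
  assumes "a \<in> {1..N}" "a' \<in> {1..N}" "a < a'" "l < b" "b \<in> {1..N}"
  shows "c a = \<alpha> (a, b) * c a'"
proof -
  have eq: "L (a, j) (a', b) = L (a', b) (a, j) + (q - inverse q) \<cdot> L (a, b) (a', j)"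
    by (rule compatibleD(3)[OF compat]) (use assms jl in auto)
  show ?thesis
    using coefficient[OF eq, of "[(a', l), (a, b)]"] assms jl(3) q_gap by (simp add: expand)
qed

lemma earlier_column:
  assumes "a \<in> {1..N}" "a' \<in> {1..N}" "a < a'" "b < j" "b \<in> {1..N}"
  shows "c a = \<alpha> (a, b) * c a'"
proof -
  have eq: "L (a, b) (a', j) = L (a', j) (a, b) + (q - inverse q) \<cdot> L (a, j) (a', b)"
    by (rule compatibleD(3)[OF compat]) (use assms jl in auto)
  show ?thesis
    using coefficient[OF eq, of "[(a', b), (a, l)]"] assms jl(3) q_gap by (simp add: expand)
qed

lemma target_column:
  assumes "a \<in> {1..N}" "a' \<in> {1..N}" "a < a'"
  shows "q * c a = \<alpha> (a', l) * c a + (q - inverse q) * q * \<alpha> (a, l) * c a'"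
proof -
  have eq: "L (a, j) (a', l) = L (a', l) (a, j) + (q - inverse q) \<cdot> L (a, l) (a', j)"
    by (rule compatibleD(3)[OF compat]) (use assms jl in auto)
  show ?thesis
    using coefficient[OF eq, of "[(a', l), (a, l)]"] assms jl(3) by (simp add: expand mult_ac)
qed

text \<open>
  If the first row were killed, the relation between rows \<open>1\<close> and \<open>a\<close> of column \<open>j\<close> would retain a term
  with the factor \<open>q - q\<^sup>-\<^sup>1\<close>.
\<close>

lemma first_row: "c 1 \<noteq> 0"
proof
  assume "c 1 = 0"
  with nonzero obtain a where a: "a \<in> {1..N}" "c a \<noteq> 0" "1 < a" by (metis atLeastAtMost_iff le_neq_implies_less)
  then have "\<alpha> (1, j) = q" "\<alpha> (1, j) * c a * (q - inverse q) = 0"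
    using same_column[of 1 a] \<open>c 1 = 0\<close> by auto
  with a q_nonzero q_gap show False by auto
qed

text \<open>
  Since \<open>N \<ge> 3\<close>, there is a further column on one side of the pair \<open>j, j + 1\<close>, and comparing with it
  makes all \<open>c\<^sub>a\<close> equal. All rows are then constrained alike.
\<close>

lemma adjacent:
  assumes "l = Suc j"
  shows "a \<in> {1..N} \<Longrightarrow> c a = c 1" and "lam * q ^ 2 = 1"
    and "a \<in> {1..N} \<Longrightarrow> b \<in> {1..N} \<Longrightarrow> \<alpha> (a, b) = (if b = j then q else if b = Suc j then inverse q else 1)"
proof -
  have one: "1 \<in> {1..N}" using N_ge by simp
  show const: "c a = c 1" if a: "a \<in> {1..N}" for a
  proof (cases "a = 1")
    case False
    then have lt: "1 < a" using a by auto
    show ?thesis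
    proof (cases "l < N")
      case True
      then have N: "N \<in> {1..N}" by simp
      have "\<alpha> (1, N) = 1" by (rule same_row(1)[OF one first_row N]) (use True in simp)
      then show ?thesis using later_column[OF one a lt True N] by simp
    next
      case False
      then have "1 < j" using assms jl N_ge by auto
      then have "\<alpha> (1, 1) = 1" by (intro same_row(1)[OF one first_row one]) simp
      then show ?thesis using earlier_column[OF one a lt \<open>1 < j\<close> one] by simp
    qed
  qed simp
  have nz: "c a \<noteq> 0" if "a \<in> {1..N}" for a using const[OF that] first_row by simp
  have col_j: "\<alpha> (a, j) = q" if a: "a \<in> {1..N}" for a
  proof (cases "a = N")
    case False
    then have lt: "a < N" using a by auto
    then have N: "N \<in> {1..N}" by auto
    show ?thesis using same_column(1)[OF a N lt] nz[OF N] by simp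
  next
    case True
    then have lt: "1 < a" using N_ge by simp
    have "\<alpha> (1, j) = q" using same_column(1)[OF one a lt] nz[OF a] by simp
    then have "q * c 1 * (q - inverse q) + c 1 = q * \<alpha> (a, j) * c 1"
      using same_column(2)[OF one a lt] const[OF a] by simp
    moreover have "q * c 1 * (q - inverse q) = q * q * c 1 - c 1"
      using q_nonzero by (simp add: right_diff_distrib mult_ac)
    ultimately have "(q * \<alpha> (a, j) - q * q) * c 1 = 0"
      by (auto simp: left_diff_distrib)
    then show ?thesis using first_row q_nonzero by auto
  qed
  have col_l: "\<alpha> (a, l) = inverse q" if a: "a \<in> {1..N}" for a
    using same_row(3)[OF a nz[OF a] jl(2)] by (metis inverse_unique)
  show "\<alpha> (a, b) = (if b = j then q else if b = Suc j then inverse q else 1)"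
    if "a \<in> {1..N}" "b \<in> {1..N}" for a b
  proof -
    consider "b < j \<or> l < b" | "b = j" | "b = l" using assms by linarith
    then show ?thesis
      using col_j[OF that(1)] col_l[OF that(1)] same_row(1)[OF that(1) nz[OF that(1)] that(2)] assms
      by cases auto
  qed
  show "lam * q ^ 2 = 1"
    using lam[OF one first_row] col_j[OF one] col_l[OF one] q_nonzero
    by (simp add: field_simps power2_eq_square)
qed

text \<open>
  A column between \<open>j\<close> and \<open>l\<close> kills all rows except the first. A column outside of the interval would
  make \<open>c\<^sub>1\<close> a multiple of \<open>c\<^sub>a = 0\<close> for a later row \<open>a\<close>, so \<open>j\<close> and \<open>l\<close> are the extreme columns.
\<close>

lemma distant:
  assumes "l \<noteq> Suc j"
  shows "j = 1" "l = N" "lam = q ^ 2" and "a \<in> {1..N} \<Longrightarrow> a \<noteq> 1 \<Longrightarrow> c a = 0"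
    and "a \<in> {1..N} \<Longrightarrow> b \<in> {1..N} \<Longrightarrow> \<alpha> (a, b) =
      (if a = 1 then inverse (q ^ 2) else 1) * (if b = 1 then inverse q else if b = N then q else 1)"
proof -
  have one: "1 \<in> {1..N}" and two: "2 \<in> {1..N}" and lt: "(1::nat) < 2" using N_ge by auto
  have inner: "j < Suc j" "Suc j < l" using assms jl by auto
  show zero: "c a = 0" if "a \<in> {1..N}" "a \<noteq> 1" for a
    using inner_column(1)[OF one that(1) _ inner] that by auto
  have "c 2 = 0" using zero[OF two] by simp
  show "l = N"
  proof (rule ccontr)
    assume "l \<noteq> N"
    then have "l < N" "N \<in> {1..N}" using jl by auto
    from later_column[OF one two lt this] \<open>c 2 = 0\<close> first_row show False by simp
  qed
  show "j = 1"
  proof (rule ccontr)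
    assume "j \<noteq> 1"
    then have "1 < j" using jl by auto
    from earlier_column[OF one two lt this one] \<open>c 2 = 0\<close> first_row show False by simp
  qed
  have row1: "\<alpha> (1, b) = inverse (q ^ 2)" if "1 < b" "b < N" for b
    using same_row(2)[OF one first_row, of b] that \<open>j = 1\<close> \<open>l = N\<close> by (metis atLeastAtMost_iff inverse_unique less_imp_le mult.commute)
  have row1N: "\<alpha> (1, N) = inverse q"
    using same_row(3)[OF one first_row jl(2)] \<open>l = N\<close> by (metis inverse_unique)
  have col1: "\<alpha> (a, 1) = inverse q" if "a \<in> {1..N}" "a \<noteq> 1" for a
  proof -
    have "q * \<alpha> (a, 1) = 1"
      using same_column(2)[OF one that(1)] zero[OF that] that \<open>j = 1\<close> first_row by auto
    then show ?thesis by (metis inverse_unique)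
  qed
  have mid: "\<alpha> (a, b) = 1" if "a \<in> {1..N}" "a \<noteq> 1" "1 < b" "b < N" for a b
    using inner_column(2)[OF one that(1), of b] that \<open>j = 1\<close> \<open>l = N\<close> first_row by auto
  have colN: "\<alpha> (a, N) = q" if "a \<in> {1..N}" "a \<noteq> 1" for a
    using target_column[OF one that(1)] zero[OF that] that \<open>l = N\<close> first_row by auto
  have "\<alpha> (1, 1) * \<alpha> (2, 2) = \<alpha> (1, 2) * \<alpha> (2, 1)"
    by (rule rank_one_weightsD(2)[OF rank_one]) (use N_ge in auto)
  then have corner: "\<alpha> (1, 1) = inverse (q ^ 2) * inverse q"
    using mid[of 2 2] row1[of 2] col1[of 2] N_ge by simp
  show "\<alpha> (a, b) = (if a = 1 then inverse (q ^ 2) else 1) * (if b = 1 then inverse q else if b = N then q else 1)"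
    if "a \<in> {1..N}" "b \<in> {1..N}" for a b
    using that row1[of b] row1N col1[of a] mid[of a b] colN[of a] corner N_ge q_nonzero
    by (cases "a = 1"; cases "b = 1"; cases "b = N") (auto simp: power2_eq_square)
  have "lam * (inverse (q ^ 2) * inverse q) = inverse q"
    using lam[OF one first_row] corner row1N \<open>j = 1\<close> \<open>l = N\<close> by simp
  then have "(lam * inverse (q ^ 2)) * inverse q = 1 * inverse q"
    by (simp add: mult.assoc)
  then have "lam * inverse (q ^ 2) = 1"
    using mult_right_cancel[OF nonzero_imp_inverse_nonzero[OF q_nonzero]] by blast
  then show "lam = q ^ 2"
    using q_nonzero by (simp add: field_simps)
qed

end

context generic_quantum_matrices
begin

lemma scale_eq_zeroD: "a \<cdot> f = 0 \<Longrightarrow> a \<noteq> 0 \<Longrightarrow> f = 0"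
  by (metis scale_scale left_inverse scale_one scale_zero(1))

text \<open>
  If both indices move, only one generator is affected. Whenever it occurs as the extra term of a
  three-term relation, that term cannot be cancelled; this leaves the corners \<open>(1, 1)\<close> and
  \<open>(N, N)\<close>, which a relation of the corner with a neighbour, or with the opposite corner, excludes.
\<close>

lemma no_diagonal_shift:
  assumes compat: "compatible (mleib \<alpha> (\<lambda>_. (k, l)) (\<lambda>u. if u = (i, j) then c else 0))" (is "compatible ?L")
    and in_N: "{i, j, k, l} \<subseteq> {1..N}" and "i \<noteq> k" "j \<noteq> l"
    and \<alpha>: "\<And>u. u \<in> square N \<Longrightarrow> \<alpha> u \<noteq> 0"
  shows "c = 0"
proof (rule ccontr)
  assume c: "c \<noteq> 0"
  note coefficient = arg_cong[where f = "\<lambda>f. cf f w" for w]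
  note expand = mleib_def nf2_def lookup_add lookup_single when_def
  have N3: "1 < N" "2 < N" "Suc 0 < N" using N_ge by auto
  have nz: "nf2 u v \<noteq> 0" for u v
  proof -
    obtain a b a' b' where "u = (a, b)" "v = (a', b')" by (cases u; cases v)
    then have "cf (nf2 u v) [u, v] \<noteq> 0 \<or> cf (nf2 u v) [v, u] \<noteq> 0"
      using q_nonzero by (auto simp: nf2_def lookup_add lookup_single when_def)
    then show ?thesis by auto
  qed
  have left: "j = 1 \<or> i = N"
  proof (rule ccontr)
    assume h: "\<not> ?thesis"
    have "?L (i, 1) (N, j) = ?L (N, j) (i, 1) + (q - inverse q) \<cdot> ?L (i, j) (N, 1)"
      by (rule compatibleD(3)[OF compat]) (use in_N h in auto)
    then have "((q - inverse q) * c) \<cdot> nf2 (k, l) (N, 1) = 0"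
      using h by (simp add: mleib_def)
    from scale_eq_zeroD[OF this] show False using nz q_gap c by simp
  qed
  have right: "i = 1 \<or> j = N"
  proof (rule ccontr)
    assume h: "\<not> ?thesis"
    have "?L (1, j) (i, N) = ?L (i, N) (1, j) + (q - inverse q) \<cdot> ?L (1, N) (i, j)"
      by (rule compatibleD(3)[OF compat]) (use in_N h in auto)
    then have *: "((q - inverse q) * (\<alpha> (1, N) * c)) \<cdot> nf2 (1, N) (k, l) = 0"
      using h by (simp add: mleib_def)
    have "(q - inverse q) * (\<alpha> (1, N) * c) \<noteq> 0"
      using q_gap c \<alpha>[of "(1, N)"] N_ge by simp
    with scale_eq_zeroD[OF *] show False using nz by simp
  qed
  consider "i = 1" "j = 1" | "i = N" "j = N" using left right N3 by auto
  then show False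
  proof cases
    case 1
    then have kl: "1 < k" "1 < l" "k \<le> N" "l \<le> N" using in_N assms(3,4) by auto
    consider "l = N" | "k = N" | "k < N" "l < N" using kl by linarith
    then show False
    proof cases
      assume l: "l = N"
      have eq: "?L (1, 1) (1, 2) = q \<cdot> ?L (1, 2) (1, 1)"
        by (rule compatibleD(1)[OF compat]) (use N3 in auto)
      show False
        using coefficient[OF eq, of "[(k, 2), (1, N)]"] 1 l kl N3 c q_nonzero q_gap \<alpha>[of "(1, 2)"]
        by (simp add: expand)
    next
      assume k: "k = N"
      have eq: "?L (1, 1) (2, 1) = q \<cdot> ?L (2, 1) (1, 1)"
        by (rule compatibleD(1)[OF compat]) (use N3 in auto)
      show False
        using coefficient[OF eq, of "[(N, 1), (2, l)]"] 1 k kl N3 c q_nonzero q_gap \<alpha>[of "(2, 1)"]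
        by (simp add: expand)
    next
      assume less: "k < N" "l < N"
      have eq: "?L (1, 1) (N, N) = ?L (N, N) (1, 1) + (q - inverse q) \<cdot> ?L (1, N) (N, 1)"
        by (rule compatibleD(3)[OF compat]) (use N3 in auto)
      show False
        using coefficient[OF eq, of "[(N, l), (k, N)]"] 1 less kl N3 c q_gap
        by (simp add: expand)
    qed
  next
    case 2
    then have kl: "k < N" "l < N" "1 \<le> k" "1 \<le> l" using in_N assms(3,4) by auto
    consider "l = 1" | "k = 1" | "1 < k" "1 < l" using kl by linarith
    then show False
    proof cases
      assume l: "l = 1"
      have eq: "?L (N, 2) (N, N) = q \<cdot> ?L (N, N) (N, 2)"
        by (rule compatibleD(1)[OF compat]) (use N3 in auto)
      show False
        using coefficient[OF eq, of "[(N, 1), (k, 2)]"] 2 l kl N3 c q_nonzero q_gap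
        by (simp add: expand)
    next
      assume k: "k = 1"
      have eq: "?L (2, N) (N, N) = q \<cdot> ?L (N, N) (2, N)"
        by (rule compatibleD(1)[OF compat]) (use N3 in auto)
      show False
        using coefficient[OF eq, of "[(2, l), (1, N)]"] 2 k kl N3 c q_nonzero q_gap
        by (simp add: expand)
    next
      assume less: "1 < k" "1 < l"
      have eq: "?L (1, 1) (N, N) = ?L (N, N) (1, 1) + (q - inverse q) \<cdot> ?L (1, N) (N, 1)"
        by (rule compatibleD(3)[OF compat]) (use N3 in auto)
      show False
        using coefficient[OF eq, of "[(k, 1), (1, l)]"] 2 less kl N3 c q_gap \<alpha>[of "(1, 1)"]
        by (simp add: expand)
    qed
  qed
qed

end

section \<open>The patterns of a linear action\<close>

text \<open>The weights of \<open>g\<close> in the listed actions, up to transposition.\<close>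

definition wcol :: "'k::field \<Rightarrow> nat \<Rightarrow> nat \<times> nat \<Rightarrow> 'k" where
  "wcol q b u = (if snd u = b then q else if snd u = Suc b then inverse q else 1)"

definition wtop :: "'k::field \<Rightarrow> nat \<Rightarrow> nat \<times> nat \<Rightarrow> 'k" where
  "wtop q N u = (if fst u = 1 then inverse (q ^ 2) else 1) *
     (if snd u = 1 then inverse q else if snd u = N then q else 1)"

definition wbot :: "'k::field \<Rightarrow> nat \<Rightarrow> nat \<times> nat \<Rightarrow> 'k" where
  "wbot q N u = (if fst u = N then q ^ 2 else 1) *
     (if snd u = 1 then inverse q else if snd u = N then q else 1)"

abbreviation transpose_pairs :: "((nat \<times> nat) \<times> (nat \<times> nat)) set \<Rightarrow> ((nat \<times> nat) \<times> (nat \<times> nat)) set" where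
  "transpose_pairs S \<equiv> map_prod prod.swap prod.swap ` S"

context generic_quantum_matrices
begin

text \<open>
  \<open>\<alpha>\<close> are the weights of \<open>g\<close>, and \<open>S\<close> is the set of pairs \<open>(u, w)\<close> such that \<open>x\<close> sends \<open>Y\<^sub>u\<close> to a nonzero
  multiple of \<open>Y\<^sub>w\<close>. These are the listed actions that preserve rows; the others are their transposes.
\<close>

definition col_pattern :: "'k \<Rightarrow> (nat \<times> nat \<Rightarrow> 'k) \<Rightarrow> ((nat \<times> nat) \<times> (nat \<times> nat)) set \<Rightarrow> bool" where
  "col_pattern lam \<alpha> S \<longleftrightarrow>
    (\<exists>b. 1 \<le> b \<and> b < N \<and> (\<forall>u\<in>square N. \<alpha> u = wcol q b u) \<and>
      (lam = inverse (q ^ 2) \<and> S = (\<lambda>a. ((a, b), (a, Suc b))) ` {1..N} \<or>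
       lam = q ^ 2 \<and> S = (\<lambda>a. ((a, Suc b), (a, b))) ` {1..N})) \<or>
    (\<forall>u\<in>square N. \<alpha> u = wtop q N u) \<and> lam = q ^ 2 \<and> S = {((1, 1), (1, N))} \<or>
    (\<forall>u\<in>square N. \<alpha> u = wbot q N u) \<and> lam = inverse (q ^ 2) \<and> S = {((N, N), (N, 1))}"

definition pattern :: "'k \<Rightarrow> (nat \<times> nat \<Rightarrow> 'k) \<Rightarrow> ((nat \<times> nat) \<times> (nat \<times> nat)) set \<Rightarrow> bool" where
  "pattern lam \<alpha> S \<longleftrightarrow> col_pattern lam \<alpha> S \<or> col_pattern lam (\<alpha> \<circ> prod.swap) (transpose_pairs S)"

text \<open>
  For \<open>l < j\<close> the reversal of indices turns the component into a shift to a later column over \<open>q\<^sup>-\<^sup>1\<close>.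
\<close>

lemma column_component:
  assumes compat: "compatible (mleib \<alpha> (\<lambda>u. (fst u, l)) (\<lambda>u. if snd u = j then c (fst u) else 0))"
    and jl: "j \<in> {1..N}" "l \<in> {1..N}" "j \<noteq> l"
    and rank_one: "rank_one_weights \<alpha>"
    and lam: "\<And>a. a \<in> {1..N} \<Longrightarrow> c a \<noteq> 0 \<Longrightarrow> \<alpha> (a, l) = lam * \<alpha> (a, j)"
    and a\<^sub>0: "a\<^sub>0 \<in> {1..N}" "c a\<^sub>0 \<noteq> 0"
  shows "\<exists>S. col_pattern lam \<alpha> S \<and> ((a\<^sub>0, j), (a\<^sub>0, l)) \<in> S \<and>
    S \<subseteq> (\<lambda>a. ((a, j), (a, l))) ` {a \<in> {1..N}. c a = c a\<^sub>0}"
proof (cases "j < l")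
  case True
  interpret S: column_shift q N \<alpha> c j l lam
    using compat jl True rank_one lam a\<^sub>0 by unfold_locales auto
  show ?thesis
  proof (cases "l = Suc j")
    case True
    have const: "c a = c a\<^sub>0" if "a \<in> {1..N}" for a
      using S.adjacent(1)[OF True that] S.adjacent(1)[OF True a\<^sub>0(1)] by simp
    have "lam = inverse (q ^ 2)"
      using S.adjacent(2)[OF True] by (metis inverse_unique mult.commute)
    moreover have "\<forall>u\<in>square N. \<alpha> u = wcol q j u"
      using S.adjacent(3)[OF True] by (auto simp: wcol_def square_def)
    moreover have "1 \<le> j" "j < N" using jl True by auto
    ultimately have pattern: "col_pattern lam \<alpha> ((\<lambda>a. ((a, j), (a, l))) ` {1..N})"
      unfolding col_pattern_def True by blast
    show ?thesis
    proof (intro exI conjI)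
      show "((a\<^sub>0, j), (a\<^sub>0, l)) \<in> (\<lambda>a. ((a, j), (a, l))) ` {1..N}"
        by (rule image_eqI[of _ _ a\<^sub>0]) (use a\<^sub>0 in simp_all)
      show "(\<lambda>a. ((a, j), (a, l))) ` {1..N} \<subseteq> (\<lambda>a. ((a, j), (a, l))) ` {a \<in> {1..N}. c a = c a\<^sub>0}"
        by (rule image_mono) (use const in blast)
    qed (rule pattern)
  next
    case False
    have "a\<^sub>0 = 1" using S.distant(4)[OF False a\<^sub>0(1)] a\<^sub>0(2) by auto
    moreover have "\<forall>u\<in>square N. \<alpha> u = wtop q N u"
      using S.distant(5)[OF False] by (auto simp: wtop_def square_def)
    ultimately have "col_pattern lam \<alpha> {((1, 1), (1, N))}"
      using S.distant(3)[OF False] unfolding col_pattern_def by blast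
    then have "col_pattern lam \<alpha> {((a\<^sub>0, j), (a\<^sub>0, l))}"
      using S.distant(1,2)[OF False] \<open>a\<^sub>0 = 1\<close> by simp
    then show ?thesis
      by (rule exI[where x = "{((a\<^sub>0, j), (a\<^sub>0, l))}", OF conjI]) (use a\<^sub>0(1) in simp)
  qed
next
  case False
  \<comment> \<open>Reversing the order of rows and of columns reduces to the previous case for \<open>q\<^sup>-\<^sup>1\<close>.\<close>
  interpret inv: generic_quantum_matrices "inverse q" N
    using q_nonzero q_square N_ge by unfold_locales (auto simp: power_inverse)
  let ?r = "rev_index N"
  let ?c = "\<lambda>a. c (Suc N - a)"
  have rev: "?r (a, b) = (Suc N - a, Suc N - b)" if "a \<in> {1..N}" "b \<in> {1..N}" for a b
    using that by (simp add: rev_index_def)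
  have "stable (\<lambda>u. mon [u] (\<alpha> u)) (\<lambda>u. mon [(fst u, l)] (if snd u = j then c (fst u) else 0))"
    by (rule monomial_stable[OF rank_one compat]) (use jl in \<open>auto simp: square_def\<close>)
  then have "inv.stable (\<lambda>u. mon [u] (\<alpha> (?r u)))
      (\<lambda>u. mon [?r (fst (?r u), l)] (if snd (?r u) = j then c (fst (?r u)) else 0))"
    using inv.stable_rev[of "\<lambda>u. mon [u] (\<alpha> u)" "\<lambda>u. mon [(fst u, l)] (if snd u = j then c (fst u) else 0)"]
    by (simp add: relabel_mon)
  from inv.stable_mleib[OF this]
  have compat': "inv.compatible (inv.mleib (\<alpha> \<circ> ?r) (\<lambda>u. (fst u, Suc N - l))
      (\<lambda>u. if snd u = Suc N - j then ?c (fst u) else 0))"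
  proof (rule inv.compatible_cong[rotated])
    have r: "?r (Suc N - fst u, l) = (fst u, Suc N - l)" "snd (?r u) = j \<longleftrightarrow> snd u = Suc N - j"
      "fst (?r u) = Suc N - fst u" if u_in: "u \<in> square N" for u
    proof -
      obtain a b where u: "u = (a, b)" "a \<in> {1..N}" "b \<in> {1..N}" using u_in by (auto simp: square_def)
      have "Suc N - a \<in> {1..N}" using u by auto
      then show "?r (Suc N - fst u, l) = (fst u, Suc N - l)" using u jl rev[of "Suc N - a" l] by simp
      show "snd (?r u) = j \<longleftrightarrow> snd u = Suc N - j" "fst (?r u) = Suc N - fst u"
        using u jl rev[of a b] by auto
    qed
    fix u v assume "u \<in> square N" "v \<in> square N"
    then show "inv.mleib (\<lambda>u. \<alpha> (?r u)) (\<lambda>u. ?r (fst (?r u), l)) (\<lambda>u. if snd (?r u) = j then c (fst (?r u)) else 0) u v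
      = inv.mleib (\<alpha> \<circ> ?r) (\<lambda>u. (fst u, Suc N - l)) (\<lambda>u. if snd u = Suc N - j then ?c (fst u) else 0) u v"
      by (simp add: inv.mleib_def r)
  qed
  interpret S: column_shift "inverse q" N "\<alpha> \<circ> ?r" ?c "Suc N - j" "Suc N - l" lam
  proof (unfold_locales; (rule compat')?)
    show "inv.rank_one_weights (\<alpha> \<circ> ?r)"
      unfolding inv.rank_one_weights_def
    proof (intro conjI ballI allI impI)
      fix i j k l assume ijkl: "{i, j, k, l} \<subseteq> {1..N}"
      then have "{Suc N - i, Suc N - j, Suc N - k, Suc N - l} \<subseteq> {1..N}" by auto
      from rank_one_weightsD(2)[OF rank_one this] ijkl
      show "(\<alpha> \<circ> ?r) (i, j) * (\<alpha> \<circ> ?r) (k, l) = (\<alpha> \<circ> ?r) (i, l) * (\<alpha> \<circ> ?r) (k, j)"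
        by (simp add: rev)
    qed (use rank_one_weightsD(1)[OF rank_one] in simp)
    show "(\<alpha> \<circ> ?r) (a, Suc N - l) = lam * (\<alpha> \<circ> ?r) (a, Suc N - j)"
      if "a \<in> {1..N}" "c (Suc N - a) \<noteq> 0" for a
    proof -
      have in_N: "Suc N - a \<in> {1..N}" "Suc N - l \<in> {1..N}" "Suc N - j \<in> {1..N}"
        using that jl by auto
      show ?thesis
        using lam[OF in_N(1) that(2)] rev[OF that(1) in_N(2)] rev[OF that(1) in_N(3)] jl by simp
    qed
    show "\<exists>a\<in>{1..N}. c (Suc N - a) \<noteq> 0"
      using a\<^sub>0 by (intro bexI[of _ "Suc N - a\<^sub>0"]) auto
  qed (use jl False in auto)
  have flip: "Suc N - a \<in> {1..N}" if "a \<in> {1..N}" for a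
    using that by auto
  have unrev: "\<alpha> (a, b) = (\<alpha> \<circ> ?r) (Suc N - a, Suc N - b)" if "a \<in> {1..N}" "b \<in> {1..N}" for a b
    using rev_index_rev[of N "(a, b)"] unfolding rev[OF that] by simp
  show ?thesis
  proof (cases "Suc N - l = Suc (Suc N - j)")
    case True
    then have j: "j = Suc l" using jl by auto
    have const: "c a = c a\<^sub>0" if "a \<in> {1..N}" for a
      using S.adjacent(1)[OF True flip[OF that]] S.adjacent(1)[OF True flip[OF a\<^sub>0(1)]] that a\<^sub>0 by simp
    have "lam = q ^ 2"
      using S.adjacent(2)[OF True] q_nonzero by (simp add: field_simps)
    moreover have "\<alpha> u = wcol q l u" if u_in: "u \<in> square N" for u
    proof -
      obtain a b where u: "u = (a, b)" "a \<in> {1..N}" "b \<in> {1..N}" using u_in by (auto simp: square_def)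
      then show ?thesis
        using unrev[OF u(2,3)] S.adjacent(3)[OF True flip[OF u(2)] flip[OF u(3)]] jl j
        by (auto simp: wcol_def)
    qed
    moreover have "1 \<le> l" "l < N" using jl j by auto
    ultimately have pattern: "col_pattern lam \<alpha> ((\<lambda>a. ((a, j), (a, l))) ` {1..N})"
      unfolding col_pattern_def j by blast
    show ?thesis
    proof (intro exI conjI)
      show "((a\<^sub>0, j), (a\<^sub>0, l)) \<in> (\<lambda>a. ((a, j), (a, l))) ` {1..N}"
        by (rule image_eqI[of _ _ a\<^sub>0]) (use a\<^sub>0 in simp_all)
      show "(\<lambda>a. ((a, j), (a, l))) ` {1..N} \<subseteq> (\<lambda>a. ((a, j), (a, l))) ` {a \<in> {1..N}. c a = c a\<^sub>0}"
        by (rule image_mono) (use const in blast)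
    qed (rule pattern)
  next
    case False
    note distant = S.distant[OF False]
    have jl': "j = N" "l = 1" using distant(1,2) jl by auto
    have "Suc N - (Suc N - a\<^sub>0) = a\<^sub>0" using a\<^sub>0(1) by auto
    then have "Suc N - a\<^sub>0 = 1" using distant(4)[OF flip[OF a\<^sub>0(1)]] a\<^sub>0(2) by auto
    then have a: "a\<^sub>0 = N" using a\<^sub>0(1) by auto
    have "\<alpha> u = wbot q N u" if u_in: "u \<in> square N" for u
    proof -
      obtain a b where u: "u = (a, b)" "a \<in> {1..N}" "b \<in> {1..N}" using u_in by (auto simp: square_def)
      then show ?thesis
        using unrev[OF u(2,3)] distant(5)[OF flip[OF u(2)] flip[OF u(3)]] u(2,3) N_ge
        by (auto simp: wbot_def power_inverse)
    qed
    moreover have "lam = inverse (q ^ 2)" using distant(3) by (simp add: power_inverse)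
    ultimately have "col_pattern lam \<alpha> {((N, N), (N, 1))}"
      unfolding col_pattern_def by blast
    then have "col_pattern lam \<alpha> {((a\<^sub>0, j), (a\<^sub>0, l))}" using jl' a by simp
    then show ?thesis
      by (rule exI[where x = "{((a\<^sub>0, j), (a\<^sub>0, l))}", OF conjI]) (use a\<^sub>0(1) in simp)
  qed
qed

lemma two_element_mset: "{#a, b#} = {#c, d#} \<longleftrightarrow> a = c \<and> b = d \<or> a = d \<and> b = c"
  by (auto simp: add_eq_conv_ex)

lemma linear_form_swap: "relabel prod.swap (linear_form c) = linear_form (c \<circ> prod.swap)"
proof -
  have "relabel prod.swap (linear_form c) = (\<Sum>w\<in>square N. mon [prod.swap w] (c w))"
    by (simp add: linear_form_def linmap_sum relabel_mon)
  also have "\<dots> = linear_form (c \<circ> prod.swap)"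
    unfolding linear_form_def
    by (rule sum.reindex_bij_witness[of _ prod.swap prod.swap]) (auto simp: square_def)
  finally show ?thesis .
qed

lemma stable_swap_linear:
  assumes "stable (\<lambda>u. mon [\<pi> u] (\<alpha> u)) (\<lambda>u. linear_form (c u))"
  shows "stable (\<lambda>u. mon [prod.swap (\<pi> (prod.swap u))] ((\<alpha> \<circ> prod.swap) u))
    (\<lambda>u. linear_form (\<lambda>w. c (prod.swap u) (prod.swap w)))"
  using stable_swap[OF assms] by (simp add: relabel_mon linear_form_swap comp_def)

lemma column_entry:
  assumes stable: "stable (\<lambda>u. mon [u] (\<alpha> u)) (\<lambda>u. linear_form (c u))"
    and rank_one: "rank_one_weights \<alpha>"
    and lam: "\<And>u w. u \<in> square N \<Longrightarrow> w \<in> square N \<Longrightarrow> c u w \<noteq> 0 \<Longrightarrow> \<alpha> w = lam * \<alpha> u"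
    and "i \<in> {1..N}" and jl: "j \<in> {1..N}" "l \<in> {1..N}" "j \<noteq> l" and "c (i, j) (i, l) \<noteq> 0"
  shows "\<exists>S. col_pattern lam \<alpha> S \<and> ((i, j), (i, l)) \<in> S \<and> (\<forall>(u, w)\<in>S. c u w = c (i, j) (i, l))"
proof -
  have "compatible (leib id \<alpha> c)"
    using stable_compatible[OF stable] leibniz_linear_form[of id \<alpha> c] by simp
  from compatible_component[OF this, of "(1, j)" "(1, l)"]
  have "compatible (mleib \<alpha> (\<lambda>u. (fst u, l)) (\<lambda>u. if snd u = j then c (fst u, j) (fst u, l) else 0))"
  proof (rule compatible_cong[rotated])
    fix u v assume uv: "u \<in> square N" "v \<in> square N"
    show "leib id \<alpha> (\<lambda>u w. if shift (1, j) (1, l) u w then c u w else 0) u v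
      = mleib \<alpha> (\<lambda>u. (fst u, l)) (\<lambda>u. if snd u = j then c (fst u, j) (fst u, l) else 0) u v"
    proof (rule leib_monomial[OF _ _ uv])
      fix u w :: "nat \<times> nat"
      show "(if shift (1, j) (1, l) u w then c u w else 0)
        = (if w = (fst u, l) then if snd u = j then c (fst u, j) (fst u, l) else 0 else 0)"
        using jl by (cases u; cases w) (auto simp: shift_def degree_def two_element_mset)
    qed (use jl in \<open>auto simp: square_def\<close>)
  qed
  from column_component[OF this jl rank_one, of lam i] lam assms(4,5,6,8)
  obtain S where S: "col_pattern lam \<alpha> S" "((i, j), (i, l)) \<in> S"
    "S \<subseteq> (\<lambda>a. ((a, j), (a, l))) ` {a \<in> {1..N}. c (a, j) (a, l) = c (i, j) (i, l)}"
    by auto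
  then show ?thesis by (intro exI[of _ S]) auto
qed

text \<open>
  A nonzero entry determines a bidegree, and the component of \<open>x\<close> in this bidegree satisfies the
  relations by itself. It preserves all rows, or all columns, or moves a single generator
  diagonally; the entries on the diagonal vanish since \<open>\<lambda> \<noteq> 1\<close>.
\<close>

lemma entry:
  assumes stable: "stable (\<lambda>u. mon [u] (\<alpha> u)) (\<lambda>u. linear_form (c u))"
    and rank_one: "rank_one_weights \<alpha>"
    and lam: "\<And>u w. u \<in> square N \<Longrightarrow> w \<in> square N \<Longrightarrow> c u w \<noteq> 0 \<Longrightarrow> \<alpha> w = lam * \<alpha> u"
    and "lam \<noteq> 1" and uw: "u \<in> square N" "w \<in> square N" "c u w \<noteq> 0"
  shows "\<exists>S. pattern lam \<alpha> S \<and> (u, w) \<in> S \<and> (\<forall>(u', w')\<in>S. c u' w' = c u w)"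
proof -
  obtain i j k l where ijkl: "u = (i, j)" "w = (k, l)" "{i, j, k, l} \<subseteq> {1..N}"
    using uw by (auto simp: square_def)
  consider "i = k" "j = l" | "i = k" "j \<noteq> l" | "i \<noteq> k" "j = l" | "i \<noteq> k" "j \<noteq> l" by blast
  then show ?thesis
  proof cases
    case 1
    then show ?thesis
      using lam[OF uw] rank_one_weightsD(1)[OF rank_one uw(1)] \<open>lam \<noteq> 1\<close> ijkl by auto
  next
    case 2
    then show ?thesis
      using column_entry[OF stable rank_one lam, of i j l] ijkl uw unfolding pattern_def by auto
  next
    case 3
    let ?s = "prod.swap :: nat \<times> nat \<Rightarrow> nat \<times> nat"
    have "rank_one_weights (\<alpha> \<circ> ?s)"
      unfolding rank_one_weights_def
    proof (intro conjI ballI allI impI)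
      fix i j k l assume "{i, j, k, l} \<subseteq> {1..N}"
      then show "(\<alpha> \<circ> ?s) (i, j) * (\<alpha> \<circ> ?s) (k, l) = (\<alpha> \<circ> ?s) (i, l) * (\<alpha> \<circ> ?s) (k, j)"
        using rank_one_weightsD(2)[OF rank_one, of j i l k] by (simp add: mult.commute)
    qed (use rank_one_weightsD(1)[OF rank_one] in \<open>auto simp: square_def\<close>)
    then obtain S where S: "col_pattern lam (\<alpha> \<circ> ?s) S" "((j, i), (j, k)) \<in> S"
      "\<forall>(u', w')\<in>S. c (?s u') (?s w') = c (?s (j, i)) (?s (j, k))"
      using column_entry[of "\<alpha> \<circ> ?s" "\<lambda>u w. c (?s u) (?s w)" lam j i k] stable_swap_linear[OF stable[folded id_apply]]
        lam ijkl 3 uw by (auto simp: square_def)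
    have "transpose_pairs (transpose_pairs S) = S"
      by (simp add: image_image map_prod_def split_beta)
    with S(1) have "pattern lam \<alpha> (transpose_pairs S)" unfolding pattern_def by simp
    moreover have "(u, w) \<in> transpose_pairs S"
      by (rule image_eqI[OF _ S(2)]) (use 3 ijkl in simp)
    moreover have "\<forall>(u', w')\<in>transpose_pairs S. c u' w' = c u w"
      using S(3) 3 ijkl by auto
    ultimately show ?thesis by blast
  next
    case 4
    have "compatible (leib id \<alpha> c)"
      using stable_compatible[OF stable] leibniz_linear_form[of id \<alpha> c] by simp
    from compatible_component[OF this, of "(i, j)" "(k, l)"]
    have "compatible (mleib \<alpha> (\<lambda>_. (k, l)) (\<lambda>u. if u = (i, j) then c (i, j) (k, l) else 0))"
    proof (rule compatible_cong[rotated])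
      fix u v assume uv: "u \<in> square N" "v \<in> square N"
      show "leib id \<alpha> (\<lambda>u w. if shift (i, j) (k, l) u w then c u w else 0) u v
        = mleib \<alpha> (\<lambda>_. (k, l)) (\<lambda>u. if u = (i, j) then c (i, j) (k, l) else 0) u v"
      proof (rule leib_monomial[OF _ _ uv])
        fix u w :: "nat \<times> nat"
        show "(if shift (i, j) (k, l) u w then c u w else 0)
          = (if w = (k, l) then if u = (i, j) then c (i, j) (k, l) else 0 else 0)"
          using 4 by (cases u; cases w) (auto simp: shift_def degree_def two_element_mset)
      qed (use ijkl in \<open>auto simp: square_def\<close>)
    qed
    from no_diagonal_shift[OF this ijkl(3) 4 rank_one_weightsD(1)[OF rank_one]]
    show ?thesis using uw ijkl by simp
  qed
qed

text \<open>
  Different components of \<open>x\<close> share the weights of \<open>g\<close> and the scalar \<open>\<lambda>\<close>, and these determine the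
  pattern. Hence \<open>x\<close> has only one component. The hypothesis \<open>\<lambda>\<^sup>2 \<noteq> 1\<close> separates \<open>q\<^sup>2\<close> from \<open>q\<^sup>-\<^sup>2\<close>.
\<close>

lemma col_pattern_cases [consumes 2, case_names col top bottom]:
  assumes "col_pattern lam \<alpha> S" "lam ^ 2 \<noteq> 1"
  obtains b where "1 \<le> b" "b < N" "\<And>u. u \<in> square N \<Longrightarrow> \<alpha> u = wcol q b u"
      "S = (if lam = q ^ 2 then (\<lambda>a. ((a, Suc b), (a, b))) ` {1..N} else (\<lambda>a. ((a, b), (a, Suc b))) ` {1..N})"
  | "\<And>u. u \<in> square N \<Longrightarrow> \<alpha> u = wtop q N u" "lam = q ^ 2" "S = {((1, 1), (1, N))}"
  | "\<And>u. u \<in> square N \<Longrightarrow> \<alpha> u = wbot q N u" "lam \<noteq> q ^ 2" "S = {((N, N), (N, 1))}"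
proof -
  have inv: "lam \<noteq> q ^ 2" if "lam = inverse (q ^ 2)"
  proof
    assume "lam = q ^ 2"
    then have "lam ^ 2 = inverse (q ^ 2) * q ^ 2" using that by (metis power2_eq_square)
    then show False using assms(2) q_nonzero by simp
  qed
  from assms(1) consider
    (c1) b where "1 \<le> b" "b < N" "\<forall>u\<in>square N. \<alpha> u = wcol q b u" "lam = inverse (q ^ 2)"
      "S = (\<lambda>a. ((a, b), (a, Suc b))) ` {1..N}"
  | (c2) b where "1 \<le> b" "b < N" "\<forall>u\<in>square N. \<alpha> u = wcol q b u" "lam = q ^ 2"
      "S = (\<lambda>a. ((a, Suc b), (a, b))) ` {1..N}"
  | (c3) "\<forall>u\<in>square N. \<alpha> u = wtop q N u" "lam = q ^ 2" "S = {((1, 1), (1, N))}"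
  | (c4) "\<forall>u\<in>square N. \<alpha> u = wbot q N u" "lam = inverse (q ^ 2)" "S = {((N, N), (N, 1))}"
    unfolding col_pattern_def by blast
  then show thesis
  proof cases
    case (c1 b)
    have "S = (if lam = q ^ 2 then (\<lambda>a. ((a, Suc b), (a, b))) ` {1..N} else (\<lambda>a. ((a, b), (a, Suc b))) ` {1..N})"
      unfolding if_not_P[OF inv[OF c1(4)]] by (rule c1(5))
    from that(1)[OF c1(1,2) bspec[OF c1(3)] this] show thesis .
  next
    case (c2 b)
    have "S = (if lam = q ^ 2 then (\<lambda>a. ((a, Suc b), (a, b))) ` {1..N} else (\<lambda>a. ((a, b), (a, Suc b))) ` {1..N})"
      unfolding if_P[OF c2(4)] by (rule c2(5))
    from that(1)[OF c2(1,2) bspec[OF c2(3)] this] show thesis .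
  next
    case c3
    from that(2)[OF bspec[OF c3(1)] c3(2,3)] show thesis .
  next
    case c4
    from that(3)[OF bspec[OF c4(1)] inv[OF c4(2)] c4(3)] show thesis .
  qed
qed

lemma transpose_pairs_twice: "transpose_pairs (transpose_pairs S) = S"
  by (simp add: image_image map_prod_def split_beta)

lemma pattern_weights:
  assumes "pattern lam \<alpha> S" "lam ^ 2 \<noteq> 1"
  obtains (col) b where "1 \<le> b" "b < N" "\<And>u. u \<in> square N \<Longrightarrow> \<alpha> u = wcol q b u"
      "S = (if lam = q ^ 2 then (\<lambda>a. ((a, Suc b), (a, b))) ` {1..N} else (\<lambda>a. ((a, b), (a, Suc b))) ` {1..N})"
  | (row) a where "1 \<le> a" "a < N" "\<And>u. u \<in> square N \<Longrightarrow> \<alpha> u = wcol q a (prod.swap u)"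
      "S = transpose_pairs (if lam = q ^ 2 then (\<lambda>b. ((b, Suc a), (b, a))) ` {1..N} else (\<lambda>b. ((b, a), (b, Suc a))) ` {1..N})"
  | (top) "\<And>u. u \<in> square N \<Longrightarrow> \<alpha> u = wtop q N u" "lam = q ^ 2" "S = {((1, 1), (1, N))}"
  | (left) "\<And>u. u \<in> square N \<Longrightarrow> \<alpha> u = wtop q N (prod.swap u)" "lam = q ^ 2" "S = transpose_pairs {((1, 1), (1, N))}"
  | (bottom) "\<And>u. u \<in> square N \<Longrightarrow> \<alpha> u = wbot q N u" "lam \<noteq> q ^ 2" "S = {((N, N), (N, 1))}"
  | (right) "\<And>u. u \<in> square N \<Longrightarrow> \<alpha> u = wbot q N (prod.swap u)" "lam \<noteq> q ^ 2" "S = transpose_pairs {((N, N), (N, 1))}"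
proof -
  have \<alpha>: "\<alpha> u = w (prod.swap u)"
    if "\<And>u. u \<in> square N \<Longrightarrow> (\<alpha> \<circ> prod.swap) u = w u" "u \<in> square N" for u and w :: "_ \<Rightarrow> 'k"
    using that(1)[of "prod.swap u"] that(2) by (auto simp: square_def)
  from assms(1) consider "col_pattern lam \<alpha> S" | "col_pattern lam (\<alpha> \<circ> prod.swap) (transpose_pairs S)"
    unfolding pattern_def by blast
  then show thesis
  proof cases
    case 1
    from 1 assms(2) show thesis
    proof (cases rule: col_pattern_cases)
      case (col b)
      from that(1)[OF col] show thesis .
    next
      case top
      from that(3)[OF top] show thesis .
    next
      case bottom
      from that(5)[OF bottom] show thesis .
    qed
  next
    case 2
    have S: "S = transpose_pairs S'" if "transpose_pairs S = S'" for S'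
      using that transpose_pairs_twice[of S] by simp
    from 2 assms(2) show thesis
    proof (cases rule: col_pattern_cases)
      case (col b)
      from row[OF col(1,2) \<alpha>[OF col(3)] S[OF col(4)]] show thesis .
    next
      case top
      from left[OF \<alpha>[OF top(1)] top(2) S[OF top(3)]] show thesis .
    next
      case bottom
      from right[OF \<alpha>[OF bottom(1)] bottom(2) S[OF bottom(3)]] show thesis .
    qed
  qed
qed

lemma col_pattern_unique:
  assumes "col_pattern lam \<alpha> S" "pattern lam \<alpha> S'" and lam: "lam ^ 2 \<noteq> 1"
  shows "S = S'"
proof -
  have N: "Suc 0 \<le> N" "2 \<le> N" "(2::nat) \<noteq> N" "Suc 0 \<noteq> N" "N \<noteq> Suc 0" "N \<noteq> 2" using N_ge by auto
  have q: "q \<noteq> 0" "q \<noteq> 1" "inverse q \<noteq> 1" "inverse q \<noteq> q" "q \<noteq> inverse q"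
    "inverse (q ^ 2) \<noteq> 1" "q ^ 2 \<noteq> 1" "inverse (q ^ 2) \<noteq> inverse q"
    using q_nonzero q_gap q_square by (auto simp: field_simps power2_eq_square)
  have pts: "(1, 1) \<in> square N" "(1, 2) \<in> square N" "(2, 1) \<in> square N" "(2, 2) \<in> square N"
    "(N, 1) \<in> square N" using N by auto
  note w = wcol_def wtop_def wbot_def
  from assms(1) lam show ?thesis
  proof (cases rule: col_pattern_cases)
    case (col b)
    note \<alpha> = col(3)
    have bb: "(1, b) \<in> square N" "(1, Suc b) \<in> square N" using col N by auto
    from assms(2) lam show ?thesis
    proof (cases rule: pattern_weights)
      case (col b')
      have "b = b'"
        using \<alpha>[OF bb(1)] col(3)[OF bb(1)] \<alpha>[OF bb(2)] col(3)[OF bb(2)] q by (auto simp: w split: if_splits)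
      with col(4) \<open>S = _\<close> show ?thesis by simp
    next
      case row
      from row(3)[OF bb(1)] row(3)[OF bb(2)] \<alpha>[OF bb(1)] \<alpha>[OF bb(2)] q show ?thesis
        by (auto simp: w split: if_splits)
    next
      case top
      from top(1)[OF pts(1)] top(1)[OF pts(3)] \<alpha>[OF pts(1)] \<alpha>[OF pts(3)] q N show ?thesis
        by (auto simp: w split: if_splits)
    next
      case left
      from left(1)[OF pts(2)] left(1)[OF pts(4)] \<alpha>[OF pts(2)] \<alpha>[OF pts(4)] q N show ?thesis
        by (auto simp: w split: if_splits)
    next
      case bottom
      from bottom(1)[OF pts(1)] bottom(1)[OF pts(5)] \<alpha>[OF pts(1)] \<alpha>[OF pts(5)] q N show ?thesis
        by (auto simp: w split: if_splits)
    next
      case right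
      from right(1)[OF pts(1)] right(1)[OF pts(3)] \<alpha>[OF pts(1)] \<alpha>[OF pts(3)] q N show ?thesis
        by (auto simp: w split: if_splits)
    qed
  next
    case top
    note \<alpha> = top(1) and first = top(2,3)
    from assms(2) lam show ?thesis
    proof (cases rule: pattern_weights)
      case col
      from col(3)[OF pts(1)] col(3)[OF pts(3)] \<alpha>[OF pts(1)] \<alpha>[OF pts(3)] q N show ?thesis
        by (auto simp: w split: if_splits)
    next
      case row
      from row(3)[OF pts(3)] row(3)[OF pts(4)] \<alpha>[OF pts(3)] \<alpha>[OF pts(4)] q N show ?thesis
        by (auto simp: w split: if_splits)
    next
      case left
      from left(1)[OF pts(1)] left(1)[OF pts(2)] \<alpha>[OF pts(1)] \<alpha>[OF pts(2)] q N show ?thesis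
        by (auto simp: w split: if_splits)
    qed (use first in simp_all)
  next
    case bottom
    note \<alpha> = bottom(1) and first = bottom(2,3)
    from assms(2) lam show ?thesis
    proof (cases rule: pattern_weights)
      case col
      from col(3)[OF pts(1)] col(3)[OF pts(5)] \<alpha>[OF pts(1)] \<alpha>[OF pts(5)] q N show ?thesis
        by (auto simp: w split: if_splits)
    next
      case row
      from row(3)[OF pts(1)] row(3)[OF pts(2)] \<alpha>[OF pts(1)] \<alpha>[OF pts(2)] q N show ?thesis
        by (auto simp: w split: if_splits)
    next
      case right
      from right(1)[OF pts(1)] right(1)[OF pts(2)] \<alpha>[OF pts(1)] \<alpha>[OF pts(2)] q N show ?thesis
        by (auto simp: w split: if_splits)
    qed (use first in simp_all)
  qed
qed

lemma pattern_unique: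
  assumes "pattern lam \<alpha> S" "pattern lam \<alpha> S'" "lam ^ 2 \<noteq> 1"
  shows "S = S'"
proof -
  have "pattern lam (\<alpha> \<circ> prod.swap) (transpose_pairs S')"
    using assms(2) unfolding pattern_def transpose_pairs_twice by (auto simp: comp_assoc)
  then show ?thesis
    using assms(1) col_pattern_unique[OF _ assms(2,3), of S]
      col_pattern_unique[OF _ _ assms(3), of "\<alpha> \<circ> prod.swap" "transpose_pairs S" "transpose_pairs S'"]
    unfolding pattern_def[of lam \<alpha> S] by (metis transpose_pairs_twice)
qed

text \<open>
  Now let \<open>g\<close> involve the transposition. The word \<open>decreasing u v\<close> is the one into which
  \<open>Y\<^sub>u Y\<^sub>v\<close> is reordered.
\<close>

definition decreasing :: "nat \<times> nat \<Rightarrow> nat \<times> nat \<Rightarrow> (nat \<times> nat) list" where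
  "decreasing u v = (if fst u < fst v \<or> fst u = fst v \<and> snd u < snd v then [v, u] else [u, v])"

lemma nf2_lead: "cf (nf2 u v) (decreasing u v) \<noteq> 0"
  using q_nonzero by (cases u; cases v) (auto simp: nf2_def decreasing_def lookup_add lookup_single when_def)

lemma nf2_support:
  assumes "cf (nf2 a b) (decreasing w v) \<noteq> 0"
  shows "a = w \<and> b = v \<or> a = v \<and> b = w \<or> fst a < fst b \<and> snd a < snd b \<and>
    (w = (fst b, snd a) \<and> v = (fst a, snd b) \<or> w = (fst a, snd b) \<and> v = (fst b, snd a))"
  using assms by (cases a; cases b; cases w; cases v)
    (auto simp: nf2_def decreasing_def lookup_add lookup_single when_def split: if_splits)

text \<open>
  In the relation between \<open>u = (i, j)\<close> and a neighbour \<open>v\<close> in the same row, the coefficient at \<open>Y\<^sub>w Y\<^sub>v\<close>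
  involves no other entry of \<open>c\<close> unless \<open>w\<close> lies in the column of \<open>u\<close> and in another row. The column of
  \<open>v\<close> is chosen different from \<open>i\<close> and \<open>j\<close>, which is possible since \<open>N \<ge> 3\<close>.
  If \<open>w\<close> is the transpose of \<open>v\<close>, the entry at \<open>v\<close> interferes, so it is eliminated first.
\<close>

lemma transposed_row:
  assumes compat: "compatible (leib prod.swap \<alpha> c)"
    and diag: "\<And>u. u \<in> square N \<Longrightarrow> c u u = 0 \<and> c u (prod.swap u) = 0"
    and ij: "i \<in> {1..N}" "j \<in> {1..N}" and w\<^sub>0: "w\<^sub>0 \<in> square N" "c (i, j) w\<^sub>0 \<noteq> 0"
  shows "snd w\<^sub>0 = j \<and> fst w\<^sub>0 \<noteq> i"
proof -
  have "\<exists>b\<in>{1..N}. b \<noteq> i \<and> b \<noteq> j"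
  proof -
    have "\<not> {1, 2, 3} \<subseteq> {i, j}" using card_mono[of "{i, j}" "{1, 2, 3::nat}"] card_insert_le_m1[of 2 "{j}" i] by auto
    then show ?thesis using N_ge by (auto simp: subset_iff)
  qed
  then obtain b where b: "b \<in> {1..N}" "b \<noteq> i" "b \<noteq> j" by blast
  define u v where "u = (i, j)" and "v = (i, b)"
  have uv: "u \<in> square N" "v \<in> square N" using ij b by (simp_all add: u_def v_def)
  have "\<exists>\<kappa>. leib prod.swap \<alpha> c u v = \<kappa> \<cdot> leib prod.swap \<alpha> c v u"
  proof (cases "j < b")
    case True
    then show ?thesis
      using compatibleD(1)[OF compat, of i j i b] ij b unfolding u_def v_def by auto
  next
    case False
    then have "leib prod.swap \<alpha> c v u = q \<cdot> leib prod.swap \<alpha> c u v"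
      using compatibleD(1)[OF compat, of i b i j] ij b unfolding u_def v_def by auto
    then have "leib prod.swap \<alpha> c u v = inverse q \<cdot> leib prod.swap \<alpha> c v u"
      using q_nonzero by simp
    then show ?thesis ..
  qed
  then obtain \<kappa> where \<kappa>: "leib prod.swap \<alpha> c u v = \<kappa> \<cdot> leib prod.swap \<alpha> c v u" ..
  \<comment> \<open>The coefficient of \<open>Y\<^sub>w Y\<^sub>v\<close> isolates the matrix entry at \<open>(u, w)\<close>.\<close>
  have isolate: "c u w = 0"
    if w: "w \<in> square N" "snd w \<noteq> j \<or> fst w = i" and cv: "w = prod.swap v \<Longrightarrow> c u v = 0" for w
  proof (rule ccontr)
    assume nz: "c u w \<noteq> 0"
    then have w_ne: "w \<noteq> u" "w \<noteq> prod.swap u" using diag[OF uv(1)] by auto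
    let ?p = "decreasing w v"
    have t1: "c v y * cf (nf2 (prod.swap u) y) ?p = 0" if "y \<in> square N" for y
    proof (rule ccontr)
      assume h: "\<not> ?thesis"
      with nf2_support[of "prod.swap u" y w v] diag[OF uv(2)] w w_ne b show False
        by (cases w; cases y) (auto simp: u_def v_def)
    qed
    have t2: "c v y * cf (nf2 y u) ?p = 0" if "y \<in> square N" for y
    proof (rule ccontr)
      assume h: "\<not> ?thesis"
      with nf2_support[of y u w v] diag[OF uv(2)] w w_ne b show False
        by (cases w; cases y) (auto simp: u_def v_def)
    qed
    have t3: "c u y * cf (nf2 (prod.swap v) y) ?p = 0" if "y \<in> square N" for y
    proof (rule ccontr)
      assume h: "\<not> ?thesis"
      with nf2_support[of "prod.swap v" y w v] cv b show False
        by (cases w; cases y) (auto simp: u_def v_def)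
    qed
    have t4: "c u y * cf (nf2 y v) ?p = 0" if "y \<in> square N" "y \<noteq> w" for y
    proof (rule ccontr)
      assume h: "\<not> ?thesis"
      with nf2_support[of y v w v] that show False
        by (cases w; cases y) (auto simp: u_def v_def)
    qed
    have left: "cf (leib prod.swap \<alpha> c u v) ?p = c u w * cf (nf2 w v) ?p"
    proof -
      have "cf (leib prod.swap \<alpha> c u v) ?p = (\<Sum>y\<in>square N. \<alpha> u * (c v y * cf (nf2 (prod.swap u) y) ?p))
          + (\<Sum>y\<in>square N. c u y * cf (nf2 y v) ?p)"
        by (simp add: leib_def lookup_add lookup_sum mult.assoc)
      also have "(\<Sum>y\<in>square N. c u y * cf (nf2 y v) ?p) = c u w * cf (nf2 w v) ?p"
      proof -
        have "(\<Sum>y\<in>square N - {w}. c u y * cf (nf2 y v) ?p) = 0"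
          by (rule sum.neutral) (use t4 in blast)
        then show ?thesis using w(1) by (simp add: sum.remove[of _ w])
      qed
      finally show ?thesis using t1 by simp
    qed
    have "cf (leib prod.swap \<alpha> c v u) ?p = (\<Sum>y\<in>square N. \<alpha> v * (c u y * cf (nf2 (prod.swap v) y) ?p))
          + (\<Sum>y\<in>square N. c v y * cf (nf2 y u) ?p)"
      by (simp add: leib_def lookup_add lookup_sum mult.assoc)
    then have "cf (leib prod.swap \<alpha> c v u) ?p = 0" using t2 t3 by simp
    then have "c u w * cf (nf2 w v) ?p = 0" using left \<kappa> by simp
    then show False using nz nf2_lead by simp
  qed
  have "c u v = 0"
    by (rule isolate) (use uv b in \<open>auto simp: u_def v_def\<close>)
  then show ?thesis using isolate[of w\<^sub>0] w\<^sub>0 unfolding u_def by blast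
qed

text \<open>
  The previous lemma places the target of a nonzero entry in the column of its source but not in the
  row. Applied to the transpose of \<open>c\<close>, it does the opposite.
\<close>

lemma no_transposed_action:
  assumes stable: "stable (\<lambda>u. mon [prod.swap u] (\<alpha> u)) (\<lambda>u. linear_form (c u))"
    and \<alpha>: "\<And>u. u \<in> square N \<Longrightarrow> \<alpha> u \<noteq> 0"
    and comm: "\<And>u w. u \<in> square N \<Longrightarrow> w \<in> square N \<Longrightarrow>
      \<alpha> w * c u w = lam * \<alpha> u * c (prod.swap u) (prod.swap w)"
    and lam: "lam ^ 2 \<noteq> 1"
    and uw: "u \<in> square N" "w \<in> square N"
  shows "c u w = 0"
proof (rule ccontr)
  let ?s = "prod.swap :: nat \<times> nat \<Rightarrow> nat \<times> nat"
  assume nz: "c u w \<noteq> 0"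
  have sq: "?s u \<in> square N" if "u \<in> square N" for u using that by (auto simp: square_def)
  \<comment> \<open>Commuting \<open>g\<close> past \<open>x\<close> twice multiplies these entries by \<open>\<lambda>\<^sup>2 \<noteq> 1\<close>.\<close>
  have diag: "c u u = 0 \<and> c u (?s u) = 0" if u: "u \<in> square N" for u
  proof -
    have cancel: "x = 0" if "a * x = lam * b * y" "b * y = lam * a * x" "a \<noteq> 0" for a b x y :: 'k
    proof -
      have "a * x = lam * (b * y)" using that(1) by (simp add: mult.assoc)
      also have "\<dots> = lam * (lam * (a * x))" by (subst that(2)) (simp add: mult.assoc)
      finally have "a * x - lam * (lam * (a * x)) = 0" by simp
      moreover have "a * x - lam * (lam * (a * x)) = (1 - lam ^ 2) * (a * x)"
        by (simp add: left_diff_distrib power2_eq_square mult.assoc)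
      ultimately show ?thesis using that(3) lam by simp
    qed
    have "c u u = c (?s u) (?s u) * lam" using comm[OF u u] \<alpha>[OF u] by simp
    moreover have "c (?s u) (?s u) = c u u * lam" using comm[OF sq[OF u] sq[OF u]] \<alpha>[OF sq[OF u]] by simp
    ultimately have "c u u = 0" using cancel[of 1 "c u u" 1 "c (?s u) (?s u)"] by (simp add: mult.commute)
    moreover have "c u (?s u) = 0"
      using cancel[of "\<alpha> (?s u)" "c u (?s u)" "\<alpha> u" "c (?s u) u"] comm[OF u sq[OF u]] comm[OF sq[OF u] u] \<alpha>[OF sq[OF u]]
      by simp
    ultimately show ?thesis ..
  qed
  obtain i j where u: "u = (i, j)" "i \<in> {1..N}" "j \<in> {1..N}" using uw by (auto simp: square_def)
  have compat: "compatible (leib ?s \<alpha> c)"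
    using stable_compatible[OF stable] leibniz_linear_form[of ?s \<alpha> c] by simp
  have "snd w = j"
    using transposed_row[OF compat diag u(2,3) uw(2)] nz u by simp
  moreover have compat': "compatible (leib ?s (\<alpha> \<circ> ?s) (\<lambda>u w. c (?s u) (?s w)))"
    using stable_compatible[OF stable_swap_linear[OF stable]]
      leibniz_linear_form[of ?s "\<alpha> \<circ> ?s" "\<lambda>u w. c (?s u) (?s w)"] by simp
  have "snd (?s w) = i \<and> fst (?s w) \<noteq> j"
    by (rule transposed_row[OF compat' _ u(3,2) sq[OF uw(2)]]) (use diag sq nz u in auto)
  ultimately show False by simp
qed

end

section \<open>Roots of unity\<close>

lemma mult_ord_dvd:
  fixes a :: "'k::field"
  assumes "a \<noteq> 0"
  shows "a ^ n = 1 \<longleftrightarrow> mult_ord a dvd n"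
proof -
  interpret G: group "mult_of (class_ring :: 'k ring)"
    by (rule Multiplicative_Group.field.field_mult_group[OF class_field])
  have pow: "a [^]\<^bsub>mult_of class_ring\<^esub> k = a ^ k" for k :: nat
    by (induction k) (simp_all add: nat_pow_def class_ring_simps mult.commute)
  have "a \<in> carrier (mult_of (class_ring :: 'k ring))"
    using assms by (simp add: class_ring_simps)
  from G.pow_eq_id[OF this, of n] show ?thesis
    by (simp add: pow mult_ord_def class_ring_simps)
qed

lemma root_of_unity_sum:
  fixes a :: "'k::field"
  assumes "a \<noteq> 0" "mult_ord a = m" "m \<ge> 2"
  shows "(\<Sum>i<m. a ^ i) = 0"
proof -
  have "a ^ m = 1" using mult_ord_dvd[OF assms(1), of m] assms(2) by simp
  moreover have "a \<noteq> 1" using mult_ord_dvd[OF assms(1), of 1] assms(2,3) by auto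
  ultimately show ?thesis by (simp add: geometric_sum)
qed

section \<open>Nilpotency of the skew derivations\<close>

text \<open>
  The \<open>\<lambda>\<close>-Leibniz rule for \<open>D\<^sup>k\<close>, on a letter killed by \<open>D\<^sup>2\<close>: only the first two terms survive, and
  the second carries the \<open>\<lambda>\<close>-integer, which vanishes for \<open>k = m\<close>.
\<close>

lemma skew_ext_power_letter:
  fixes \<gamma> \<delta> :: "'x \<Rightarrow> ('x list \<Rightarrow>\<^sub>0 'k::field)"
  defines "G \<equiv> hom_ext \<gamma>" and "D \<equiv> skew_ext \<gamma> \<delta>"
  assumes "\<gamma> u = a \<cdot> mon [u] 1" "G (\<delta> u) = (lam * a) \<cdot> \<delta> u" "D (\<delta> u) = 0"
  shows "(D ^^ Suc k) (mon [u] 1 \<diamondop> f) = a ^ Suc k \<cdot> (mon [u] 1 \<diamondop> (D ^^ Suc k) f)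
    + ((\<Sum>i\<le>k. lam ^ i) * a ^ k) \<cdot> (\<delta> u \<diamondop> (D ^^ k) f)"
proof -
  have D: "linmap D" and DG: "D (e \<diamondop> f) = G e \<diamondop> D f + D e \<diamondop> f" for e f
    by (simp_all add: D_def G_def skew_ext_mult)
  have letter: "G (mon [u] 1) = a \<cdot> mon [u] 1" "D (mon [u] 1) = \<delta> u"
    by (simp_all add: G_def D_def hom_ext_mon skew_ext_mon assms(3))
  have monu: "mon [u] b \<diamondop> e = b \<cdot> (mon [u] 1 \<diamondop> e)" for b e
    using conv_scale(2)[of "(@)" b "mon [u] 1" e] by simp
  have map_id: "Poly_Mapping.map (\<lambda>a. a) e = e" for e :: "'x list \<Rightarrow>\<^sub>0 'k"
  proof -
    have eq: "(\<lambda>a::'k. a) = (*) 1" by (simp add: fun_eq_iff)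
    show ?thesis unfolding eq by (rule scale_one)
  qed
  have D1: "D (mon [u] 1 \<diamondop> e) = a \<cdot> (mon [u] 1 \<diamondop> D e) + \<delta> u \<diamondop> e" for e
    by (simp add: DG letter monu[of a])
  have D2: "D (\<delta> u \<diamondop> e) = (lam * a) \<cdot> (\<delta> u \<diamondop> D e)" for e
    by (simp add: DG assms(4,5) conv_scale)
  show ?thesis
  proof (induction k)
    case 0
    show ?case by (simp add: D1 map_id)
  next
    case (Suc k)
    let ?t = "\<Sum>i\<le>k. lam ^ i"
    have "(\<Sum>i\<le>Suc k. lam ^ i) = 1 + lam * ?t"
      by (simp add: sum.atMost_Suc_shift sum_distrib_left del: sum.atMost_Suc)
    then have coeff: "a ^ Suc k + ?t * a ^ k * (lam * a) = (\<Sum>i\<le>Suc k. lam ^ i) * a ^ Suc k"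
      by (simp add: algebra_simps del: sum.atMost_Suc)
    have "(D ^^ Suc (Suc k)) (mon [u] 1 \<diamondop> f) = D ((D ^^ Suc k) (mon [u] 1 \<diamondop> f))" by simp
    also have "\<dots> = a ^ Suc k \<cdot> D (mon [u] 1 \<diamondop> (D ^^ Suc k) f) + (?t * a ^ k) \<cdot> D (\<delta> u \<diamondop> (D ^^ k) f)"
      unfolding Suc.IH linmap_add[OF D] linmap_scale[OF D] ..
    also have "\<dots> = (a ^ Suc k * a) \<cdot> (mon [u] 1 \<diamondop> D ((D ^^ Suc k) f))
        + (a ^ Suc k \<cdot> (\<delta> u \<diamondop> (D ^^ Suc k) f) + (?t * a ^ k * (lam * a)) \<cdot> (\<delta> u \<diamondop> D ((D ^^ k) f)))"
      unfolding D1 D2 scale_add scale_scale add.assoc ..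
    also have "D ((D ^^ k) f) = (D ^^ Suc k) f" by simp
    also have "a ^ Suc k \<cdot> (\<delta> u \<diamondop> (D ^^ Suc k) f) + (?t * a ^ k * (lam * a)) \<cdot> (\<delta> u \<diamondop> (D ^^ Suc k) f)
        = ((\<Sum>i\<le>Suc k. lam ^ i) * a ^ Suc k) \<cdot> (\<delta> u \<diamondop> (D ^^ Suc k) f)"
      unfolding scale_add_left[symmetric] coeff ..
    also have "D ((D ^^ Suc k) f) = (D ^^ Suc (Suc k)) f" by simp
    finally show ?case by (simp only: power_Suc2[symmetric])
  qed
qed

text \<open>
  The \<open>\<lambda>\<close>-integer \<open>1 + \<lambda> + \<dots> + \<lambda>\<^bsup>m-1\<^esup>\<close> vanishes, so by the previous lemma \<open>D\<^sup>m\<close> moves past every letter.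
\<close>

lemma skew_ext_nilpotent:
  fixes \<gamma> \<delta> :: "'x \<Rightarrow> ('x list \<Rightarrow>\<^sub>0 'k::field)"
  defines "G \<equiv> hom_ext \<gamma>" and "D \<equiv> skew_ext \<gamma> \<delta>"
  assumes letter: "\<And>u. u \<in> X \<Longrightarrow> \<gamma> u = a u \<cdot> mon [u] 1 \<and> G (\<delta> u) = (lam * a u) \<cdot> \<delta> u \<and> D (\<delta> u) = 0"
    and sum: "(\<Sum>i<m. lam ^ i) = 0" and m: "m > 0" and f: "f \<in> formal_sums (words X)"
  shows "(D ^^ m) f = 0"
proof -
  have lin: "linmap (D ^^ k)" for k
    by (induction k) (simp_all add: D_def linmap_ident id_def linmap_comp)
  have word: "(D ^^ m) (mon w 1) = 0" if "set w \<subseteq> X" for w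
    using that
  proof (induction w)
    case Nil
    have "D (mon [] 1) = 0" by (simp add: D_def skew_ext_mon)
    moreover have "(D ^^ k) 0 = 0" for k using lin by (rule linmap_zero)
    ultimately show ?case using m by (cases m) (simp_all add: funpow_swap1)
  next
    case (Cons u w)
    obtain k where k: "m = Suc k" using m by (cases m) auto
    have "{..<m} = {..k}" using k by auto
    with sum have "(\<Sum>i\<le>k. lam ^ i) = 0" by simp
    with Cons letter[of u] skew_ext_power_letter[of \<gamma> u "a u" \<delta> lam k "mon w 1"] show ?case
      unfolding mon_Cons[of u w] k G_def D_def by simp
  qed
  have "(D ^^ m) f = lin (\<lambda>w. (D ^^ m) (mon w 1)) f" by (rule linmap_eq_lin[OF lin])
  also have "\<dots> = lin (\<lambda>w. 0) f"
    using supp_formal_sums[OF f] word by (intro lin_cong) (auto simp: lists_eq_set)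
  finally show ?thesis by simp
qed

lemma skew_ext_commute:
  fixes \<gamma> \<delta> :: "'x \<Rightarrow> ('x list \<Rightarrow>\<^sub>0 'k::field)"
  defines "G \<equiv> hom_ext \<gamma>" and "D \<equiv> skew_ext \<gamma> \<delta>"
  assumes letter: "\<And>u. u \<in> X \<Longrightarrow> G (\<delta> u) = lam \<cdot> D (\<gamma> u)" and f: "f \<in> formal_sums (words X)"
  shows "G (D f) = lam \<cdot> D (G f)"
proof -
  have word: "G (D (mon w 1)) = lam \<cdot> D (G (mon w 1))" if "set w \<subseteq> X" for w
    using that
  proof (induction w)
    case Nil
    show ?case by (simp add: G_def D_def hom_ext_mon skew_ext_mon linmap_zero)
  next
    case (Cons u w)
    have "D (mon [u] 1) = \<delta> u" "G (mon [u] 1) = \<gamma> u"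
      by (simp_all add: G_def D_def hom_ext_mon skew_ext_mon)
    moreover have "D (e \<diamondop> f) = G e \<diamondop> D f + D e \<diamondop> f" "G (e \<diamondop> f) = G e \<diamondop> G f" "G (e + f) = G e + G f" for e f
      by (simp_all add: D_def G_def skew_ext_mult hom_ext_mult linmap_add)
    ultimately show ?case
      unfolding mon_Cons[of u w] using Cons letter[of u] by (simp add: conv_scale)
  qed
  have "linmap (\<lambda>f. G (D f))" "linmap (\<lambda>f. lam \<cdot> D (G f))"
    unfolding G_def D_def by (intro linmap_comp[OF linmap_hom_ext] linmap_scaled
        linmap_comp[OF linmap_skew_ext] linmap_skew_ext linmap_hom_ext)+
  then show ?thesis
    by (rule linmap_eqI) (use supp_formal_sums[OF f] word in \<open>auto simp: lists_eq_set\<close>)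
qed

section \<open>The automorphisms of quantum matrices\<close>

context quantum_matrices
begin

abbreviation Aut where "Aut \<equiv> alg_Aut Q.B"

text \<open>An invertible endomorphism of the free algebra that respects the ideal in both directions.\<close>

lemma alg_Aut_memI:
  assumes ext: "\<phi> \<in> extensional (carrier Q.B)" and \<phi>: "\<And>f. f \<in> Q.C \<Longrightarrow> \<phi> (Q.cl f) = Q.cl (hom_ext \<gamma> f)"
    and \<gamma>: "\<And>f. f \<in> Q.C \<Longrightarrow> hom_ext \<gamma> f \<in> Q.C"
    and K: "linmap K" "\<And>f. f \<in> Q.C \<Longrightarrow> K f \<in> Q.C" "\<And>f. f \<in> Q.I \<Longrightarrow> K f \<in> Q.I"
    and inverse: "\<And>f. f \<in> Q.C \<Longrightarrow> K (hom_ext \<gamma> f) = f" "\<And>f. f \<in> Q.C \<Longrightarrow> hom_ext \<gamma> (K f) = f"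
  shows "\<phi> \<in> carrier Aut"
proof -
  have "bij_betw \<phi> (carrier Q.B) (carrier Q.B)"
  proof (rule bij_betwI')
    fix a b assume "a \<in> carrier Q.B" "b \<in> carrier Q.B"
    then obtain e f where e: "e \<in> Q.C" "a = Q.cl e" and f: "f \<in> Q.C" "b = Q.cl f" by (metis Q.B_cases)
    show "\<phi> a = \<phi> b \<longleftrightarrow> a = b"
    proof
      assume "\<phi> a = \<phi> b"
      then have "hom_ext \<gamma> (e - f) \<in> Q.I" using e f by (simp add: \<phi> Q.cl_eq_iff linmap_diff)
      from K(3)[OF this] have "e - f \<in> Q.I" using e f by (simp add: inverse)
      then show "a = b" using e f by (simp add: Q.cl_eq_iff)
    qed simp
  next
    fix a assume "a \<in> carrier Q.B"
    then show "\<phi> a \<in> carrier Q.B" by (elim Q.B_cases) (simp add: \<phi> \<gamma>)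
  next
    fix b assume "b \<in> carrier Q.B"
    then obtain f where f: "f \<in> Q.C" "b = Q.cl f" by (elim Q.B_cases)
    then show "\<exists>a\<in>carrier Q.B. b = \<phi> a"
      by (intro bexI[of _ "Q.cl (K f)"]) (simp_all add: \<phi> K inverse)
  qed
  then have "\<phi> \<in> Bij (carrier Q.B)" using ext by (simp add: Bij_def)
  moreover have "\<phi> \<in> Ring.ring_hom Q.B Q.B"
  proof (rule ring_hom_memI)
    fix a b assume "a \<in> carrier Q.B" "b \<in> carrier Q.B"
    then obtain e f where e: "e \<in> Q.C" "a = Q.cl e" and f: "f \<in> Q.C" "b = Q.cl f" by (metis Q.B_cases)
    then show "\<phi> a \<in> carrier Q.B" "\<phi> (a \<otimes>\<^bsub>Q.B\<^esub> b) = \<phi> a \<otimes>\<^bsub>Q.B\<^esub> \<phi> b" "\<phi> (a \<oplus>\<^bsub>Q.B\<^esub> b) = \<phi> a \<oplus>\<^bsub>Q.B\<^esub> \<phi> b"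
      by (simp_all add: \<phi> \<gamma> Q.B_mult Q.B_add hom_ext_mult linmap_add)
  qed (simp add: Q.B_one \<phi> hom_ext_mon)
  moreover have "\<phi> (c \<odot>\<^bsub>Q.B\<^esub> a) = c \<odot>\<^bsub>Q.B\<^esub> \<phi> a" if "a \<in> carrier Q.B" for c a
    using that by (elim Q.B_cases) (simp add: \<phi> Q.B_smult linmap_scale)
  ultimately show ?thesis by (simp add: alg_Aut_def)
qed

abbreviation tau where "tau \<equiv> qmat_transp q N"

lemma tau_cl:
  assumes "f \<in> Q.C"
  shows "tau (Q.cl f) = Q.cl (relabel prod.swap f)"
proof -
  have const: "free_lift Q.B (\<lambda>(i, j). qY q N j i) f' = Q.cl (relabel prod.swap f)" if f': "f' \<in> Q.cl f" for f'
  proof -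
    have "f' - f \<in> Q.I" using f' by (simp add: Q.mem_cl_iff)
    then have in_C: "f' \<in> Q.C" using formal_sums_closed(2)[OF Q.I_sub[OF \<open>f' - f \<in> Q.I\<close>] assms] by simp
    have "relabel prod.swap (f' - f) \<in> Q.I"
      by (rule relabel_I[OF Q.free_relations_axioms relabel_swap_rel _ \<open>f' - f \<in> Q.I\<close>]) (auto simp: square_def)
    then have "Q.cl (relabel prod.swap f') = Q.cl (relabel prod.swap f)"
      by (simp add: Q.cl_eq_iff linmap_diff)
    moreover have "(\<lambda>(i, j). qY q N j i) = (\<lambda>u. Q.cl (mon [prod.swap u] 1))"
      by (auto simp: qY_cl fun_eq_iff)
    moreover have "prod.swap u \<in> square N" if "w \<in> supp f'" "u \<in> set w" for w u
      using supp_formal_sums[OF in_C that(1)] that(2) by (auto simp: in_lists_conv_set square_def)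
    then have "free_lift Q.B (\<lambda>u. Q.cl (mon [prod.swap u] 1)) f' = Q.cl (relabel prod.swap f')"
      unfolding hom_ext_def word_prod_def[abs_def]
      by (intro Q.free_lift_B) simp
    ultimately show ?thesis by simp
  qed
  have "tau (Q.cl f) = (\<Union>f'\<in>Q.cl f. free_lift Q.B (\<lambda>(i, j). qY q N j i) f')"
    using assms by (simp add: qmat_transp_def qmat_B)
  also have "\<dots> = (\<Union>f'\<in>Q.cl f. Q.cl (relabel prod.swap f))"
    by (intro SUP_cong refl const)
  also have "\<dots> = Q.cl (relabel prod.swap f)"
    using Q.cl_self[of f] by (intro UN_constant[THEN trans]) auto
  finally show ?thesis .
qed

lemma relabel_swap_in: "f \<in> Q.C \<Longrightarrow> relabel prod.swap f \<in> Q.C"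
  by (rule hom_ext_in) (auto simp: square_def)

lemma relabel_swap_I: "f \<in> Q.I \<Longrightarrow> relabel prod.swap f \<in> Q.I"
  by (rule relabel_I[OF Q.free_relations_axioms relabel_swap_rel]) (auto simp: square_def)

lemma tau_Aut: "tau \<in> carrier Aut"
  by (rule alg_Aut_memI[where \<gamma> = "\<lambda>u. mon [prod.swap u] 1" and K = "relabel prod.swap"])
    (simp_all add: tau_cl relabel_swap_in relabel_swap_I relabel_relabel, simp add: qmat_transp_def qmat_B)

lemma Aut_sel:
  "one Aut = (\<lambda>a\<in>carrier Q.B. a)"
  "\<phi> \<in> carrier Aut \<Longrightarrow> \<psi> \<in> carrier Aut \<Longrightarrow> \<phi> \<otimes>\<^bsub>Aut\<^esub> \<psi> = compose (carrier Q.B) \<phi> \<psi>"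
  "\<phi> \<in> carrier Aut \<Longrightarrow> \<phi> \<in> extensional (carrier Q.B)"
  "\<phi> \<in> carrier Aut \<Longrightarrow> a \<in> carrier Q.B \<Longrightarrow> \<phi> a \<in> carrier Q.B"
  by (auto simp: alg_Aut_def BijGroup_def Bij_def dest: bij_betwE)

lemma one_Aut: "one Aut \<in> carrier Aut"
proof -
  have id: "hom_ext (\<lambda>u. mon [u] 1) f = f" for f :: "(nat \<times> nat) list \<Rightarrow>\<^sub>0 'k"
    by (rule linmap_eqI[where L = "hom_ext (\<lambda>u. mon [u] 1)" and L' = "\<lambda>f. f"])
      (simp_all add: linmap_ident relabel_mon[of "\<lambda>u. u", simplified])
  show ?thesis
    by (rule alg_Aut_memI[where \<gamma> = "\<lambda>u. mon [u] 1" and K = "\<lambda>f. f"])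
      (simp_all add: Aut_sel(1) id linmap_ident)
qed

lemma tau_tau: "a \<in> carrier Q.B \<Longrightarrow> tau (tau a) = a"
  by (elim Q.B_cases) (simp add: tau_cl relabel_swap_in relabel_relabel)

text \<open>
  The transposition is an involution.
\<close>

lemma generate_tau: "generate Aut {tau} \<subseteq> {one Aut, tau}"
proof
  have ext: "tau \<in> extensional (carrier Q.B)" by (rule Aut_sel(3)[OF tau_Aut])
  have tt: "tau \<otimes>\<^bsub>Aut\<^esub> tau = one Aut"
    using tau_tau by (simp add: Aut_sel tau_Aut compose_def cong: restrict_cong)
  have inv: "inv\<^bsub>Aut\<^esub> tau = tau"
    unfolding m_inv_def
  proof (rule the_equality)
    show "tau \<in> carrier Aut \<and> tau \<otimes>\<^bsub>Aut\<^esub> tau = \<one>\<^bsub>Aut\<^esub> \<and> tau \<otimes>\<^bsub>Aut\<^esub> tau = \<one>\<^bsub>Aut\<^esub>"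
      using tau_Aut tt by simp
    fix y assume y: "y \<in> carrier Aut \<and> tau \<otimes>\<^bsub>Aut\<^esub> y = \<one>\<^bsub>Aut\<^esub> \<and> y \<otimes>\<^bsub>Aut\<^esub> tau = \<one>\<^bsub>Aut\<^esub>"
    show "y = tau"
    proof (rule extensionalityI[OF Aut_sel(3)])
      fix a assume a: "a \<in> carrier Q.B"
      note tau_a = Aut_sel(4)[OF tau_Aut a]
      have "y a = (y \<otimes>\<^bsub>Aut\<^esub> tau) (tau a)"
        unfolding Aut_sel(2)[OF y[THEN conjunct1] tau_Aut] using tau_a tau_tau[OF a] by (simp add: compose_def)
      also have "\<dots> = tau a"
        using y tau_a by (simp add: Aut_sel(1))
      finally show "y a = tau a" .
    qed (use y ext in auto)
  qed
  fix t assume "t \<in> generate Aut {tau}"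
  then show "t \<in> {one Aut, tau}"
  proof (induction rule: generate.induct)
    case (eng s t)
    have "one Aut \<otimes>\<^bsub>Aut\<^esub> \<phi> = \<phi>" "\<phi> \<otimes>\<^bsub>Aut\<^esub> one Aut = \<phi>" if "\<phi> \<in> carrier Aut" for \<phi>
      using that one_Aut Aut_sel(3,4)[OF that] unfolding Aut_sel(2)[OF one_Aut that] Aut_sel(2)[OF that one_Aut]
      by (auto simp: Aut_sel(1) compose_def extensional_def fun_eq_iff)
    with eng tt tau_Aut one_Aut show ?case by auto
  qed (use inv in auto)
qed

lemma rank_product:
  fixes r s :: "nat \<Rightarrow> 'k"
  assumes "N > 0" "r 1 \<noteq> 0" "s 1 \<noteq> 0"
  shows "vec_space.rank N (mat N N (\<lambda>(i, j). r (i + 1) * s (j + 1))) = 1"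
proof -
  let ?M = "mat N N (\<lambda>(i, j). r (i + 1) * s (j + 1))"
  interpret V: vec_space "TYPE('k)" N .
  have le: "V.rank ?M \<le> 1"
    by (rule V.rank_le_1_product_entries[where f = "\<lambda>i. r (i + 1)" and g = "\<lambda>j. s (j + 1)"]) auto
  have ge: "V.rank ?M \<ge> card {col ?M 0}"
  proof (rule V.rank_ge_card_indpt)
    have "col ?M 0 $ 0 = r 1 * s 1" using assms(1) by simp
    then have "col ?M 0 \<noteq> 0\<^sub>v N" using assms by (metis index_zero_vec(1) no_zero_divisors)
    moreover have "V.span {} = {0\<^sub>v N}"
      by (auto simp: V.span_def V.lincomb_def)
    moreover have "V.lin_indpt {}" by (auto simp: V.lin_dep_def)
    moreover have "col ?M 0 \<in> carrier_vec N" by (rule carrier_vecI) simp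
    ultimately show "V.lin_indpt {col ?M 0}"
      using V.lin_dep_iff_in_span[of "{}" "col ?M 0"] by simp
    show "{col ?M 0} \<subseteq> set (cols ?M)" using assms(1) by (simp add: cols_def)
  qed auto
  have "card {col ?M 0} = 1" by simp
  from le ge[unfolded this] show ?thesis by (rule le_antisym)
qed

end

section \<open>Realization of the listed patterns\<close>

context generic_quantum_matrices
begin

lemma compatible_col_right:
  assumes "1 \<le> b" "b < N"
  shows "compatible (mleib (wcol q b) (\<lambda>u. (fst u, Suc b)) (\<lambda>u. if snd u = b then \<delta> else 0))" (is "compatible ?L")
  unfolding compatible_def
proof (intro allI impI conjI)
  note expand = mleib_def nf2_def wcol_def lookup_add lookup_minus lookup_single when_def
  have q: "q * inverse q = 1" "q * (inverse q * x) = x" "inverse q * (q * x) = x" for x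
    using q_nonzero by simp_all
  fix i j k l :: nat
  show "?L (i, j) (k, l) = q \<cdot> ?L (k, l) (i, j)" if "i < k \<and> j = l \<or> i = k \<and> j < l"
  proof -
    from that consider (col) "i < k" "j = l" | (row) "i = k" "j < l" by blast
    then show ?thesis
    proof cases
      case col
      then show ?thesis
        by (cases "j = b") (rule poly_mapping_eqI; auto simp: expand q algebra_simps split: if_splits)+
    next
      case row
      then consider "j = b" "l = Suc b" | "j = b" "Suc b < l" | "l = b" | "j \<noteq> b" "l \<noteq> b" by linarith
      then show ?thesis
        using row by cases (rule poly_mapping_eqI; auto simp: expand q algebra_simps split: if_splits)+
    qed
  qed
  show "?L (i, j) (k, l) = ?L (k, l) (i, j)" if "i < k \<and> l < j"
  proof -
    from that have "l < j" by simp
    then consider "j = b" | "l = b" "j = Suc b" | "l = b" "Suc b < j" | "j \<noteq> b" "l \<noteq> b"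
      by (cases "j = b"; cases "l = b"; cases "j = Suc b") auto
    then show ?thesis
      using that by cases (rule poly_mapping_eqI; auto simp: expand q algebra_simps split: if_splits)+
  qed
  show "?L (i, j) (k, l) = ?L (k, l) (i, j) + (q - inverse q) \<cdot> ?L (i, l) (k, j)" if "i < k \<and> j < l"
  proof -
    from that have "j < l" by simp
    then consider "l = b" | "j = b" "l = Suc b" | "j = b" "Suc b < l" | "j \<noteq> b" "l \<noteq> b"
      by (cases "j = b"; cases "l = b"; cases "l = Suc b") auto
    then show ?thesis
      using that by cases (rule poly_mapping_eqI; auto simp: expand q algebra_simps split: if_splits)+
  qed
qed

lemma compatible_top:
  shows "compatible (mleib (wtop q N) (\<lambda>u. (1, N)) (\<lambda>u. if u = (1, 1) then \<delta> else 0))" (is "compatible ?L")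
  unfolding compatible_def
proof (intro allI impI conjI)
  note expand = mleib_def nf2_def wtop_def lookup_add lookup_minus lookup_single when_def power2_eq_square
  have q: "q * inverse q = 1" "q * (inverse q * x) = x" "inverse q * (q * x) = x" for x
    using q_nonzero by simp_all
  have N: "Suc 0 < N" "N \<noteq> Suc 0" "Suc 0 \<noteq> N" using N_ge by auto
  fix i j k l :: nat assume in_N: "{i, j, k, l} \<subseteq> {1..N}"
  show "?L (i, j) (k, l) = q \<cdot> ?L (k, l) (i, j)" if "i < k \<and> j = l \<or> i = k \<and> j < l"
  proof (cases "(i, j) = (1, 1)")
    case True
    with that consider "i = 1" "j = 1" "1 < k" "l = 1" | "i = 1" "j = 1" "k = 1" "l = N"
      | "i = 1" "j = 1" "k = 1" "1 < l" "l < N" using in_N by fastforce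
    then show ?thesis
      using N by cases (rule poly_mapping_eqI; auto simp: expand q algebra_simps split: if_splits)+
  next
    case False
    then have "(k, l) \<noteq> (1, 1)" using that in_N by auto
    with False show ?thesis by (auto simp: mleib_def)
  qed
  show "?L (i, j) (k, l) = ?L (k, l) (i, j)" if "i < k \<and> l < j"
  proof -
    have "(i, j) \<noteq> (1, 1)" "(k, l) \<noteq> (1, 1)" using that in_N by auto
    then show ?thesis by (auto simp: mleib_def)
  qed
  show "?L (i, j) (k, l) = ?L (k, l) (i, j) + (q - inverse q) \<cdot> ?L (i, l) (k, j)" if "i < k \<and> j < l"
  proof (cases "(i, j) = (1, 1)")
    case True
    with that consider "i = 1" "j = 1" "1 < k" "l = N" | "i = 1" "j = 1" "1 < k" "1 < l" "l < N"
      using in_N by fastforce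
    then show ?thesis
      using N by cases (rule poly_mapping_eqI; auto simp: expand q algebra_simps split: if_splits)+
  next
    case False
    then have "(k, l) \<noteq> (1, 1)" "(i, l) \<noteq> (1, 1)" "(k, j) \<noteq> (1, 1)" using that in_N by auto
    with False show ?thesis by (auto simp: mleib_def)
  qed
qed

lemma rank_one_product:
  assumes "\<And>u. u \<in> square N \<Longrightarrow> \<alpha> u = r (fst u) * s (snd u)" "\<And>u. u \<in> square N \<Longrightarrow> \<alpha> u \<noteq> 0"
  shows "rank_one_weights \<alpha>"
  unfolding rank_one_weights_def
proof (intro conjI ballI allI impI)
  fix i j k l assume "{i, j, k, l} \<subseteq> {1..N}"
  then show "\<alpha> (i, j) * \<alpha> (k, l) = \<alpha> (i, l) * \<alpha> (k, j)"
    by (simp add: assms(1) mult_ac)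
qed (rule assms(2))

lemma stable_cong:
  assumes "\<And>u. u \<in> square N \<Longrightarrow> \<gamma> u = \<gamma>' u \<and> \<delta> u = \<delta>' u" "stable \<gamma> \<delta>"
  shows "stable \<gamma>' \<delta>'"
proof -
  have "skew_word \<gamma> \<delta> w = skew_word \<gamma>' \<delta>' w" if "set w \<subseteq> square N" for w
    using that by (induction w) (simp_all add: assms(1))
  then have "skew_ext \<gamma> \<delta> f = skew_ext \<gamma>' \<delta>' f" if "f \<in> Q.C" for f
    unfolding skew_ext_def using supp_formal_sums[OF that] by (intro lin_cong) (auto simp: lists_eq_set)
  then show ?thesis using assms(2) Q.I_sub unfolding stable_def by auto
qed

text \<open>
  The data from which an action is built: \<open>x\<close> sends \<open>Y\<^sub>u\<close> to \<open>d u\<close> times \<open>Y\<^bsub>\<sigma> u\<^esub>\<close>. The weights are powers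
  of \<open>q\<close> so that \<open>q\<^sup>n = 1\<close> implies \<open>g\<^sup>n = 1\<close>, and \<open>x\<^sup>2\<close> kills the generators, as the proof of \<open>x\<^sup>m = 0\<close> requires.
\<close>

definition realized :: "'k \<Rightarrow> (nat \<times> nat \<Rightarrow> 'k) \<Rightarrow> ((nat \<times> nat) \<times> (nat \<times> nat)) set \<Rightarrow> 'k \<Rightarrow>
    (nat \<times> nat \<Rightarrow> nat \<times> nat) \<Rightarrow> (nat \<times> nat \<Rightarrow> 'k) \<Rightarrow> bool" where
  "realized lam \<alpha> S \<delta> \<sigma> d \<longleftrightarrow>
     stable (\<lambda>u. mon [u] (\<alpha> u)) (\<lambda>u. mon [\<sigma> u] (d u)) \<and>
     (\<exists>r s. (\<forall>u\<in>square N. \<alpha> u = r (fst u) * s (snd u))) \<and>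
     (\<forall>u\<in>square N. \<exists>k::int. \<alpha> u = q powi k) \<and>
     (\<forall>u\<in>square N. d u \<noteq> 0 \<longrightarrow> \<sigma> u \<in> square N \<and> \<alpha> (\<sigma> u) = lam * \<alpha> u \<and> d (\<sigma> u) = 0) \<and>
     (\<exists>u\<in>square N. d u \<noteq> 0) \<and>
     (\<forall>u\<in>square N. \<forall>w\<in>square N. (u, w) \<in> S \<longleftrightarrow> w = \<sigma> u \<and> d u \<noteq> 0) \<and>
     (\<forall>u\<in>square N. d u \<noteq> 0 \<longrightarrow> d u = \<delta>)"

lemma weights_facts:
  "\<exists>r s. \<forall>u. wcol q b u = r (fst u) * s (snd u)" "\<exists>r s. \<forall>u. wtop q N u = r (fst u) * s (snd u)"
  "\<exists>r s. \<forall>u. wbot q N u = r (fst u) * s (snd u)"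
  "\<exists>k::int. wcol q b u = q powi k" "\<exists>k::int. wtop q N u = q powi k" "\<exists>k::int. wbot q N u = q powi k"
proof -
  show "\<exists>r s. \<forall>u. wcol q b u = r (fst u) * s (snd u)"
    by (rule exI[of _ "\<lambda>_. 1"], rule exI[of _ "\<lambda>j. if j = b then q else if j = Suc b then inverse q else 1"])
      (simp add: wcol_def)
  show "\<exists>r s. \<forall>u. wtop q N u = r (fst u) * s (snd u)"
    by (rule exI[of _ "\<lambda>i. if i = 1 then inverse (q ^ 2) else 1"],
        rule exI[of _ "\<lambda>j. if j = 1 then inverse q else if j = N then q else 1"]) (simp add: wtop_def)
  show "\<exists>r s. \<forall>u. wbot q N u = r (fst u) * s (snd u)"
    by (rule exI[of _ "\<lambda>i. if i = N then q ^ 2 else 1"],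
        rule exI[of _ "\<lambda>j. if j = 1 then inverse q else if j = N then q else 1"]) (simp add: wbot_def)
  define pow where "pow x \<longleftrightarrow> (\<exists>k::int. x = q powi k)" for x
  have mult: "pow (x * y)" if "pow x" "pow y" for x y
    using that q_nonzero unfolding pow_def by (metis power_int_add)
  have "q = q powi 1" "inverse q = q powi (-1)" "1 = q powi 0" "q ^ 2 = q powi 2" "inverse (q ^ 2) = q powi (-2)"
    by (simp_all add: power_int_minus)
  then have base: "pow q" "pow (inverse q)" "pow 1" "pow (q ^ 2)" "pow (inverse (q ^ 2))"
    unfolding pow_def by blast+
  have "pow (wcol q b u)" "pow (wtop q N u)" "pow (wbot q N u)"
    unfolding wcol_def wtop_def wbot_def by (auto intro!: mult base simp del: mult_1_left mult_1_right)
  then show "\<exists>k::int. wcol q b u = q powi k" "\<exists>k::int. wtop q N u = q powi k" "\<exists>k::int. wbot q N u = q powi k"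
    unfolding pow_def by blast+
qed

lemma realized_swap:
  assumes "realized lam \<alpha> S \<delta> \<sigma> d"
  shows "realized lam (\<alpha> \<circ> prod.swap) (transpose_pairs S) \<delta> (prod.swap \<circ> \<sigma> \<circ> prod.swap) (d \<circ> prod.swap)"
proof -
  let ?s = "prod.swap :: nat \<times> nat \<Rightarrow> nat \<times> nat"
  have sq: "?s u \<in> square N \<longleftrightarrow> u \<in> square N" for u by (cases u) (auto simp: square_def)
  have mem: "(u, w) \<in> transpose_pairs S \<longleftrightarrow> (?s u, ?s w) \<in> S" for u w
  proof
    assume "(?s u, ?s w) \<in> S"
    then show "(u, w) \<in> transpose_pairs S" by (rule image_eqI[rotated]) simp
  qed auto
  have flip: "?s w = v \<longleftrightarrow> w = ?s v" for w v by auto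
  obtain r s where rs: "\<forall>u\<in>square N. \<alpha> u = r (fst u) * s (snd u)"
    using assms unfolding realized_def by blast
  obtain u where u: "u \<in> square N" "d u \<noteq> 0"
    using assms unfolding realized_def by blast
  show ?thesis
    unfolding realized_def
  proof (intro conjI)
    have "stable (\<lambda>u. mon [u] (\<alpha> u)) (\<lambda>u. mon [\<sigma> u] (d u))" using assms by (simp add: realized_def)
    from stable_swap[OF this]
    show "stable (\<lambda>u. mon [u] ((\<alpha> \<circ> ?s) u)) (\<lambda>u. mon [(?s \<circ> \<sigma> \<circ> ?s) u] ((d \<circ> ?s) u))"
      by (simp add: relabel_mon)
    show "\<exists>r s. \<forall>u\<in>square N. (\<alpha> \<circ> ?s) u = r (fst u) * s (snd u)"
      by (rule exI[of _ s], rule exI[of _ r]) (use rs sq in \<open>simp add: mult.commute\<close>)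
    show "\<forall>u\<in>square N. \<exists>k. (\<alpha> \<circ> ?s) u = q powi k"
      using assms sq by (simp add: realized_def)
    show "\<forall>u\<in>square N. (d \<circ> ?s) u \<noteq> 0 \<longrightarrow> (?s \<circ> \<sigma> \<circ> ?s) u \<in> square N \<and>
        (\<alpha> \<circ> ?s) ((?s \<circ> \<sigma> \<circ> ?s) u) = lam * (\<alpha> \<circ> ?s) u \<and> (d \<circ> ?s) ((?s \<circ> \<sigma> \<circ> ?s) u) = 0"
      using assms sq by (simp add: realized_def)
    show "\<exists>u\<in>square N. (d \<circ> ?s) u \<noteq> 0"
      using u sq by (intro bexI[of _ "?s u"]) simp_all
    show "\<forall>u\<in>square N. \<forall>w\<in>square N. ((u, w) \<in> transpose_pairs S) = (w = (?s \<circ> \<sigma> \<circ> ?s) u \<and> (d \<circ> ?s) u \<noteq> 0)"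
      using assms sq flip by (simp add: realized_def mem)
    show "\<forall>u\<in>square N. (d \<circ> ?s) u \<noteq> 0 \<longrightarrow> (d \<circ> ?s) u = \<delta>"
      using assms sq by (simp add: realized_def)
  qed
qed

lemma realized_right:
  assumes "1 \<le> b" "b < N" "\<delta> \<noteq> 0"
  shows "realized (inverse (q ^ 2)) (wcol q b) ((\<lambda>a. ((a, b), (a, Suc b))) ` {1..N}) \<delta>
    (\<lambda>u. (fst u, Suc b)) (\<lambda>u. if snd u = b then \<delta> else 0)"
proof -
  obtain r s where rs: "\<forall>u. wcol q b u = r (fst u) * s (snd u)" using weights_facts(1) by blast
  have nz: "wcol q b u \<noteq> 0" for u using q_nonzero by (simp add: wcol_def)
  have rank: "rank_one_weights (wcol q b)" by (rule rank_one_product[of _ r s]) (use rs nz in auto)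
  have stable: "stable (\<lambda>u. mon [u] (wcol q b u)) (\<lambda>u. mon [(fst u, Suc b)] (if snd u = b then \<delta> else 0))"
    by (rule monomial_stable[OF rank compatible_col_right[OF assms(1,2)]]) (use assms in \<open>auto simp: square_def\<close>)
  show ?thesis
    unfolding realized_def
  proof (intro conjI stable)
    show "\<exists>r s. \<forall>u\<in>square N. wcol q b u = r (fst u) * s (snd u)" using rs by blast
    show "\<forall>u\<in>square N. \<exists>k. wcol q b u = q powi k" using weights_facts(4) by blast
    show "\<exists>u\<in>square N. (if snd u = b then \<delta> else 0) \<noteq> 0"
      using assms by (intro bexI[of _ "(1, b)"]) auto
    show "\<forall>u\<in>square N. (if snd u = b then \<delta> else 0) \<noteq> 0 \<longrightarrow> (fst u, Suc b) \<in> square N \<and>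
        wcol q b (fst u, Suc b) = inverse (q ^ 2) * wcol q b u \<and> (if snd (fst u, Suc b) = b then \<delta> else 0) = 0"
      using assms q_nonzero by (auto simp: square_def wcol_def power2_eq_square)
    show "\<forall>u\<in>square N. \<forall>w\<in>square N. ((u, w) \<in> (\<lambda>a. ((a, b), (a, Suc b))) ` {1..N})
        = (w = (fst u, Suc b) \<and> (if snd u = b then \<delta> else 0) \<noteq> 0)"
      using assms by (auto simp: square_def)
  qed simp
qed

lemma realized_top:
  assumes "\<delta> \<noteq> 0"
  shows "realized (q ^ 2) (wtop q N) {((1, 1), (1, N))} \<delta> (\<lambda>u. (1, N)) (\<lambda>u. if u = (1, 1) then \<delta> else 0)"
proof -
  obtain r s where rs: "\<forall>u. wtop q N u = r (fst u) * s (snd u)" using weights_facts(2) by blast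
  have nz: "wtop q N u \<noteq> 0" for u using q_nonzero by (simp add: wtop_def)
  have rank: "rank_one_weights (wtop q N)" by (rule rank_one_product[of _ r s]) (use rs nz in auto)
  have stable: "stable (\<lambda>u. mon [u] (wtop q N u)) (\<lambda>u. mon [(1, N)] (if u = (1, 1) then \<delta> else 0))"
    by (rule monomial_stable[OF rank compatible_top]) (use N_ge in auto)
  show ?thesis
    unfolding realized_def
  proof (intro conjI stable)
    show "\<exists>r s. \<forall>u\<in>square N. wtop q N u = r (fst u) * s (snd u)" using rs by blast
    show "\<forall>u\<in>square N. \<exists>k. wtop q N u = q powi k" using weights_facts(5) by blast
    show "\<exists>u\<in>square N. (if u = (1, 1) then \<delta> else 0) \<noteq> 0"
      using assms N_ge by (intro bexI[of _ "(1, 1)"]) auto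
    have N: "N \<noteq> Suc 0" "Suc 0 \<noteq> N" using N_ge by auto
    show "\<forall>u\<in>square N. (if u = (1, 1) then \<delta> else 0) \<noteq> 0 \<longrightarrow> (1, N) \<in> square N \<and>
        wtop q N (1, N) = q ^ 2 * wtop q N u \<and> (if (1, N) = (1, 1::nat) then \<delta> else 0) = 0"
      using N_ge q_nonzero N by (auto simp: wtop_def power2_eq_square)
    show "\<forall>u\<in>square N. \<forall>w\<in>square N. ((u, w) \<in> {((1, 1), (1, N))}) = (w = (1, N) \<and> (if u = (1, 1) then \<delta> else 0) \<noteq> 0)"
      using assms by auto
  qed simp
qed

text \<open>Reversal transports realizations from \<open>q\<^sup>-\<^sup>1\<close> to \<open>q\<close>.\<close>

lemma realized_rev:
  assumes "generic_quantum_matrices.realized (inverse q) N lam \<alpha>' S' \<delta> \<sigma>' d'"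
    and \<alpha>: "\<And>u. u \<in> square N \<Longrightarrow> \<alpha> u = \<alpha>' (rev_index N u)" and powers: "\<And>u. \<exists>k::int. \<alpha> u = q powi k"
    and rs: "\<exists>r s. \<forall>u. \<alpha> u = r (fst u) * s (snd u)"
    and S: "\<And>u w. u \<in> square N \<Longrightarrow> w \<in> square N \<Longrightarrow> (u, w) \<in> S \<longleftrightarrow> (rev_index N u, rev_index N w) \<in> S'"
  shows "realized lam \<alpha> S \<delta> (rev_index N \<circ> \<sigma>' \<circ> rev_index N) (d' \<circ> rev_index N)"
proof -
  let ?r = "rev_index N"
  interpret inv: generic_quantum_matrices "inverse q" N
    using q_nonzero q_square N_ge by unfold_locales (auto simp: power_inverse)
  have flip: "?r w = v \<longleftrightarrow> w = ?r v" for w v by (metis rev_index_rev)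
  obtain u where u: "u \<in> square N" "d' u \<noteq> 0"
    using assms(1) unfolding inv.realized_def by blast
  show ?thesis
    unfolding realized_def
  proof (intro conjI)
    have "inv.stable (\<lambda>u. mon [u] (\<alpha>' u)) (\<lambda>u. mon [\<sigma>' u] (d' u))" using assms(1) by (simp add: inv.realized_def)
    from stable_rev[OF this]
    have "stable (\<lambda>u. mon [u] (\<alpha>' (?r u))) (\<lambda>u. mon [(?r \<circ> \<sigma>' \<circ> ?r) u] ((d' \<circ> ?r) u))"
      by (simp add: relabel_mon)
    then show "stable (\<lambda>u. mon [u] (\<alpha> u)) (\<lambda>u. mon [(?r \<circ> \<sigma>' \<circ> ?r) u] ((d' \<circ> ?r) u))"
      by (rule stable_cong[rotated]) (simp add: \<alpha>)
    show "\<exists>r s. \<forall>u\<in>square N. \<alpha> u = r (fst u) * s (snd u)" using rs by blast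
    show "\<forall>u\<in>square N. \<exists>k. \<alpha> u = q powi k" using powers by blast
    show "\<forall>u\<in>square N. (d' \<circ> ?r) u \<noteq> 0 \<longrightarrow> (?r \<circ> \<sigma>' \<circ> ?r) u \<in> square N \<and>
        \<alpha> ((?r \<circ> \<sigma>' \<circ> ?r) u) = lam * \<alpha> u \<and> (d' \<circ> ?r) ((?r \<circ> \<sigma>' \<circ> ?r) u) = 0"
      using assms(1) by (simp add: inv.realized_def \<alpha>)
    show "\<exists>u\<in>square N. (d' \<circ> ?r) u \<noteq> 0"
      using u by (intro bexI[of _ "?r u"]) simp_all
    show "\<forall>u\<in>square N. \<forall>w\<in>square N. ((u, w) \<in> S) = (w = (?r \<circ> \<sigma>' \<circ> ?r) u \<and> (d' \<circ> ?r) u \<noteq> 0)"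
      using assms(1) flip by (simp add: inv.realized_def S)
    show "\<forall>u\<in>square N. (d' \<circ> ?r) u \<noteq> 0 \<longrightarrow> (d' \<circ> ?r) u = \<delta>"
      using assms(1) by (simp add: inv.realized_def)
  qed
qed

lemma realized_left:
  assumes "1 \<le> b" "b < N" "\<delta> \<noteq> 0"
  shows "\<exists>\<sigma> d. realized (q ^ 2) (wcol q b) ((\<lambda>a. ((a, Suc b), (a, b))) ` {1..N}) \<delta> \<sigma> d"
proof -
  interpret inv: generic_quantum_matrices "inverse q" N
    using q_nonzero q_square N_ge by unfold_locales (auto simp: power_inverse)
  have b: "1 \<le> N - b" "N - b < N" "Suc N - b = Suc (N - b)" "Suc N - Suc b = N - b" using assms by auto
  have eq: "inverse (inverse q ^ 2) = q ^ 2" by (simp add: power_inverse)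
  have flip: "Suc N - j = N - b \<longleftrightarrow> j = Suc b" "Suc N - j = Suc (N - b) \<longleftrightarrow> j = b" if "j \<in> {1..N}" for j
    using that assms by auto
  have "realized (q ^ 2) (wcol q b) ((\<lambda>a. ((a, Suc b), (a, b))) ` {1..N}) \<delta>
      (rev_index N \<circ> (\<lambda>u. (fst u, Suc (N - b))) \<circ> rev_index N) ((\<lambda>u. if snd u = N - b then \<delta> else 0) \<circ> rev_index N)"
  proof (rule realized_rev[OF inv.realized_right[OF b(1,2) assms(3), unfolded eq] _ weights_facts(4,1)])
    fix u w assume "u \<in> square N" "w \<in> square N"
    then obtain i j k l where u: "u = (i, j)" "i \<in> {1..N}" "j \<in> {1..N}" and w: "w = (k, l)" "k \<in> {1..N}" "l \<in> {1..N}"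
      by (auto simp: square_def)
    show "wcol q b u = wcol (inverse q) (N - b) (rev_index N u)"
      using u flip[OF u(3)] by (simp add: wcol_def rev_index_def)
    have left: "(u, w) \<in> (\<lambda>a. ((a, Suc b), (a, b))) ` {1..N} \<longleftrightarrow> i = k \<and> j = Suc b \<and> l = b"
      using u w by auto
    have "Suc N - i \<in> {1..N}" "Suc N - k \<in> {1..N}" using u w by auto
    moreover have "rev_index N u = (Suc N - i, Suc N - j)" "rev_index N w = (Suc N - k, Suc N - l)"
      using u w by (simp_all add: rev_index_def)
    ultimately have "(rev_index N u, rev_index N w) \<in> (\<lambda>a. ((a, N - b), (a, Suc (N - b)))) ` {1..N}
        \<longleftrightarrow> Suc N - i = Suc N - k \<and> Suc N - j = N - b \<and> Suc N - l = Suc (N - b)"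
      by (simp only: image_iff prod.inject) metis
    then show "((u, w) \<in> (\<lambda>a. ((a, Suc b), (a, b))) ` {1..N})
        = ((rev_index N u, rev_index N w) \<in> (\<lambda>a. ((a, N - b), (a, Suc (N - b)))) ` {1..N})"
      unfolding left using u w flip by auto
  qed
  then show ?thesis by blast
qed

lemma realized_bottom:
  assumes "\<delta> \<noteq> 0"
  shows "\<exists>\<sigma> d. realized (inverse (q ^ 2)) (wbot q N) {((N, N), (N, 1))} \<delta> \<sigma> d"
proof -
  interpret inv: generic_quantum_matrices "inverse q" N
    using q_nonzero q_square N_ge by unfold_locales (auto simp: power_inverse)
  have eq: "inverse q ^ 2 = inverse (q ^ 2)" by (simp add: power_inverse)
  have flip: "Suc N - j = Suc 0 \<longleftrightarrow> j = N" "Suc N - j = N \<longleftrightarrow> j = Suc 0" if "j \<in> {1..N}" for j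
    using that by auto
  have "realized (inverse (q ^ 2)) (wbot q N) {((N, N), (N, 1))} \<delta>
      (rev_index N \<circ> (\<lambda>u. (1, N)) \<circ> rev_index N) ((\<lambda>u. if u = (1, 1) then \<delta> else 0) \<circ> rev_index N)"
  proof (rule realized_rev[OF inv.realized_top[OF assms, unfolded eq] _ weights_facts(6,3)])
    fix u w assume "u \<in> square N" "w \<in> square N"
    then obtain i j k l where u: "u = (i, j)" "i \<in> {1..N}" "j \<in> {1..N}" and w: "w = (k, l)" "k \<in> {1..N}" "l \<in> {1..N}"
      by (auto simp: square_def)
    show "wbot q N u = wtop (inverse q) N (rev_index N u)"
      using u flip N_ge by (auto simp: wbot_def wtop_def rev_index_def power_inverse)
    show "((u, w) \<in> {((N, N), (N, 1))}) = ((rev_index N u, rev_index N w) \<in> {((1, 1), (1, N))})"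
      using u w flip by (auto simp: rev_index_def)
  qed
  then show ?thesis by blast
qed

lemma pattern_realized:
  assumes "pattern lam \<alpha> S" "\<delta> \<noteq> 0"
  obtains \<alpha>' \<sigma> d where "realized lam \<alpha>' S \<delta> \<sigma> d" "\<And>u. u \<in> square N \<Longrightarrow> \<alpha> u = \<alpha>' u"
proof -
  have col: "\<exists>\<alpha>' \<sigma> d. realized lam \<alpha>' S \<delta> \<sigma> d \<and> (\<forall>u\<in>square N. \<alpha> u = \<alpha>' u)" if c: "col_pattern lam \<alpha> S" for \<alpha> S
  proof -
    from c consider
      (right) b where "1 \<le> b" "b < N" "\<forall>u\<in>square N. \<alpha> u = wcol q b u" "lam = inverse (q ^ 2)"
        "S = (\<lambda>a. ((a, b), (a, Suc b))) ` {1..N}"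
    | (left) b where "1 \<le> b" "b < N" "\<forall>u\<in>square N. \<alpha> u = wcol q b u" "lam = q ^ 2"
        "S = (\<lambda>a. ((a, Suc b), (a, b))) ` {1..N}"
    | (top) "\<forall>u\<in>square N. \<alpha> u = wtop q N u" "lam = q ^ 2" "S = {((1, 1), (1, N))}"
    | (bottom) "\<forall>u\<in>square N. \<alpha> u = wbot q N u" "lam = inverse (q ^ 2)" "S = {((N, N), (N, 1))}"
      unfolding col_pattern_def by blast
    then show ?thesis
    proof cases
      case (right b)
      from realized_right[OF right(1,2) assms(2)] right(3) show ?thesis unfolding right(4,5) by blast
    next
      case (left b)
      from realized_left[OF left(1,2) assms(2)] left(3) show ?thesis unfolding left(4,5) by blast
    next
      case top
      from realized_top[OF assms(2)] top(1) show ?thesis unfolding top(2,3) by blast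
    next
      case bottom
      from realized_bottom[OF assms(2)] bottom(1) show ?thesis unfolding bottom(2,3) by blast
    qed
  qed
  show thesis
  proof (cases "col_pattern lam \<alpha> S")
    case True
    from col[OF this] that show thesis by blast
  next
    case False
    then have "col_pattern lam (\<alpha> \<circ> prod.swap) (transpose_pairs S)" using assms(1) unfolding pattern_def by blast
    from col[OF this] obtain \<alpha>' \<sigma> d where r: "realized lam \<alpha>' (transpose_pairs S) \<delta> \<sigma> d"
      and \<alpha>: "\<forall>u\<in>square N. (\<alpha> \<circ> prod.swap) u = \<alpha>' u" by blast
    have "\<alpha> u = (\<alpha>' \<circ> prod.swap) u" if "u \<in> square N" for u
      using \<alpha>[rule_format, of "prod.swap u"] that by (auto simp: square_def)
    from that[OF realized_swap[OF r, unfolded transpose_pairs_twice] this] show thesis .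
  qed
qed

end

section \<open>Linear Taft actions\<close>

lemma linmap_funpow:
  fixes L :: "('a \<Rightarrow>\<^sub>0 'k::field) \<Rightarrow> ('a \<Rightarrow>\<^sub>0 'k)"
  shows "linmap L \<Longrightarrow> linmap (L ^^ k)"
  by (induction k) (simp_all add: linmap_def)

context quantum_matrices
begin

lemma linear_form_add: "linear_form c + linear_form d = linear_form (\<lambda>w. c w + d w)"
  by (simp add: linear_form_def sum.distrib single_add)

lemma linear_form_scale: "a \<cdot> linear_form c = linear_form (\<lambda>w. a * c w)"
  by (simp add: linear_form_def scale_sum)

lemma linear_form_cong: "(\<And>w. w \<in> square N \<Longrightarrow> c w = d w) \<Longrightarrow> linear_form c = linear_form d"
  by (simp add: linear_form_def)

lemma linear_form_zero: "linear_form (\<lambda>w. 0) = 0"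
  by (simp add: linear_form_def)

lemma lsubspace_linear_forms: "lsubspace (range linear_form)"
  unfolding lsubspace_def
proof (intro conjI ballI allI)
  show "0 \<in> range linear_form" using linear_form_zero by (metis rangeI)
qed (auto simp: linear_form_add linear_form_scale)

lemma mon_linear_form: "u \<in> square N \<Longrightarrow> mon [u] d \<in> range linear_form"
  by (metis linear_form_single rangeI)

lemma qY_span_linear_forms: "qY_span q N = range (\<lambda>c. Q.cl (linear_form c))"
proof -
  have "(\<Oplus>\<^bsub>qmat q N\<^esub>u\<in>{1..N} \<times> {1..N}. c u \<odot>\<^bsub>qmat q N\<^esub> qY q N (fst u) (snd u)) = Q.cl (linear_form c)" for c
  proof -
    have "(\<Oplus>\<^bsub>Q.B\<^esub>u\<in>square N. Q.cl (mon [u] (c u))) = Q.cl (linear_form c)"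
      unfolding linear_form_def by (rule Q.B_finsum) auto
    then show ?thesis
      by (simp only: qmat_B qY_cl prod.collapse Q.B_smult scale_mon mult_1_right flip: square_def)
  qed
  then show ?thesis unfolding qY_span_def by (simp add: full_SetCompr_eq)
qed

lemma word_prod_weights: "word_prod (\<lambda>u. mon [u] (\<alpha> u)) w = mon w (prod_list (map \<alpha> w))"
  by (induction w) (simp_all add: conv_mon)

lemma weights_power:
  assumes "\<And>u. u \<in> square N \<Longrightarrow> \<alpha> u ^ n = 1" "f \<in> Q.C"
  shows "(hom_ext (\<lambda>u. mon [u] (\<alpha> u)) ^^ n) f = f"
proof -
  let ?G = "hom_ext (\<lambda>u. mon [u] (\<alpha> u))"
  have "(?G ^^ k) (mon w 1) = mon w (prod_list (map \<alpha> w) ^ k)" for w k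
    by (induction k) (simp_all add: hom_ext_mon word_prod_weights mult.commute)
  moreover have "prod_list (map \<alpha> w) ^ n = 1" if "set w \<subseteq> square N" for w
    using that by (induction w) (simp_all add: power_mult_distrib assms(1))
  ultimately have word: "(?G ^^ n) (mon w 1) = mon w 1" if "set w \<subseteq> square N" for w
    using that by simp
  have "linmap (?G ^^ n)" by (rule linmap_funpow[OF linmap_hom_ext])
  then show ?thesis
    by (rule linmap_eqI[where L = "?G ^^ n" and L' = "\<lambda>f. f", OF _ linmap_ident])
      (use word supp_formal_sums[OF assms(2)] in \<open>simp add: lists_eq_set\<close>)
qed

lemma torus_memI:
  assumes \<phi>: "\<phi> \<in> carrier Aut" and r: "\<And>i. i \<in> {1..N} \<Longrightarrow> r i \<noteq> 0" and s: "\<And>i. i \<in> {1..N} \<Longrightarrow> s i \<noteq> 0"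
    and "N > 0" and gen: "\<And>u. u \<in> square N \<Longrightarrow> \<phi> (Q.cl (mon [u] 1)) = Q.cl (mon [u] (r (fst u) * s (snd u)))"
  shows "\<phi> \<in> qmat_torus_transp q N"
proof -
  have "\<phi> \<in> qmat_torus q N"
    unfolding qmat_torus_def qmat_B
  proof (intro CollectI conjI exI[of _ "\<lambda>i j. r i * s j"] ballI \<phi>)
    show "vec_space.rank N (mat N N (\<lambda>(i, j). r (i + 1) * s (j + 1))) = 1"
      using assms(4) r s by (intro rank_product) auto
  qed (use r s gen in \<open>auto simp: qY_cl Q.B_smult\<close>)
  moreover have "\<phi> = \<phi> \<otimes>\<^bsub>Aut\<^esub> one Aut"
    using Aut_sel(3,4)[OF \<phi>] unfolding Aut_sel(2)[OF \<phi> one_Aut]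
    by (auto simp: Aut_sel(1) compose_def extensional_def fun_eq_iff)
  ultimately show ?thesis
    unfolding qmat_torus_transp_def set_mult_def qmat_B using generate.one[of Aut "{tau}"] by blast
qed

text \<open>
  Both a torus element and \<open>1\<close> or \<open>\<tau>\<close> permute the generators up to scalars.
\<close>

lemma torus_transpE:
  assumes "\<phi> \<in> qmat_torus_transp q N"
  obtains \<pi> \<alpha> where "\<pi> = id \<or> \<pi> = prod.swap" "\<And>u. u \<in> square N \<Longrightarrow> \<alpha> u \<noteq> 0"
    "\<And>u. u \<in> square N \<Longrightarrow> \<phi> (Q.cl (mon [u] 1)) = Q.cl (mon [\<pi> u] (\<alpha> u))"
proof -
  obtain h t where h: "h \<in> qmat_torus q N" and t: "t \<in> {one Aut, tau}" and \<phi>: "\<phi> = h \<otimes>\<^bsub>Aut\<^esub> t"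
    using assms generate_tau unfolding qmat_torus_transp_def set_mult_def qmat_B by blast
  from h obtain \<beta> where h_Aut: "h \<in> carrier Aut" and \<beta>': "\<forall>i\<in>{1..N}. \<forall>j\<in>{1..N}.
      \<beta> i j \<noteq> 0 \<and> h (Q.cl (mon [(i, j)] 1)) = Q.cl (\<beta> i j \<cdot> mon [(i, j)] 1)"
    unfolding qmat_torus_def qmat_B qY_cl Q.B_smult by blast
  have \<beta>: "\<beta> i j \<noteq> 0 \<and> h (Q.cl (mon [(i, j)] 1)) = Q.cl (mon [(i, j)] (\<beta> i j))" if "(i, j) \<in> square N" for i j
    using \<beta>'[rule_format, of i j] that by simp
  have t_Aut: "t \<in> carrier Aut" using t one_Aut tau_Aut by auto
  define \<pi> where "\<pi> = (if t = one Aut then id else prod.swap :: nat \<times> nat \<Rightarrow> _)"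
  have \<pi>_in: "\<pi> u \<in> square N" if "u \<in> square N" for u
    using that by (cases u) (simp add: \<pi>_def)
  have t_\<pi>: "t (Q.cl (mon [u] 1)) = Q.cl (mon [\<pi> u] 1)" if "u \<in> square N" for u
    using t that by (auto simp: \<pi>_def Aut_sel(1) tau_cl relabel_mon)
  show thesis
  proof (rule that[of \<pi> "\<lambda>u. \<beta> (fst (\<pi> u)) (snd (\<pi> u))"])
    show "\<pi> = id \<or> \<pi> = prod.swap" by (simp add: \<pi>_def)
    fix u assume u: "u \<in> square N"
    obtain i j where ij: "\<pi> u = (i, j)" by (cases "\<pi> u")
    have "(i, j) \<in> square N" using \<pi>_in[OF u] ij by simp
    note b = \<beta>[OF this]
    show "\<beta> (fst (\<pi> u)) (snd (\<pi> u)) \<noteq> 0" using b ij by simp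
    show "\<phi> (Q.cl (mon [u] 1)) = Q.cl (mon [\<pi> u] (\<beta> (fst (\<pi> u)) (snd (\<pi> u))))"
      unfolding \<phi> Aut_sel(2)[OF h_Aut t_Aut] using u b ij t_\<pi>[OF u] by (simp add: compose_def)
  qed
qed

end

context generic_quantum_matrices
begin

text \<open>
  The relation \<open>gx = \<lambda>xg\<close> holds since each step of \<open>\<sigma>\<close> multiplies the weight by \<open>\<lambda>\<close>.
\<close>

lemma action_from_pattern:
  assumes r: "realized lam \<alpha> S \<delta> \<sigma> d"
    and lam: "lam \<noteq> 0" "mult_ord lam = m" "m \<ge> 2" and n: "n > 0" "q ^ n = 1"
  shows "\<exists>\<rho>. linear_taft_action q N n lam m \<rho> \<and> (\<forall>u\<in>square N.
      \<rho> (taft_g n lam m) (Q.cl (mon [u] 1)) = Q.cl (mon [u] (\<alpha> u)) \<and>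
      \<rho> (taft_x n lam m) (Q.cl (mon [u] 1)) = Q.cl (linear_form (\<lambda>w. if (u, w) \<in> S then \<delta> else 0)))"
proof -
  let ?\<gamma> = "\<lambda>u. mon [u] (\<alpha> u)" and ?d = "\<lambda>u. mon [\<sigma> u] (d u)"
  let ?G = "hom_ext ?\<gamma>" and ?D = "skew_ext ?\<gamma> ?d"
  note parts = r[unfolded realized_def]
  note stable = parts[THEN conjunct1]
    and weights = parts[THEN conjunct2, THEN conjunct1]
    and powers = parts[THEN conjunct2, THEN conjunct2, THEN conjunct1]
    and steps = parts[THEN conjunct2, THEN conjunct2, THEN conjunct2, THEN conjunct1]
    and moved = parts[THEN conjunct2, THEN conjunct2, THEN conjunct2, THEN conjunct2, THEN conjunct1]
    and pairs = parts[THEN conjunct2, THEN conjunct2, THEN conjunct2, THEN conjunct2, THEN conjunct2, THEN conjunct1]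
    and value_\<delta> = parts[THEN conjunct2, THEN conjunct2, THEN conjunct2, THEN conjunct2, THEN conjunct2, THEN conjunct2]
  from weights obtain r' s where rs': "\<forall>u\<in>square N. \<alpha> u = r' (fst u) * s (snd u)" by blast
  then have rs: "\<alpha> u = r' (fst u) * s (snd u)" if "u \<in> square N" for u using that by blast
  have pow: "\<exists>k::int. \<alpha> u = q powi k" if "u \<in> square N" for u using powers that by blast
  have nz: "\<alpha> u \<noteq> 0" if "u \<in> square N" for u using pow[OF that] q_nonzero by auto
  have \<alpha>_n: "\<alpha> u ^ n = 1" if u: "u \<in> square N" for u
  proof -
    obtain k :: int where "\<alpha> u = q powi k" using pow[OF u] by blast
    then have "\<alpha> u ^ n = (q ^ n) powi k" by (simp add: mult.commute flip: power_int_mult power_int_of_nat)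
    then show ?thesis using n by simp
  qed
  have \<sigma>: "\<sigma> u \<in> square N" "\<alpha> (\<sigma> u) = lam * \<alpha> u" "d (\<sigma> u) = 0" if "u \<in> square N" "d u \<noteq> 0" for u
    using steps that by auto
  have rank: "rank_one_weights \<alpha>" by (rule rank_one_product[of _ r' s]) (use rs nz in auto)
  have in_C: "?\<gamma> u \<in> Q.C" "?d u \<in> Q.C" if "u \<in> square N" for u
    using that \<sigma>(1)[OF that] by (cases "d u = 0"; simp)+
  have Gd: "?G (?d u) = (lam * \<alpha> u) \<cdot> ?d u" and Dd: "?D (?d u) = 0" if "u \<in> square N" for u
    using \<sigma>(2,3)[OF that] by (cases "d u = 0"; simp add: hom_ext_mon skew_ext_mon mult_ac linmap_zero)+
  have m: "m > 0" using lam by simp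
  interpret op: taft_operators n m lam "square N" "qmat_rels q N" ?\<gamma> ?d
  proof unfold_locales
    show "?G r \<in> Q.I" "?D r \<in> Q.I" if "r \<in> qmat_rels q N" for r
      using rank_one_hom_ext[OF rank that] stable Q.I_rel[OF that] unfolding stable_def by blast+
    show "(?G ^^ n) f = f" if "f \<in> Q.C" for f
      by (rule weights_power[OF \<alpha>_n that])
    show "(?D ^^ m) f = 0" if "f \<in> Q.C" for f
      by (rule skew_ext_nilpotent[OF _ root_of_unity_sum[OF lam] m that, where a = \<alpha>]) (simp add: Gd Dd)
    show "?G (?D f) = lam \<cdot> ?D (?G f)" if "f \<in> Q.C" for f
      by (rule skew_ext_commute[OF _ that]) (simp add: Gd, simp add: skew_ext_mon mult_ac)
  qed (use m in_C in auto)
  have gen: "op.rho (taft_g n lam m) (Q.cl (mon [u] 1)) = Q.cl (?\<gamma> u)"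
    "op.rho (taft_x n lam m) (Q.cl (mon [u] 1)) = Q.cl (?d u)" if "u \<in> square N" for u
    using that by (simp_all add: op.rho_gx hom_ext_mon skew_ext_mon)
  have form: "?d u = linear_form (\<lambda>w. if (u, w) \<in> S then \<delta> else 0)" if u: "u \<in> square N" for u
  proof (cases "d u = 0")
    case True
    have "linear_form (\<lambda>w. if (u, w) \<in> S then \<delta> else 0) = linear_form (\<lambda>w. 0)"
      by (rule linear_form_cong) (use pairs u True in simp)
    then show ?thesis using True by (simp add: linear_form_zero)
  next
    case False
    have "linear_form (\<lambda>w. if (u, w) \<in> S then \<delta> else 0) = linear_form (\<lambda>w. if w = \<sigma> u then d u else 0)"
      by (rule linear_form_cong) (use pairs value_\<delta> u False in auto)
    then show ?thesis using linear_form_single[OF \<sigma>(1)[OF u False]] by simp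
  qed
  have "linear_taft_action q N n lam m op.rho"
    unfolding linear_taft_action_def qmat_B
  proof (intro conjI)
    show "module_algebra (taft n lam m) Q.B op.rho" by (rule op.module_algebra_rho)
    have "?D (linear_form c) \<in> range linear_form" for c
    proof -
      have "?D (linear_form c) = (\<Sum>w\<in>square N. c w \<cdot> ?d w)"
        unfolding linear_form_def by (simp add: linmap_sum skew_ext_mon)
      also have "\<dots> \<in> range linear_form"
        by (intro lsubspace_sum[OF lsubspace_linear_forms] lsubspace_scale[OF lsubspace_linear_forms])
          (simp add: form)
      finally show ?thesis .
    qed
    then have "Q.cl (?D (linear_form c)) \<in> qY_span q N" for c
      unfolding qY_span_linear_forms by (metis (no_types, lifting) image_iff rangeI)
    then show "op.rho (taft_x n lam m) ` qY_span q N \<subseteq> qY_span q N"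
      by (simp add: qY_span_linear_forms image_subset_iff op.rho_gx linear_form_in)
    obtain u where u: "u \<in> square N" "d u \<noteq> 0" using moved by blast
    have "Q.cl (?d u) \<noteq> Q.cl 0"
    proof
      assume "Q.cl (?d u) = Q.cl 0"
      then have "Q.cl (linear_form (\<lambda>w. if w = \<sigma> u then d u else 0)) = Q.cl (linear_form (\<lambda>w. 0))"
        using linear_form_single[OF \<sigma>(1)[OF u]] by (simp add: linear_form_zero)
      from linear_form_cl_eq[OF this \<sigma>(1)[OF u]] show False using u by simp
    qed
    then show "\<exists>a\<in>carrier Q.B. op.rho (taft_x n lam m) a \<noteq> \<zero>\<^bsub>Q.B\<^esub>"
      using u by (intro bexI[of _ "Q.cl (mon [u] 1)"]) (simp_all add: gen Q.B_zero)
    have Gk: "(?G ^^ k) f \<in> Q.C" if "f \<in> Q.C" for k f using that by (induction k) (simp_all add: op.GD_in)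
    have GI: "(?G ^^ k) f \<in> Q.I" if "f \<in> Q.I" for k f using that by (induction k) (simp_all add: op.GD_I)
    obtain l where l: "n = Suc l" using n by (cases n) auto
    have Gn: "(?G ^^ l) (?G f) = f" "?G ((?G ^^ l) f) = f" if "f \<in> Q.C" for f
    proof -
      have "(?G ^^ Suc l) f = f" using op.G_pow[OF that] l by simp
      then show "(?G ^^ l) (?G f) = f" "?G ((?G ^^ l) f) = f"
        by (simp_all add: funpow_swap1)
    qed
    have "op.rho (taft_g n lam m) \<in> carrier Q.B \<rightarrow>\<^sub>E carrier Q.B"
      by (rule PiE_mem[OF op.module_algebra_rho[unfolded module_algebra_def op.taft_sel, THEN conjunct1] op.gx_carrier(1)])
    then have Aut: "op.rho (taft_g n lam m) \<in> carrier Aut"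
      by (intro alg_Aut_memI[where \<gamma> = ?\<gamma> and K = "?G ^^ l"])
        (simp_all add: PiE_iff op.rho_gx op.GD_in linmap_funpow Gk GI Gn)
    have "(i, 1) \<in> square N" "(1, i) \<in> square N" if "i \<in> {1..N}" for i using that by auto
    then have "r' i \<noteq> 0" "s i \<noteq> 0" if "i \<in> {1..N}" for i
      using that nz rs by (metis fst_conv mult_zero_left, metis snd_conv mult_zero_right)
    then show "op.rho (taft_g n lam m) \<in> qmat_torus_transp q N"
      using N_ge by (intro torus_memI[OF Aut, of r' s]) (simp_all add: gen rs)
  qed
  then show ?thesis
    using gen form by (intro exI[of _ op.rho]) simp
qed

text \<open>
  An action gives a skew derivation and a homomorphism that respect the ideal. The three-term
  relation, rescaled by \<open>g\<close>, forces the \<open>2 \<times> 2\<close> minors of the weights to vanish because \<open>q \<noteq> q\<^sup>-\<^sup>1\<close>.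
\<close>

lemma action_data:
  assumes act: "linear_taft_action q N n lam m \<rho>" and "m > 0" and lam: "lam ^ 2 \<noteq> 1"
  obtains \<alpha> c where "stable (\<lambda>u. mon [u] (\<alpha> u)) (\<lambda>u. linear_form (c u))" "rank_one_weights \<alpha>"
    "\<And>u w. u \<in> square N \<Longrightarrow> w \<in> square N \<Longrightarrow> c u w \<noteq> 0 \<Longrightarrow> \<alpha> w = lam * \<alpha> u"
    "\<And>u. u \<in> square N \<Longrightarrow> \<alpha> u ^ n = 1" "\<exists>u\<in>square N. \<exists>w\<in>square N. c u w \<noteq> 0"
    "\<And>u. u \<in> square N \<Longrightarrow> \<rho> (taft_g n lam m) (Q.cl (mon [u] 1)) = Q.cl (mon [u] (\<alpha> u))"
    "\<And>u. u \<in> square N \<Longrightarrow> \<rho> (taft_x n lam m) (Q.cl (mon [u] 1)) = Q.cl (linear_form (c u))"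
proof -
  interpret ma: taft_module_algebra n m lam "square N" "qmat_rels q N" \<rho>
    using act \<open>m > 0\<close> by unfold_locales (simp_all add: linear_taft_action_def qmat_B)
  note act = act[unfolded linear_taft_action_def]
  have "\<rho> ma.gT \<in> qmat_torus_transp q N" using act by blast
  then obtain \<pi> \<alpha> where \<pi>: "\<pi> = id \<or> \<pi> = prod.swap" and \<alpha>: "\<And>u. u \<in> square N \<Longrightarrow> \<alpha> u \<noteq> 0"
    and g: "\<And>u. u \<in> square N \<Longrightarrow> \<rho> ma.gT (Q.cl (mon [u] 1)) = Q.cl (mon [\<pi> u] (\<alpha> u))"
    by (rule torus_transpE) metis
  have \<pi>_in: "\<pi> u \<in> square N" if "u \<in> square N" for u using that \<pi> by (cases u) auto
  have \<pi>\<pi>: "\<pi> (\<pi> u) = u" for u using \<pi> by auto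
  have "\<exists>c. \<rho> ma.xT (Q.cl (mon [u] 1)) = Q.cl (linear_form c)" if u: "u \<in> square N" for u
  proof -
    have "Q.cl (mon [u] 1) \<in> qY_span q N"
      unfolding qY_span_linear_forms using mon_linear_form[OF u, of 1] by auto
    then have "\<rho> ma.xT (Q.cl (mon [u] 1)) \<in> qY_span q N" using act by blast
    then show ?thesis unfolding qY_span_linear_forms by blast
  qed
  then obtain c where x: "\<And>u. u \<in> square N \<Longrightarrow> \<rho> ma.xT (Q.cl (mon [u] 1)) = Q.cl (linear_form (c u))"
    by metis
  let ?\<gamma> = "\<lambda>u. mon [\<pi> u] (\<alpha> u)" and ?d = "\<lambda>u. linear_form (c u)"
  let ?G = "hom_ext ?\<gamma>" and ?D = "skew_ext ?\<gamma> ?d"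
  have in_C: "?\<gamma> u \<in> Q.C" "?d u \<in> Q.C" if "u \<in> square N" for u
    using \<pi>_in[OF that] by (simp_all add: linear_form_in)
  have gx: "\<rho> ma.gT (Q.cl f) = Q.cl (?G f)" "\<rho> ma.xT (Q.cl f) = Q.cl (?D f)" if "f \<in> Q.C" for f
    using ma.rho_gx_ext[of ?\<gamma> ?d, OF in_C g x that] by simp_all
  have I: "?G f \<in> Q.I" "?D f \<in> Q.I" if f: "f \<in> Q.I" for f
  proof -
    have "Q.cl f = Q.cl 0" using f by (simp add: Q.cl_eq_iff)
    then have "Q.cl (?G f) = Q.cl (?G 0)" "Q.cl (?D f) = Q.cl (?D 0)"
      using gx[OF Q.I_sub[OF f]] gx[of 0] by simp_all
    then show "?G f \<in> Q.I" "?D f \<in> Q.I" by (simp_all add: Q.cl_eq_iff linmap_zero)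
  qed
  then have stable: "stable ?\<gamma> ?d" by (simp add: stable_def)
  have comm: "\<alpha> w * c u w = lam * \<alpha> u * c (\<pi> u) (\<pi> w)" if u: "u \<in> square N" and w: "w \<in> square N" for u w
  proof -
    have "\<rho> ma.gT (\<rho> ma.xT (Q.cl (mon [u] 1))) = lam \<odot>\<^bsub>Q.B\<^esub> \<rho> ma.xT (\<rho> ma.gT (Q.cl (mon [u] 1)))"
      by (rule ma.rho_gx_commute) (simp add: u)
    moreover have "\<rho> ma.gT (\<rho> ma.xT (Q.cl (mon [u] 1))) = Q.cl (?G (?d u))"
      by (simp only: x[OF u] gx(1)[OF linear_form_in])
    moreover have "?G (?d u) = (\<Sum>w\<in>square N. mon [\<pi> w] (c u w * \<alpha> w))"
      unfolding linear_form_def by (simp add: linmap_sum hom_ext_mon)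
    moreover have "\<dots> = (\<Sum>w\<in>square N. mon [w] (c u (\<pi> w) * \<alpha> (\<pi> w)))"
      by (rule sum.reindex_bij_witness[of _ \<pi> \<pi>]) (simp_all add: \<pi>\<pi> \<pi>_in)
    moreover have "lam \<odot>\<^bsub>Q.B\<^esub> \<rho> ma.xT (\<rho> ma.gT (Q.cl (mon [u] 1))) = Q.cl ((lam * \<alpha> u) \<cdot> ?d (\<pi> u))"
      by (simp only: g[OF u] gx(2)[OF in_C(1)[OF u]]) (simp add: skew_ext_mon Q.B_smult)
    ultimately have "Q.cl (linear_form (\<lambda>w. c u (\<pi> w) * \<alpha> (\<pi> w))) = Q.cl (linear_form (\<lambda>w. lam * \<alpha> u * c (\<pi> u) w))"
      by (simp add: linear_form_def scale_sum)
    from linear_form_cl_eq[OF this \<pi>_in[OF w]] show ?thesis by (simp add: \<pi>\<pi> mult.commute)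
  qed
  have nonzero: "\<exists>u\<in>square N. \<exists>w\<in>square N. c u w \<noteq> 0"
  proof (rule ccontr)
    assume "\<not> ?thesis"
    then have "?d u = 0" if "u \<in> square N" for u
      using that linear_form_cong[of "c u" "\<lambda>w. 0"] by (simp add: linear_form_zero)
    then have "skew_word ?\<gamma> ?d w = 0" if "set w \<subseteq> square N" for w
      using that by (induction w) (simp_all add: linmap_zero)
    then have word: "skew_word ?\<gamma> ?d w = 0" if "w \<in> supp f" "f \<in> Q.C" for f w
      using supp_formal_sums[OF that(2,1)] by (simp add: lists_eq_set)
    have "?D f = 0" if "f \<in> Q.C" for f
      unfolding skew_ext_def by (subst lin_cong[of f _ "\<lambda>w. 0", OF word[OF _ that]]) simp_all
    then have "\<rho> ma.xT a = \<zero>\<^bsub>Q.B\<^esub>" if "a \<in> carrier Q.B" for a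
      using that by (elim Q.B_cases) (simp add: gx Q.B_zero)
    then show False using act by (auto simp: qmat_B)
  qed
  have "\<pi> \<noteq> prod.swap"
  proof
    assume "\<pi> = prod.swap"
    then have "c u w = 0" if "u \<in> square N" "w \<in> square N" for u w
      using no_transposed_action[of \<alpha> c, OF _ \<alpha> _ lam that] stable comm by simp
    then show False using nonzero by blast
  qed
  then have id: "\<pi> u = u" for u using \<pi> by auto
  have minor: "\<alpha> (i, j) * \<alpha> (k, l) = \<alpha> (i, l) * \<alpha> (k, j)" if in_N: "{i, j, k, l} \<subseteq> {1..N}" and "i < k" "j < l" for i j k l
  proof -
    let ?r = "mon [(i, j), (k, l)] 1 - mon [(k, l), (i, j)] 1 - mon [(i, l), (k, j)] (q - inverse q)"
    have "nf (?G ?r) = 0"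
      by (rule nf_I, rule I(1), rule Q.I_rel, rule qmat_rels_I(3)[OF in_N that(2,3)])
    then have "cf (nf (?G ?r)) [(k, j), (i, l)] = 0" by simp
    then have "(q - inverse q) * (\<alpha> (i, j) * \<alpha> (k, l)) = (q - inverse q) * (\<alpha> (i, l) * \<alpha> (k, j))"
      using that(2,3)
      by (simp add: id linmap_diff hom_ext_mon conv_mon nf_mon nf2_def lookup_minus lookup_add lookup_single mult_ac)
    then show ?thesis using q_gap(1) by simp
  qed
  have "rank_one_weights \<alpha>"
    unfolding rank_one_weights_def
  proof (intro conjI ballI allI impI)
    fix i j k l assume in_N: "{i, j, k, l} \<subseteq> {1..N}"
    then have perm: "{i, l, k, j} \<subseteq> {1..N}" "{k, j, i, l} \<subseteq> {1..N}" "{k, l, i, j} \<subseteq> {1..N}" by auto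
    consider "i = k \<or> j = l" | "i < k" "j < l" | "i < k" "l < j" | "k < i" "j < l" | "k < i" "l < j" by linarith
    then show "\<alpha> (i, j) * \<alpha> (k, l) = \<alpha> (i, l) * \<alpha> (k, j)"
    proof cases
      case 1
      then show ?thesis by (auto simp: mult.commute)
    next
      case 2
      then show ?thesis using minor[OF in_N] by simp
    next
      case 3
      then show ?thesis using minor[OF perm(1)] by simp
    next
      case 4
      then show ?thesis using minor[OF perm(2)] by (simp add: mult.commute)
    next
      case 5
      then show ?thesis using minor[OF perm(3)] by (simp add: mult.commute)
    qed
  qed (rule \<alpha>)
  moreover have "\<alpha> u ^ n = 1" if u: "u \<in> square N" for u
  proof -
    have "(\<rho> ma.gT ^^ k) (Q.cl (mon [u] 1)) = Q.cl (mon [u] (\<alpha> u ^ k))" for k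
      using u by (induction k) (simp_all add: gx hom_ext_mon id mult.commute)
    then have "Q.cl (mon [u] (\<alpha> u ^ n)) = Q.cl (mon [u] 1)"
      using ma.rho_g_pow[of "Q.cl (mon [u] 1)"] u by simp
    then show ?thesis
      using linear_form_cl_eq[of "\<lambda>w. if w = u then \<alpha> u ^ n else 0" "\<lambda>w. if w = u then 1 else 0", OF _ u]
      by (simp add: linear_form_single[OF u])
  qed
  moreover have "\<alpha> w = lam * \<alpha> u" if "u \<in> square N" "w \<in> square N" "c u w \<noteq> 0" for u w
    using comm[OF that(1,2)] that(3) by (simp add: id)
  ultimately show thesis
    using that[of \<alpha> c] stable nonzero g x by (simp add: id)
qed

end

section \<open>The listed actions\<close>

context generic_quantum_matrices
begin

text \<open>
  The listed actions are given by functions of \<open>i\<close> and \<open>j\<close>, the patterns by sets of pairs; this relation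
  says that both describe the same values of \<open>g\<close> and \<open>x\<close> on the generators.
\<close>

definition matches where
  "matches \<alpha>' v \<alpha> S \<delta> \<longleftrightarrow> (\<forall>i\<in>{1..N}. \<forall>j\<in>{1..N}. \<alpha>' i j = \<alpha> (i, j) \<and>
     v i j = Q.cl (linear_form (\<lambda>w. if ((i, j), w) \<in> S then \<delta> else 0)))"

lemma matchesI:
  assumes "\<And>i j. i \<in> {1..N} \<Longrightarrow> j \<in> {1..N} \<Longrightarrow> \<alpha>' i j = \<alpha> (i, j)"
    and t: "\<And>i j. i \<in> {1..N} \<Longrightarrow> j \<in> {1..N} \<Longrightarrow> P i j \<Longrightarrow> s i j \<in> {1..N} \<and> t i j \<in> {1..N}"
    and S: "\<And>i j k l. {i, j, k, l} \<subseteq> {1..N} \<Longrightarrow> ((i, j), (k, l)) \<in> S \<longleftrightarrow> P i j \<and> k = s i j \<and> l = t i j"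
  shows "matches \<alpha>' (\<lambda>i j. if P i j then \<delta> \<odot>\<^bsub>qmat q N\<^esub> qY q N (s i j) (t i j) else \<zero>\<^bsub>qmat q N\<^esub>) \<alpha> S \<delta>"
  unfolding matches_def
proof (intro ballI conjI)
  fix i j assume ij: "i \<in> {1..N}" "j \<in> {1..N}"
  show "\<alpha>' i j = \<alpha> (i, j)" using assms(1) ij .
  have form: "linear_form (\<lambda>w. if ((i, j), w) \<in> S then \<delta> else 0)
      = linear_form (\<lambda>w. if P i j \<and> w = (s i j, t i j) then \<delta> else 0)"
  proof (rule linear_form_cong)
    fix w assume "w \<in> square N"
    then show "(if ((i, j), w) \<in> S then \<delta> else 0) = (if P i j \<and> w = (s i j, t i j) then \<delta> else 0)"
      using S[of i j "fst w" "snd w"] ij by (cases w) auto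
  qed
  show "(if P i j then \<delta> \<odot>\<^bsub>qmat q N\<^esub> qY q N (s i j) (t i j) else \<zero>\<^bsub>qmat q N\<^esub>)
      = Q.cl (linear_form (\<lambda>w. if ((i, j), w) \<in> S then \<delta> else 0))"
  proof (cases "P i j")
    case True
    then have "(s i j, t i j) \<in> square N" using t ij by simp
    from linear_form_single[OF this, of \<delta>] True show ?thesis
      unfolding form by (simp add: qmat_B qY_cl Q.B_smult)
  next
    case False
    then show ?thesis unfolding form by (simp add: qmat_B Q.B_zero linear_form_zero)
  qed
qed

lemma matches_cong:
  assumes "matches \<alpha>' v \<alpha> S \<delta>" "\<And>u. u \<in> square N \<Longrightarrow> \<beta> u = \<alpha> u"
  shows "matches \<alpha>' v \<beta> S \<delta>"
  using assms by (simp add: matches_def)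

lemma mem_transpose_pairs: "((i, j), (k, l)) \<in> transpose_pairs S \<longleftrightarrow> ((j, i), (l, k)) \<in> S"
proof
  assume "((j, i), (l, k)) \<in> S"
  then show "((i, j), (k, l)) \<in> transpose_pairs S" by (rule image_eqI[rotated]) simp
qed auto

lemma q_powers:
  "q powi (-1) = inverse q" "q powi (-2) = inverse (q ^ 2)" "q powi (-3) = inverse (q ^ 2) * inverse q"
  "inverse (q ^ 2) * q = inverse q" "q ^ 2 * inverse q = q" "q ^ 2 * q = q ^ 3"
proof -
  have "q powi (-3) = inverse (q ^ 3)" by (simp add: power_int_minus)
  also have "q ^ 3 = q ^ 2 * q" by (simp add: power3_eq_cube power2_eq_square)
  finally show "q powi (-3) = inverse (q ^ 2) * inverse q" by (simp only: inverse_mult_distrib)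
qed (use q_nonzero in \<open>simp_all add: power_int_minus power2_eq_square power3_eq_cube\<close>)

lemma N_neq: "N \<noteq> Suc 0" "Suc 0 \<noteq> N" "0 < N"
  using N_ge by auto

lemma listed_matches:
  assumes "1 \<le> b" "b < N"
  shows "matches (\<lambda>i j. if j = b then q else if j = b + 1 then q powi (-1) else 1)
      (\<lambda>i j. if j = b then \<delta> \<odot>\<^bsub>qmat q N\<^esub> qY q N i (b + 1) else \<zero>\<^bsub>qmat q N\<^esub>)
      (wcol q b) ((\<lambda>a. ((a, b), (a, Suc b))) ` {1..N}) \<delta>"
    and "matches (\<lambda>i j. if j = b then q else if j = b + 1 then q powi (-1) else 1)
      (\<lambda>i j. if j = b + 1 then \<delta> \<odot>\<^bsub>qmat q N\<^esub> qY q N i b else \<zero>\<^bsub>qmat q N\<^esub>)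
      (wcol q b) ((\<lambda>a. ((a, Suc b), (a, b))) ` {1..N}) \<delta>"
    and "matches (\<lambda>i j. if i = b then q else if i = b + 1 then q powi (-1) else 1)
      (\<lambda>i j. if i = b then \<delta> \<odot>\<^bsub>qmat q N\<^esub> qY q N (b + 1) j else \<zero>\<^bsub>qmat q N\<^esub>)
      (wcol q b \<circ> prod.swap) (transpose_pairs ((\<lambda>a. ((a, b), (a, Suc b))) ` {1..N})) \<delta>"
    and "matches (\<lambda>i j. if i = b then q else if i = b + 1 then q powi (-1) else 1)
      (\<lambda>i j. if i = b + 1 then \<delta> \<odot>\<^bsub>qmat q N\<^esub> qY q N b j else \<zero>\<^bsub>qmat q N\<^esub>)
      (wcol q b \<circ> prod.swap) (transpose_pairs ((\<lambda>a. ((a, Suc b), (a, b))) ` {1..N})) \<delta>"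
  by (rule matchesI; use assms in \<open>auto simp: mem_transpose_pairs wcol_def q_powers(1)\<close>)+

lemma listed_matches_corner:
  "matches (\<lambda>i j. if i = 1 then ends N (q powi (-3)) (q powi (-2)) (q powi (-1)) j else ends N (q powi (-1)) 1 q j)
    (\<lambda>i j. if i = 1 \<and> j = 1 then \<delta> \<odot>\<^bsub>qmat q N\<^esub> qY q N 1 N else \<zero>\<^bsub>qmat q N\<^esub>)
    (wtop q N) {((1, 1), (1, N))} \<delta>"
  "matches (\<lambda>i j. if j = 1 then ends N (q powi (-3)) (q powi (-2)) (q powi (-1)) i else ends N (q powi (-1)) 1 q i)
    (\<lambda>i j. if i = 1 \<and> j = 1 then \<delta> \<odot>\<^bsub>qmat q N\<^esub> qY q N N 1 else \<zero>\<^bsub>qmat q N\<^esub>)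
    (wtop q N \<circ> prod.swap) (transpose_pairs {((1, 1), (1, N))}) \<delta>"
  "matches (\<lambda>i j. if j = N then ends N q (q ^ 2) (q ^ 3) i else ends N (q powi (-1)) 1 q i)
    (\<lambda>i j. if i = N \<and> j = N then \<delta> \<odot>\<^bsub>qmat q N\<^esub> qY q N 1 N else \<zero>\<^bsub>qmat q N\<^esub>)
    (wbot q N \<circ> prod.swap) (transpose_pairs {((N, N), (N, 1))}) \<delta>"
  "matches (\<lambda>i j. if i = N then ends N q (q ^ 2) (q ^ 3) j else ends N (q powi (-1)) 1 q j)
    (\<lambda>i j. if i = N \<and> j = N then \<delta> \<odot>\<^bsub>qmat q N\<^esub> qY q N N 1 else \<zero>\<^bsub>qmat q N\<^esub>)
    (wbot q N) {((N, N), (N, 1))} \<delta>"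
  by (rule matchesI; use N_neq in \<open>auto simp: mem_transpose_pairs wtop_def wbot_def ends_def q_powers\<close>)+

lemma col_pattern_listed:
  assumes "col_pattern lam \<beta> S'" "\<delta> \<noteq> 0"
  shows "\<beta> = \<alpha> \<Longrightarrow> S' = S \<Longrightarrow> \<exists>\<alpha>' v. listed q N lam \<alpha>' v \<and> matches \<alpha>' v \<alpha> S \<delta>"
    and "\<beta> = \<alpha> \<circ> prod.swap \<Longrightarrow> S' = transpose_pairs S \<Longrightarrow> \<exists>\<alpha>' v. listed q N lam \<alpha>' v \<and> matches \<alpha>' v \<alpha> S \<delta>"
proof -
  from assms(1) consider
      (right) b where "1 \<le> b" "b < N" "\<forall>u\<in>square N. \<beta> u = wcol q b u" "lam = inverse (q ^ 2)"
        "S' = (\<lambda>a. ((a, b), (a, Suc b))) ` {1..N}"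
    | (left) b where "1 \<le> b" "b < N" "\<forall>u\<in>square N. \<beta> u = wcol q b u" "lam = q ^ 2"
        "S' = (\<lambda>a. ((a, Suc b), (a, b))) ` {1..N}"
    | (top) "\<forall>u\<in>square N. \<beta> u = wtop q N u" "lam = q ^ 2" "S' = {((1, 1), (1, N))}"
    | (bottom) "\<forall>u\<in>square N. \<beta> u = wbot q N u" "lam = inverse (q ^ 2)" "S' = {((N, N), (N, 1))}"
    unfolding col_pattern_def by blast
  note cases = this
  have sq: "prod.swap u \<in> square N" if "u \<in> square N" for u using that by (cases u) simp
  show "\<exists>\<alpha>' v. listed q N lam \<alpha>' v \<and> matches \<alpha>' v \<alpha> S \<delta>" if eq: "\<beta> = \<alpha>" "S' = S"
    using cases
  proof cases
    case (right b)
    have "listed q N lam (\<lambda>i j. if j = b then q else if j = b + 1 then q powi (-1) else 1)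
      (\<lambda>i j. if j = b then \<delta> \<odot>\<^bsub>qmat q N\<^esub> qY q N i (b + 1) else \<zero>\<^bsub>qmat q N\<^esub>)"
      by (rule listed.col_right) (use right assms(2) q_powers(2) in simp_all)
    moreover note matches_cong[OF listed_matches(1)[OF right(1,2)], of \<alpha> \<delta>]
    ultimately show ?thesis using right(3) unfolding eq right(5)[unfolded eq] by blast
  next
    case (left b)
    have "listed q N lam (\<lambda>i j. if j = b then q else if j = b + 1 then q powi (-1) else 1)
      (\<lambda>i j. if j = b + 1 then \<delta> \<odot>\<^bsub>qmat q N\<^esub> qY q N i b else \<zero>\<^bsub>qmat q N\<^esub>)"
      by (rule listed.col_left[of lam q "b + 1" N \<delta>, unfolded add_diff_cancel_right']) (use left assms(2) in simp_all)
    moreover note matches_cong[OF listed_matches(2)[OF left(1,2)], of \<alpha> \<delta>]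
    ultimately show ?thesis using left(3) unfolding eq left(5)[unfolded eq] by blast
  next
    case top
    from listed.first_to_right[of lam q \<delta> N] matches_cong[OF listed_matches_corner(1), of \<alpha> \<delta>]
    show ?thesis using top(1,2) assms(2) unfolding eq top(3)[unfolded eq] by blast
  next
    case bottom
    from listed.last_to_left[of lam q \<delta> N] matches_cong[OF listed_matches_corner(4), of \<alpha> \<delta>]
    show ?thesis using bottom(1,2) assms(2) unfolding eq bottom(3)[unfolded eq] q_powers(2) by blast
  qed
  show "\<exists>\<alpha>' v. listed q N lam \<alpha>' v \<and> matches \<alpha>' v \<alpha> S \<delta>" if eq: "\<beta> = \<alpha> \<circ> prod.swap" "S' = transpose_pairs S"
  proof -
    have S: "S = transpose_pairs S'" unfolding eq transpose_pairs_twice ..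
    have weights: "\<alpha> u = (w \<circ> prod.swap) u" if "\<forall>u\<in>square N. \<beta> u = w u" "u \<in> square N" for w u
      using that(1)[rule_format, OF sq[OF that(2)]] by (simp add: eq)
    from cases show ?thesis
    proof cases
      case (right b)
      have "listed q N lam (\<lambda>i j. if i = b then q else if i = b + 1 then q powi (-1) else 1)
        (\<lambda>i j. if i = b then \<delta> \<odot>\<^bsub>qmat q N\<^esub> qY q N (b + 1) j else \<zero>\<^bsub>qmat q N\<^esub>)"
        by (rule listed.row_down) (use right assms(2) q_powers(2) in simp_all)
      moreover note matches_cong[OF listed_matches(3)[OF right(1,2)] weights[OF right(3)], of \<delta>]
      ultimately show ?thesis unfolding S right(5) by blast
    next
      case (left b)
      have "listed q N lam (\<lambda>i j. if i = b then q else if i = b + 1 then q powi (-1) else 1)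
        (\<lambda>i j. if i = b + 1 then \<delta> \<odot>\<^bsub>qmat q N\<^esub> qY q N b j else \<zero>\<^bsub>qmat q N\<^esub>)"
        by (rule listed.row_up[of lam q "b + 1" N \<delta>, unfolded add_diff_cancel_right']) (use left assms(2) in simp_all)
      moreover note matches_cong[OF listed_matches(4)[OF left(1,2)] weights[OF left(3)], of \<delta>]
      ultimately show ?thesis unfolding S left(5) by blast
    next
      case top
      from listed.first_to_bottom[of lam q \<delta> N] matches_cong[OF listed_matches_corner(2) weights[OF top(1)], of \<delta>]
      show ?thesis using top(2) assms(2) unfolding S top(3) by blast
    next
      case bottom
      from listed.last_to_top[of lam q \<delta> N] matches_cong[OF listed_matches_corner(3) weights[OF bottom(1)], of \<delta>]
      show ?thesis using bottom(2) assms(2) unfolding S bottom(3) q_powers(2) by blast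
    qed
  qed
qed

lemma pattern_listed:
  assumes "pattern lam \<alpha> S" "\<delta> \<noteq> 0"
  obtains \<alpha>' v where "listed q N lam \<alpha>' v" "matches \<alpha>' v \<alpha> S \<delta>"
proof -
  have "\<exists>\<alpha>' v. listed q N lam \<alpha>' v \<and> matches \<alpha>' v \<alpha> S \<delta>"
    using assms(1) unfolding pattern_def
  proof
    assume "col_pattern lam \<alpha> S"
    then show ?thesis by (rule col_pattern_listed(1)[OF _ assms(2) refl refl])
  next
    assume "col_pattern lam (\<alpha> \<circ> prod.swap) (transpose_pairs S)"
    then show ?thesis by (rule col_pattern_listed(2)[OF _ assms(2) refl refl])
  qed
  then show thesis using that by blast
qed

lemma col_pattern_examples:
  "1 \<le> b \<Longrightarrow> b < N \<Longrightarrow> col_pattern (inverse (q ^ 2)) (wcol q b) ((\<lambda>a. ((a, b), (a, Suc b))) ` {1..N})"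
  "1 \<le> b \<Longrightarrow> b < N \<Longrightarrow> col_pattern (q ^ 2) (wcol q b) ((\<lambda>a. ((a, Suc b), (a, b))) ` {1..N})"
  "col_pattern (q ^ 2) (wtop q N) {((1, 1), (1, N))}"
  "col_pattern (inverse (q ^ 2)) (wbot q N) {((N, N), (N, 1))}"
  unfolding col_pattern_def by blast+

lemma pattern_intros:
  "col_pattern lam \<alpha> S \<Longrightarrow> pattern lam \<alpha> S"
  "col_pattern lam \<alpha> S \<Longrightarrow> pattern lam (\<alpha> \<circ> prod.swap) (transpose_pairs S)"
  unfolding pattern_def transpose_pairs_twice by (simp_all add: comp_assoc)

lemma listed_pattern:
  assumes "listed q N lam \<alpha>' v"
  obtains \<alpha> S \<delta> where "pattern lam \<alpha> S" "\<delta> \<noteq> 0" "matches \<alpha>' v \<alpha> S \<delta>"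
  using assms
proof cases
  case (col_left b \<delta>)
  then have b: "1 \<le> b - 1" "b - 1 < N" "b - 1 + 1 = b" by auto
  show thesis
    by (rule that[OF pattern_intros(1)[OF col_pattern_examples(2)[OF b(1,2)], folded col_left(3)] col_left(6)
          listed_matches(2)[OF b(1,2), of \<delta>, unfolded b(3), folded col_left(1,2)]])
next
  case (row_up a \<delta>)
  then have a: "1 \<le> a - 1" "a - 1 < N" "a - 1 + 1 = a" by auto
  show thesis
    by (rule that[OF pattern_intros(2)[OF col_pattern_examples(2)[OF a(1,2)], folded row_up(3)] row_up(6)
          listed_matches(4)[OF a(1,2), of \<delta>, unfolded a(3), folded row_up(1,2)]])
next
  case (first_to_right \<delta>)
  show thesis
    by (rule that[OF pattern_intros(1)[OF col_pattern_examples(3), folded first_to_right(3)] first_to_right(4)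
          listed_matches_corner(1)[of \<delta>, folded first_to_right(1,2)]])
next
  case (first_to_bottom \<delta>)
  show thesis
    by (rule that[OF pattern_intros(2)[OF col_pattern_examples(3), folded first_to_bottom(3)] first_to_bottom(4)
          listed_matches_corner(2)[of \<delta>, folded first_to_bottom(1,2)]])
next
  case (col_right b \<delta>)
  show thesis
    by (rule that[OF pattern_intros(1)[OF col_pattern_examples(1)[OF col_right(4,5)], folded q_powers(2) col_right(3)] col_right(6)
          listed_matches(1)[OF col_right(4,5), of \<delta>, folded col_right(1,2)]])
next
  case (row_down a \<delta>)
  show thesis
    by (rule that[OF pattern_intros(2)[OF col_pattern_examples(1)[OF row_down(4,5)], folded q_powers(2) row_down(3)] row_down(6)
          listed_matches(3)[OF row_down(4,5), of \<delta>, folded row_down(1,2)]])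
next
  case (last_to_top \<delta>)
  show thesis
    by (rule that[OF pattern_intros(2)[OF col_pattern_examples(4), folded q_powers(2) last_to_top(3)] last_to_top(4)
          listed_matches_corner(3)[of \<delta>, folded last_to_top(1,2)]])
next
  case (last_to_left \<delta>)
  show thesis
    by (rule that[OF pattern_intros(1)[OF col_pattern_examples(4), folded q_powers(2) last_to_left(3)] last_to_left(4)
          listed_matches_corner(4)[of \<delta>, folded last_to_left(1,2)]])
qed

lemma pattern_parameters:
  assumes "pattern lam \<alpha> S"
  shows "lam = q ^ 2 \<or> lam = inverse (q ^ 2)" "\<exists>u\<in>square N. \<alpha> u = q \<or> \<alpha> u = inverse q"
proof -
  have col: "(lam = q ^ 2 \<or> lam = inverse (q ^ 2)) \<and> (\<exists>u\<in>square N. \<alpha> u = q \<or> \<alpha> u = inverse q)"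
    if c: "col_pattern lam \<alpha> S" for \<alpha> S
  proof -
    have squares: "(1, b) \<in> square N" if "1 \<le> b" "b < N" for b using that by simp
    have corner: "(2, 1) \<in> square N" "(1, 1) \<in> square N" using N_ge by simp_all
    have "wcol q b (1, b) = q" "wtop q N (2, 1) = inverse q" "wbot q N (1, 1) = inverse q" for b
      using N_neq by (simp_all add: wcol_def wtop_def wbot_def)
    with c squares corner show ?thesis unfolding col_pattern_def by metis
  qed
  have "(lam = q ^ 2 \<or> lam = inverse (q ^ 2)) \<and> (\<exists>u\<in>square N. \<alpha> u = q \<or> \<alpha> u = inverse q)"
    using assms unfolding pattern_def
  proof
    assume "col_pattern lam (\<alpha> \<circ> prod.swap) (transpose_pairs S)"
    from col[OF this] obtain u where u: "u \<in> square N" "\<alpha> (prod.swap u) = q \<or> \<alpha> (prod.swap u) = inverse q"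
      and lam: "lam = q ^ 2 \<or> lam = inverse (q ^ 2)" by auto
    have "prod.swap u \<in> square N" using u(1) by (cases u) simp
    with u lam show ?thesis by blast
  qed (rule col)
  then show "lam = q ^ 2 \<or> lam = inverse (q ^ 2)" "\<exists>u\<in>square N. \<alpha> u = q \<or> \<alpha> u = inverse q"
    by blast+
qed

lemma ball_square: "(\<forall>u\<in>square N. P u) \<longleftrightarrow> (\<forall>i\<in>{1..N}. \<forall>j\<in>{1..N}. P (i, j))"
  by (simp add: square_def)

lemma acts_on_gens_iff:
  assumes "matches \<alpha>' v \<alpha> S \<delta>"
  shows "acts_on_gens q N n lam m \<rho> \<alpha>' v \<longleftrightarrow> (\<forall>u\<in>square N.
    \<rho> (taft_g n lam m) (Q.cl (mon [u] 1)) = Q.cl (mon [u] (\<alpha> u)) \<and>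
    \<rho> (taft_x n lam m) (Q.cl (mon [u] 1)) = Q.cl (linear_form (\<lambda>w. if (u, w) \<in> S then \<delta> else 0)))"
  using assms unfolding acts_on_gens_def matches_def qmat_B qY_cl Q.B_smult ball_square by simp

lemma action_pattern:
  assumes "linear_taft_action q N n lam m \<rho>" "m > 0" "lam ^ 2 \<noteq> 1"
  obtains \<alpha> S \<delta> where "pattern lam \<alpha> S" "\<delta> \<noteq> 0" "\<And>u. u \<in> square N \<Longrightarrow> \<alpha> u ^ n = 1"
    "\<And>u. u \<in> square N \<Longrightarrow> \<rho> (taft_g n lam m) (Q.cl (mon [u] 1)) = Q.cl (mon [u] (\<alpha> u)) \<and>
      \<rho> (taft_x n lam m) (Q.cl (mon [u] 1)) = Q.cl (linear_form (\<lambda>w. if (u, w) \<in> S then \<delta> else 0))"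
  using assms
proof (rule action_data)
  fix \<alpha> c
  assume stable: "stable (\<lambda>u. mon [u] (\<alpha> u)) (\<lambda>u. linear_form (c u))" and rank: "rank_one_weights \<alpha>"
    and weights: "\<And>u w. u \<in> square N \<Longrightarrow> w \<in> square N \<Longrightarrow> c u w \<noteq> 0 \<Longrightarrow> \<alpha> w = lam * \<alpha> u"
    and pow: "\<And>u. u \<in> square N \<Longrightarrow> \<alpha> u ^ n = 1"
    and nonzero: "\<exists>u\<in>square N. \<exists>w\<in>square N. c u w \<noteq> 0"
    and g: "\<And>u. u \<in> square N \<Longrightarrow> \<rho> (taft_g n lam m) (Q.cl (mon [u] 1)) = Q.cl (mon [u] (\<alpha> u))"
    and x: "\<And>u. u \<in> square N \<Longrightarrow> \<rho> (taft_x n lam m) (Q.cl (mon [u] 1)) = Q.cl (linear_form (c u))"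
  have "lam \<noteq> 1" using assms(3) by auto
  have entry: "\<exists>S. pattern lam \<alpha> S \<and> (u, w) \<in> S \<and> (\<forall>(u', w')\<in>S. c u' w' = c u w)"
    if "u \<in> square N" "w \<in> square N" "c u w \<noteq> 0" for u w
    by (rule entry[OF stable rank _ \<open>lam \<noteq> 1\<close> that]) (rule weights)
  obtain u\<^sub>0 w\<^sub>0 where u\<^sub>0: "u\<^sub>0 \<in> square N" "w\<^sub>0 \<in> square N" "c u\<^sub>0 w\<^sub>0 \<noteq> 0" using nonzero by blast
  from entry[OF u\<^sub>0] obtain S where S: "pattern lam \<alpha> S" and c_S: "\<forall>(u, w)\<in>S. c u w = c u\<^sub>0 w\<^sub>0" by blast
  have "c u w = (if (u, w) \<in> S then c u\<^sub>0 w\<^sub>0 else 0)" if "u \<in> square N" "w \<in> square N" for u w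
  proof (cases "c u w = 0")
    case False
    from entry[OF that False] obtain S' where "pattern lam \<alpha> S'" "(u, w) \<in> S'" by blast
    with pattern_unique[OF S _ assms(3)] have "(u, w) \<in> S" by blast
    then show ?thesis using c_S by auto
  qed (use c_S u\<^sub>0 in auto)
  then have "linear_form (c u) = linear_form (\<lambda>w. if (u, w) \<in> S then c u\<^sub>0 w\<^sub>0 else 0)" if "u \<in> square N" for u
    using that by (intro linear_form_cong)
  then show thesis
    using that[OF S u\<^sub>0(3) pow] g x by simp
qed

end

theorem proposition4p11:
  fixes q lam :: "'k::{alg_closed_field, field_char_0}" and N m n :: nat
  assumes "q \<noteq> 0" "q \<noteq> 1" "q \<noteq> -1"
    and "N \<ge> 3" "m \<ge> 3"
    and "n > 0" "m dvd n" "lam \<noteq> 0" "mult_ord lam = m"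
  shows
    "((\<exists>\<rho>. linear_taft_action q N n lam m \<rho>) \<longleftrightarrow>
        (lam = q ^ 2 \<or> lam = q powi (-2)) \<and> mult_ord q dvd n)
     \<and> (\<forall>\<rho>. linear_taft_action q N n lam m \<rho> \<longrightarrow>
          (\<exists>\<alpha> v. listed q N lam \<alpha> v \<and> acts_on_gens q N n lam m \<rho> \<alpha> v))
     \<and> (mult_ord q dvd n \<longrightarrow>
          (\<forall>\<alpha> v. listed q N lam \<alpha> v \<longrightarrow>
             (\<exists>!\<rho>. linear_taft_action q N n lam m \<rho> \<and> acts_on_gens q N n lam m \<rho> \<alpha> v)))"
proof -
  have "q ^ 2 \<noteq> 1" using assms(2,3) by (simp add: power2_eq_1_iff)
  then interpret generic_quantum_matrices q N using assms(1,4) by unfold_locales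
  have lam: "lam ^ 2 \<noteq> 1"
    using assms(5) dvd_imp_le[of m 2] unfolding mult_ord_dvd[OF assms(8)] assms(9) by auto
  have m: "m > 0" "m \<ge> 2" using assms(5) by simp_all
  have exists: "\<exists>\<rho>. linear_taft_action q N n lam m \<rho> \<and> acts_on_gens q N n lam m \<rho> \<alpha> v"
    if ord: "mult_ord q dvd n" and listed: "listed q N lam \<alpha> v" for \<alpha> v
  proof -
    obtain \<beta> S \<delta> where pattern: "pattern lam \<beta> S" "\<delta> \<noteq> 0" and match: "matches \<alpha> v \<beta> S \<delta>"
      using listed_pattern[OF listed] by blast
    obtain \<beta>' \<sigma> d where r: "realized lam \<beta>' S \<delta> \<sigma> d" and \<beta>: "\<And>u. u \<in> square N \<Longrightarrow> \<beta> u = \<beta>' u"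
      using pattern_realized[OF pattern] by blast
    have "q ^ n = 1" using ord mult_ord_dvd[OF assms(1)] by blast
    from action_from_pattern[OF r assms(8,9) m(2) assms(6) this] \<beta> show ?thesis
      unfolding acts_on_gens_iff[OF match] by simp
  qed
  have "\<exists>\<alpha> v. listed q N lam \<alpha> v \<and> acts_on_gens q N n lam m \<rho> \<alpha> v"
      and "(lam = q ^ 2 \<or> lam = q powi (-2)) \<and> mult_ord q dvd n"
    if act: "linear_taft_action q N n lam m \<rho>" for \<rho>
  proof -
    obtain \<alpha> S \<delta> where pattern: "pattern lam \<alpha> S" "\<delta> \<noteq> 0" and pow: "\<And>u. u \<in> square N \<Longrightarrow> \<alpha> u ^ n = 1"
      and gen: "\<And>u. u \<in> square N \<Longrightarrow> \<rho> (taft_g n lam m) (Q.cl (mon [u] 1)) = Q.cl (mon [u] (\<alpha> u)) \<and>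
        \<rho> (taft_x n lam m) (Q.cl (mon [u] 1)) = Q.cl (linear_form (\<lambda>w. if (u, w) \<in> S then \<delta> else 0))"
      using action_pattern[OF act m(1) lam] by blast
    obtain \<alpha>' v where listed: "listed q N lam \<alpha>' v" and match: "matches \<alpha>' v \<alpha> S \<delta>"
      using pattern_listed[OF pattern] by blast
    have "acts_on_gens q N n lam m \<rho> \<alpha>' v" unfolding acts_on_gens_iff[OF match] using gen by blast
    then show "\<exists>\<alpha> v. listed q N lam \<alpha> v \<and> acts_on_gens q N n lam m \<rho> \<alpha> v" using listed by blast
    from pattern_parameters(2)[OF pattern(1)] obtain u where "u \<in> square N" "\<alpha> u = q \<or> \<alpha> u = inverse q" by blast
    then have "q ^ n = 1" using pow[of u] by (auto simp: power_inverse)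
    then show "(lam = q ^ 2 \<or> lam = q powi (-2)) \<and> mult_ord q dvd n"
      using pattern_parameters(1)[OF pattern(1)] mult_ord_dvd[OF assms(1)] unfolding q_powers(2) by blast
  qed
  moreover have "\<exists>\<alpha> v. listed q N lam \<alpha> v" if "lam = q ^ 2 \<or> lam = q powi (-2)"
    using that listed.col_left[of lam q 2 N 1] listed.col_right[of lam q 1 N 1] N_ge by fastforce
  moreover have "\<exists>!\<rho>. linear_taft_action q N n lam m \<rho> \<and> acts_on_gens q N n lam m \<rho> \<alpha> v"
    if "mult_ord q dvd n" "listed q N lam \<alpha> v" for \<alpha> v
  proof (rule ex_ex1I[OF exists[OF that]])
    fix \<rho> \<rho>'
    assume \<rho>: "linear_taft_action q N n lam m \<rho> \<and> acts_on_gens q N n lam m \<rho> \<alpha> v"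
      and \<rho>': "linear_taft_action q N n lam m \<rho>' \<and> acts_on_gens q N n lam m \<rho>' \<alpha> v"
    have alg: "taft_module_algebra n m lam (square N) (qmat_rels q N) \<rho>''"
      if "linear_taft_action q N n lam m \<rho>''" for \<rho>''
      using that m by unfold_locales (simp_all add: linear_taft_action_def qmat_B)
    show "\<rho> = \<rho>'"
    proof (rule taft_module_algebra_unique[OF alg alg])
      fix u assume "u \<in> square N"
      then obtain i j where u: "u = (i, j)" "i \<in> {1..N}" "j \<in> {1..N}" by (cases u) auto
      have "pres_gen (square N) (qmat_rels q N) u = qY q N i j"
        by (simp add: u Q.pres_gen_cl qY_cl)
      then show "\<rho> (taft_g n lam m) (pres_gen (square N) (qmat_rels q N) u) = \<rho>' (taft_g n lam m) (pres_gen (square N) (qmat_rels q N) u)"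
        "\<rho> (taft_x n lam m) (pres_gen (square N) (qmat_rels q N) u) = \<rho>' (taft_x n lam m) (pres_gen (square N) (qmat_rels q N) u)"
        using \<rho> \<rho>' u(2,3) unfolding acts_on_gens_def by auto
    qed (use \<rho> \<rho>' in auto)
  qed
  ultimately show ?thesis using exists by blast
qed

end
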